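(* Consider the eigenvalue problem $D^4u=\lambda D^2u$ on $-1\le x\le1$ with $u(\pm1)=Du(\pm1)=0$, where $D=d/dx$, and let $n\ge 4$. The Chebyshev ($\gamma=0$) and Legendre ($\gamma=1/2$) tau approximations of degree $n$ have spurious eigenvalues: the Chebyshev tau approximation has a real positive eigenvalue $\lambda$, and the Legendre tau approximation has an infinite eigenvalue, i.e. an eigenvalue $\mu=1/\lambda=0$. On the other hand, the Chebyshev and Legendre inviscid Galerkin approximations of degree $n$, and the Chebyshev and Legendre Galerkin approximations of degree $n$, have eigenvalues that are all real, negative, and distinct.
   Context: For $\gamma>-1/2$ let $W^{(\gamma)}(x)=(1-x^2)^{\gamma-1/2}$ on $(-1,1)$. "Chebyshev" refers to $\gamma=0$ and "Legendre" to $\gamma=1/2$. For an integer $s\in\{0,1,2\}$, consider the finite-dimensional eigenvalue problem: find $\lambda\in\mathbb{C}$ and a nonzero polynomial $u_n(x)$ (complex coefficients, degree at most $n$) such that $u_n(\pm1)=Du_n(\pm1)=0$ and $$\int_{-1}^1\big(\lambda D^2u_n(x)-D^4u_n(x)\big)\,(1-x^2)^s q(x)\,W^{(\gamma)}(x)\,dx=0\quad\text{for all polynomials } q\text{ of degree at most } n-4.$$ The case $s=0$ is the Gegenbauer tau approximation with index $\gamma$; the case $s=1$ is the Gegenbauer inviscid Galerkin approximation with index $\gamma$ (test functions: polynomials of degree at most $n-2$ that vanish at $\pm1$); the case $s=2$ is the Gegenbauer Galerkin approximation with index $\gamma$ (test functions: polynomials of degree at most $n$ that vanish together with their first derivative at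 $\pm1$). Thus the inviscid Galerkin (resp. Galerkin) approximation with index $\gamma$ is the tau approximation with index $\gamma+1$ (resp. $\gamma+2$). The values $\lambda$ are the (finite) eigenvalues. An eigenvalue $\mu=0$ (equivalently $\lambda=\infty$) means that there is a nonzero polynomial $u_n$ of degree at most $n$ with $u_n(\pm1)=Du_n(\pm1)=0$ for which the integral condition holds with $\lambda D^2u_n-D^4u_n$ replaced by $D^2u_n-\mu D^4u_n$ at $\mu=0$. Choosing bases of the $(n-3)$-dimensional trial and test spaces, the problem is a generalized matrix eigenvalue problem $Aa=\lambda Ba$ of size $n-3$; "distinct" means that the roots of $\det(A-\lambda B)$ are all simple. *)

theory Defs
  imports
    "HOL-Analysis.Analysis"
    "HOL-Computational_Algebra.Polynomial"
    "Jordan_Normal_Form.Determinant"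
begin

hide_const (open) Module.module.smult

definition gegenbauer_weight :: "real \<Rightarrow> real \<Rightarrow> real" where
  "gegenbauer_weight \<gamma> x = (1 - x\<^sup>2) powr (\<gamma> - 1/2)"

text \<open>The pairing is bilinear: no complex conjugation is involved.\<close>

definition weighted_integral :: "real \<Rightarrow> complex poly \<Rightarrow> complex poly \<Rightarrow> complex" where
  "weighted_integral \<gamma> f v =
     (LINT x:{-1<..<1}|lborel.
        poly f (complex_of_real x) * poly v (complex_of_real x)
          * complex_of_real (gegenbauer_weight \<gamma> x))"

abbreviation D2 :: "complex poly \<Rightarrow> complex poly" where
  "D2 u \<equiv> (pderiv ^^ 2) u"

abbreviation D4 :: "complex poly \<Rightarrow> complex poly" where
  "D4 u \<equiv> (pderiv ^^ 4) u"

definition trial_space :: "nat \<Rightarrow> complex poly set" where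
  "trial_space n = {u. degree u \<le> n \<and> poly u 1 = 0 \<and> poly u (-1) = 0
                     \<and> poly (pderiv u) 1 = 0 \<and> poly (pderiv u) (-1) = 0}"

text \<open>
  Only meaningful for \<open>n \<ge> 4\<close>, because of the truncated subtraction. The polynomial
  \<open>[:1, 0, -1:]\<close> is \<open>1 - x\<^sup>2\<close>; the values 0, 1, 2 of \<open>s\<close> give the tau, inviscid Galerkin
  and Galerkin methods respectively.
\<close>

definition test_space :: "nat \<Rightarrow> nat \<Rightarrow> complex poly set" where
  "test_space n s = {[:1, 0, -1:] ^ s * q | q. degree q \<le> n - 4}"

definition eigenvalue :: "nat \<Rightarrow> real \<Rightarrow> nat \<Rightarrow> complex \<Rightarrow> bool" where
  "eigenvalue n \<gamma> s l \<longleftrightarrow>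
     (\<exists>u \<in> trial_space n. u \<noteq> 0 \<and>
        (\<forall>v \<in> test_space n s. weighted_integral \<gamma> (smult l (D2 u) - D4 u) v = 0))"

text \<open>
  The problem in terms of \<open>\<mu> = 1/\<lambda>\<close>; it has the eigenvalue \<open>\<mu> = 0\<close> exactly when the
  original problem has the infinite eigenvalue \<open>\<lambda> = \<infinity>\<close>.
\<close>

definition reciprocal_eigenvalue :: "nat \<Rightarrow> real \<Rightarrow> nat \<Rightarrow> complex \<Rightarrow> bool" where
  "reciprocal_eigenvalue n \<gamma> s \<mu> \<longleftrightarrow>
     (\<exists>u \<in> trial_space n. u \<noteq> 0 \<and>
        (\<forall>v \<in> test_space n s. weighted_integral \<gamma> (D2 u - smult \<mu> (D4 u)) v = 0))"

interpretation cpoly: vector_space "smult :: complex \<Rightarrow> complex poly \<Rightarrow> complex poly"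
  by unfold_locales (simp_all add: smult_add_left smult_add_right)

definition is_basis :: "complex poly list \<Rightarrow> complex poly set \<Rightarrow> bool" where
  "is_basis bs V \<longleftrightarrow> distinct bs \<and> cpoly.independent (set bs) \<and> cpoly.span (set bs) = V"

text \<open>
  Rows are indexed by the test basis \<open>\<psi>\<close>, columns by the trial basis \<open>\<phi>\<close>, so that
  \<open>A a = \<lambda> B a\<close> is the problem for the coefficient vector \<open>a\<close> of \<open>u\<close> with respect to \<open>\<phi>\<close>.
\<close>

definition stiffness_matrix ::
  "real \<Rightarrow> complex poly list \<Rightarrow> complex poly list \<Rightarrow> complex Matrix.mat" where
  "stiffness_matrix \<gamma> \<phi> \<psi> =
     Matrix.mat (length \<psi>) (length \<phi>) (\<lambda>(i, j). weighted_integral \<gamma> (D4 (\<phi> ! j)) (\<psi> ! i))"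

definition mass_matrix ::
  "real \<Rightarrow> complex poly list \<Rightarrow> complex poly list \<Rightarrow> complex Matrix.mat" where
  "mass_matrix \<gamma> \<phi> \<psi> =
     Matrix.mat (length \<psi>) (length \<phi>) (\<lambda>(i, j). weighted_integral \<gamma> (D2 (\<phi> ! j)) (\<psi> ! i))"

text \<open>
  \<open>det (A - \<lambda> B)\<close> as a polynomial in the indeterminate \<open>\<lambda> = [:0, 1:]\<close>.
\<close>

definition pencil_det :: "complex Matrix.mat \<Rightarrow> complex Matrix.mat \<Rightarrow> complex poly" where
  "pencil_det A B =
     Determinant.det (map_mat (\<lambda>a. [:a:]) A - [:0, 1:] \<cdot>\<^sub>m map_mat (\<lambda>b. [:b:]) B)"

text \<open>
  Another choice of bases multiplies the determinant by a nonzero constant. \<open>rsquarefree\<close> says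
  that the polynomial is nonzero and that each of its roots is simple.
\<close>

definition distinct_eigenvalues :: "nat \<Rightarrow> real \<Rightarrow> nat \<Rightarrow> bool" where
  "distinct_eigenvalues n \<gamma> s \<longleftrightarrow>
     (\<forall>\<phi> \<psi>. is_basis \<phi> (trial_space n) \<and> is_basis \<psi> (test_space n s) \<longrightarrow>
        rsquarefree (pencil_det (stiffness_matrix \<gamma> \<phi> \<psi>) (mass_matrix \<gamma> \<phi> \<psi>)))"

text \<open>
  Both spaces have bases and dimension \<open>n - 3\<close>, so \<open>distinct_eigenvalues\<close> is a condition on
  square pencils of size \<open>n - 3\<close> and is not vacuous.
\<close>

lemma dvd_if_double_root:
  fixes u :: "complex poly"
  assumes "poly u a = 0" "poly (pderiv u) a = 0"
  shows "[:- a, 1:] ^ 2 dvd u"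
proof -
  obtain w where w: "u = [:- a, 1:] * w"
    using assms(1) by (auto simp: poly_eq_0_iff_dvd elim: dvdE)
  have "poly (pderiv u) a = poly w a"
    unfolding w by (simp add: pderiv_mult pderiv_pCons del: mult_pCons_left)
  with assms(2) have "[:- a, 1:] dvd w" by (simp add: poly_eq_0_iff_dvd)
  then show ?thesis unfolding w power2_eq_square by (rule mult_dvd_mono[OF dvd_refl])
qed

lemma trial_space_eq:
  assumes n: "n \<ge> 4"
  shows "trial_space n = test_space n 2"
proof -
  let ?w = "[:1, 0, -1:] ^ 2 :: complex poly"
  have w: "?w = [:- 1, 1:] ^ 2 * [:- (- 1), 1:] ^ 2"
    by (simp add: power2_eq_square)
  have dw: "degree ?w = 4" by (simp add: power2_eq_square)
  have w0: "?w \<noteq> 0" by simp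
  have "u \<in> test_space n 2" if u: "u \<in> trial_space n" for u
  proof -
    have "[:- 1, 1:] ^ 2 dvd u"
      using u by (intro dvd_if_double_root; simp add: trial_space_def)
    then obtain w where w1: "u = [:- 1, 1:] ^ 2 * w" by (elim dvdE)
    have "poly w (-1) = 0"
      using u unfolding trial_space_def w1 by simp
    moreover from this have "poly (pderiv w) (-1) = 0"
      using u unfolding trial_space_def w1
      by (simp add: pderiv_mult del: mult_pCons_left)
    ultimately have "[:- (- 1), 1:] ^ 2 dvd w" by (rule dvd_if_double_root)
    then have "?w dvd u" unfolding w w1 by (rule mult_dvd_mono[OF dvd_refl])
    then obtain q where q: "u = ?w * q" by (elim dvdE)
    have "degree q \<le> n - 4"
    proof (cases "q = 0")
      case False
      have "degree u = 4 + degree q"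
        unfolding q using degree_mult_eq[OF w0 False] dw by simp
      moreover have "degree u \<le> n" using u by (simp add: trial_space_def)
      ultimately show ?thesis by linarith
    qed simp
    with q show ?thesis unfolding test_space_def by blast
  qed
  moreover have "u \<in> trial_space n" if u: "u \<in> test_space n 2" for u
  proof -
    obtain q where q: "u = ?w * q" "degree q \<le> n - 4"
      using u unfolding test_space_def by blast
    have "degree u \<le> n"
      using degree_mult_le[of ?w q] q n dw by simp
    moreover have "poly u 1 = 0" "poly u (-1) = 0"
      unfolding q(1) by (simp_all add: power2_eq_square)
    moreover have "poly (pderiv u) 1 = 0" "poly (pderiv u) (-1) = 0"
      unfolding q(1) power2_eq_square pderiv_mult
      by (simp_all add: pderiv_pCons del: mult_pCons_left mult_pCons_right)
    ultimately show ?thesis by (simp add: trial_space_def)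
  qed
  ultimately show ?thesis by blast
qed

lemma test_space_has_basis:
  assumes n: "n \<ge> 4"
  obtains bs where "is_basis bs (test_space n s)" "length bs = n - 3"
proof
  let ?p = "[:1, 0, -1:] ^ s :: complex poly"
  let ?b = "\<lambda>i. ?p * monom 1 i"
  let ?bs = "map ?b [0..<n - 3]"
  have p0: "?p \<noteq> 0" by simp
  have inj: "inj ?b"
    by (rule injI) (simp add: p0 monom_eq_iff')
  have set_bs: "set ?bs = ?b ` {..<n - 3}"
    by (auto simp: atLeast0LessThan)
  have comb: "(\<Sum>i<n - 3. smult (c i) (?b i)) = ?p * (\<Sum>i<n - 3. monom (c i) i)" for c
    unfolding sum_distrib_left by (intro sum.cong) (simp_all add: smult_monom flip: mult_smult_right)
  have "cpoly.independent (?b ` {..<n - 3})"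
  proof (rule cpoly.independent_if_scalars_zero)
    fix f v
    assume 0: "(\<Sum>x\<in>?b ` {..<n - 3}. smult (f x) x) = 0" and v: "v \<in> ?b ` {..<n - 3}"
    then obtain i where i: "i < n - 3" "v = ?b i" by blast
    have "?p * (\<Sum>i<n - 3. monom (f (?b i)) i) = 0"
      using 0 unfolding comb[symmetric]
      by (subst (asm) sum.reindex) (auto intro: inj_on_subset[OF inj])
    then have "(\<Sum>i<n - 3. monom (f (?b i)) i) = 0" using p0 by simp
    then have "coeff (\<Sum>i<n - 3. monom (f (?b i)) i) i = 0" by simp
    then show "f v = 0" using i by (simp add: coeff_sum sum.delta if_distrib cong: if_cong)
  qed simp
  moreover have "cpoly.span (?b ` {..<n - 3}) = test_space n s"
  proof
    have sub: "cpoly.subspace (test_space n s)"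
    proof (rule cpoly.subspaceI)
      show "0 \<in> test_space n s"
        unfolding test_space_def by (auto intro!: exI[of _ 0])
    next
      fix x y assume "x \<in> test_space n s" "y \<in> test_space n s"
      then obtain a b where "x = ?p * a" "degree a \<le> n - 4" "y = ?p * b" "degree b \<le> n - 4"
        unfolding test_space_def by blast
      then show "x + y \<in> test_space n s"
        unfolding test_space_def by (auto intro!: exI[of _ "a + b"] degree_add_le simp: distrib_left)
    next
      fix c x assume "x \<in> test_space n s"
      then obtain a where "x = ?p * a" "degree a \<le> n - 4"
        unfolding test_space_def by blast
      then show "smult c x \<in> test_space n s"
        unfolding test_space_def
        by (auto intro!: exI[of _ "smult c a"] order_trans[OF degree_smult_le])
    qed
    show "cpoly.span (?b ` {..<n - 3}) \<subseteq> test_space n s"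
    proof (rule cpoly.span_minimal[OF _ sub])
      show "?b ` {..<n - 3} \<subseteq> test_space n s"
        unfolding test_space_def by (auto simp: degree_monom_eq)
    qed
    show "test_space n s \<subseteq> cpoly.span (?b ` {..<n - 3})"
    proof
      fix x assume "x \<in> test_space n s"
      then obtain q where q: "x = ?p * q" "degree q \<le> n - 4"
        unfolding test_space_def by blast
      have "{..n - 4} = {..<n - 3}" using n by auto
      then have "q = (\<Sum>i<n - 3. monom (coeff q i) i)"
        using poly_as_sum_of_monoms'[OF q(2)] by simp
      then have "x = (\<Sum>i<n - 3. smult (coeff q i) (?b i))"
        unfolding comb q(1) by simp
      also have "\<dots> \<in> cpoly.span (?b ` {..<n - 3})"
        by (intro cpoly.span_sum cpoly.span_scale cpoly.span_base) simp
      finally show "x \<in> cpoly.span (?b ` {..<n - 3})" .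
    qed
  qed
  moreover have "distinct ?bs"
    by (simp add: distinct_map inj_on_subset[OF inj])
  ultimately show "is_basis ?bs (test_space n s)"
    unfolding is_basis_def set_bs by blast
qed simp

lemma is_basis_length_unique:
  assumes "is_basis bs V" "is_basis cs V"
  shows "length bs = length cs"
proof -
  have "length xs \<le> length ys" if "is_basis xs V" "is_basis ys V" for xs ys
  proof -
    have "set xs \<subseteq> cpoly.span (set ys)"
      using that cpoly.span_superset[of "set xs"] by (simp add: is_basis_def)
    then have "card (set xs) \<le> card (set ys)"
      using that cpoly.independent_span_bound[of "set ys" "set xs"] by (simp add: is_basis_def)
    then show ?thesis using that by (simp add: is_basis_def distinct_card)
  qed
  with assms show ?thesis by (meson le_antisym)
qed

lemma length_test_basis:
  assumes "n \<ge> 4" "is_basis bs (test_space n s)"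
  shows "length bs = n - 3"
  using test_space_has_basis[OF assms(1)] is_basis_length_unique[OF assms(2)] by metis

lemma length_trial_basis:
  assumes "n \<ge> 4" "is_basis bs (trial_space n)"
  shows "length bs = n - 3"
  using assms length_test_basis trial_space_eq by metis

end

theory Submission
  imports Defs "HOL-Computational_Algebra.Fundamental_Theorem_Algebra"
begin

text \<open>
  Why the theorem holds. Put \<open>\<alpha> = \<gamma> + s - 1/2\<close> and \<open>w = u''\<close>. The integral condition, written with
  \<open>\<mu> = 1 / l\<close>, says that \<open>w - \<mu> w''\<close> is orthogonal to all polynomials of degree at most \<open>n - 4\<close> for the
  weight \<open>(1 - x\<^sup>2) powr \<alpha>\<close>, hence is a combination of the two Gegenbauer polynomials \<open>G\<close> of degrees
  \<open>n - 2\<close> and \<open>n - 3\<close>; the boundary conditions say that \<open>w\<close> integrates to zero against \<open>1\<close> and \<open>x\<close>.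
  Since \<open>w - \<mu> w'' = G\<close> is solved by \<open>resolvent2 \<mu> G\<close>, which has the parity of \<open>G\<close>, the problem splits:
  \<open>\<mu>\<close> is a reciprocal eigenvalue iff the integral of the even resolvent vanishes, or the integral of \<open>x\<close>
  times the odd one (lemma \<open>reciprocal_eigenvalue_iff\<close>). Both are polynomials in \<open>\<mu>\<close>. Their coefficients
  are values of derivatives of \<open>G\<close> at \<open>1\<close>, except the constant ones, which carry a factor \<open>\<alpha>\<close>. For
  \<open>\<alpha> = -1/2\<close> (Chebyshev tau) the constant coefficient of the even polynomial is negative and the other
  ones are nonnegative, so there is a positive root; for \<open>\<alpha> = 0\<close> (Legendre tau) zero is a root.

  In the remaining four cases write \<open>\<alpha> = a + 1\<close> with \<open>a\<close> one of \<open>-1/2\<close>, \<open>0\<close>, \<open>1/2\<close>, \<open>1\<close>. Comparing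
  coefficients, both polynomials arise from one polynomial \<open>E\<close> (\<open>even_jet_poly\<close>) by operators
  \<open>s + \<mu> d/d\<mu>\<close> (\<open>theta\<close>), where the coefficients of \<open>E\<close> are, up to a common factor, the even derivatives at \<open>1\<close> of the Jacobi
  polynomial \<open>F\<close> of odd degree with exponents \<open>a\<close> and \<open>a - 2\<close>. These operators preserve the property
  that all roots are real, negative and simple, and two different operators applied to the same such polynomial
  produce no common root (\<open>simple_negative_roots_theta\<close>, \<open>theta_no_common_root\<close>). Now \<open>E\<close> is proportional to the even part of
  \<open>\<phi> \<nu> = (\<Sum>k. F\<^sup>(\<^sup>k\<^sup>)(1) * \<nu> ^ k)\<close>, so that by the Hermite--Biehler theorem it suffices that \<open>\<phi>\<close> has no
  root in the closed right half plane.

  This is the analytic core. The value \<open>\<phi> \<nu>\<close> is \<open>p(1)\<close> for the solution \<open>p\<close> of \<open>p - \<nu> p' = F\<close>. If it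
  vanished for some \<open>\<nu> = 1 / z\<close>, one could write \<open>p = (1 - x) q\<close> and integrate the equation against
  \<open>M\<close> times the conjugate of \<open>q\<close> with a weight \<open>(1 - x) powr a * (1 + x) powr c\<close>, where \<open>c - (a - 2)\<close> is a small
  integer. Integration by parts gives a sign for suitable real multipliers \<open>M\<close> (\<open>energy_pos\<close>). On the
  other hand \<open>F\<close> is almost orthogonal for this weight, so that only a few leading coefficients of \<open>q\<close>
  contribute, and the same integral is an explicit polynomial in \<open>1 / z\<close> whose sign is opposite. The
  multiplier depends on the sector that contains \<open>z\<close>
  (\<open>hurwitz_resolvent_nonneg\<close>, \<open>hurwitz_resolvent_minus_half\<close>, \<open>hurwitz_resolvent_one\<close>).

  Altogether there are \<open>n - 3\<close> distinct eigenvalues, which is the size of the pencil; hence all roots of its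
  determinant are simple.
\<close>

section \<open>Integrals against Jacobi weights\<close>

definition jweight :: "real \<Rightarrow> real \<Rightarrow> real \<Rightarrow> real" where
  "jweight a c x = (1 - x) powr a * (1 + x) powr c"

text \<open>
  The integral is bilinear in its polynomial factors: a product \<open>f * q\<close> is integrated without
  conjugation, and conjugates are inserted explicitly where a positive form is needed.
\<close>

definition jint :: "real \<Rightarrow> real \<Rightarrow> complex poly \<Rightarrow> complex" where
  "jint a c f = integral {-1..1} (\<lambda>x. of_real (jweight a c x) * poly f (of_real x))"

lemma jweight_pos: "x \<in> {-1<..<1} \<Longrightarrow> jweight a c x > 0"
  by (simp add: jweight_def)

lemma jweight_nonneg: "jweight a c x \<ge> 0"
  by (simp add: jweight_def)

lemma jweight_Suc:
  assumes "x \<in> {-1..1}"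
  shows "jweight (a + 1) (c + 1) x = (1 - x\<^sup>2) * jweight a c x"
proof -
  have p: "(1 - x) powr (a + 1) = (1 - x) * (1 - x) powr a" "(1 + x) powr (c + 1) = (1 + x) * (1 + x) powr c"
    using assms by (auto simp: powr_mult_base add.commute)
  show ?thesis unfolding jweight_def p by (simp add: power2_eq_square algebra_simps)
qed

lemma continuous_on_jweight:
  assumes "a > 0" "c > 0"
  shows "continuous_on {-1..1} (jweight a c)"
  unfolding jweight_def using assms by (intro continuous_intros continuous_on_powr') auto

lemma continuous_on_jweight_open: "continuous_on {-1<..<1} (jweight a c)"
  unfolding jweight_def by (intro continuous_intros continuous_on_powr') auto

lemma jweight_deriv:
  assumes "x \<in> {-1<..<1}"
  shows "(jweight (a + 1) (c + 1) has_real_derivative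
           ((c - a) - (a + c + 2) * x) * jweight a c x) (at x)"
proof -
  have x: "1 - x > 0" "1 + x > 0" using assms by auto
  have p: "(1 - x) powr (a + 1) = (1 - x) * (1 - x) powr a" "(1 + x) powr (c + 1) = (1 + x) * (1 + x) powr c"
    using x by (auto simp: powr_mult_base add.commute)
  have "((\<lambda>x. (1 - x) powr (a + 1) * (1 + x) powr (c + 1)) has_real_derivative
      (- (a + 1) * (1 - x) powr a) * (1 + x) powr (c + 1)
      + ((c + 1) * (1 + x) powr c) * (1 - x) powr (a + 1)) (at x)"
    using x by (auto intro!: derivative_eq_intros simp: algebra_simps)
  then show ?thesis
    unfolding p jweight_def by (simp add: jweight_def[abs_def] algebra_simps)
qed

lemma poly_of_real_vector_derivative:
  "((\<lambda>x. poly r (of_real x)) has_vector_derivative poly (pderiv r) (of_real x)) (at x within S)"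
  for r :: "complex poly"
  by (rule has_vector_derivative_real_field) (rule poly_DERIV)

lemma continuous_on_poly_of_real: "continuous_on S (\<lambda>x. poly r (of_real x))"
  for r :: "complex poly"
  by (intro continuous_intros)

text \<open>
  The total derivative of \<open>(1 - x) powr (a + 1) * (1 + x) powr (c + 1) * r\<close>, which vanishes at both
  ends because the exponents are positive. All moment relations below come from this identity.
\<close>

lemma jweight_by_parts:
  assumes "a > -1" "c > -1"
  shows "((\<lambda>x. of_real (jweight a c x) *
      poly ([:1, 0, -1:] * pderiv r + [:of_real (c - a), - of_real (a + c + 2):] * r) (of_real x :: complex))
      has_integral 0) {-1..1}"
proof -
  let ?f = "\<lambda>x. of_real (jweight (a + 1) (c + 1) x) * poly r (complex_of_real x)"
  let ?g = "\<lambda>x. of_real (jweight a c x) *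
      poly ([:1, 0, -1:] * pderiv r + [:of_real (c - a), - of_real (a + c + 2):] * r) (of_real x :: complex)"
  have "(?g has_integral ?f 1 - ?f (-1)) {-1..1}"
  proof (rule fundamental_theorem_of_calculus_interior)
    show "continuous_on {-1..1} ?f"
      using assms by (intro continuous_intros continuous_on_jweight) auto
    fix x :: real assume x: "x \<in> {-1<..<1}"
    have "((\<lambda>x. complex_of_real (jweight (a + 1) (c + 1) x)) has_vector_derivative
        of_real (((c - a) - (a + c + 2) * x) * jweight a c x)) (at x)"
      by (intro has_vector_derivative_of_real has_real_derivative_iff_has_vector_derivative[THEN iffD1] jweight_deriv x)
    note D = has_vector_derivative_mult[OF this poly_of_real_vector_derivative[of r x UNIV]]
    show "(?f has_vector_derivative ?g x) (at x)"
    proof (rule has_vector_derivative_eq_rhs[OF D])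
      have J: "jweight (a + 1) (c + 1) x = (1 - x\<^sup>2) * jweight a c x"
        using x by (intro jweight_Suc) auto
      show "of_real (jweight (a + 1) (c + 1) x) * poly (pderiv r) (of_real x)
          + of_real ((c - a - (a + c + 2) * x) * jweight a c x) * poly r (of_real x) = ?g x"
        unfolding J by (simp add: algebra_simps power2_eq_square)
    qed
  qed simp
  moreover have "?f 1 - ?f (-1) = 0" using assms by (simp add: jweight_def)
  ultimately show ?thesis by (simp only:)
qed

text \<open>
  For negative exponents the integrand is unbounded. A multiple of \<open>1 - x\<^sup>2\<close> raises both exponents
  by one and leaves a continuous integrand; the remaining linear polynomials are, modulo such
  multiples, combinations of two total derivatives.
\<close>

lemma jweight_poly_integrable:
  assumes "a > -1" "c > -1"
  shows "(\<lambda>x. of_real (jweight a c x) * poly f (of_real x :: complex)) integrable_on {-1..1}"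
proof -
  let ?I = "\<lambda>f. (\<lambda>x. of_real (jweight a c x) * poly f (of_real x :: complex)) integrable_on {-1..1}"
  have add: "?I (f + g)" if "?I f" "?I g" for f g
    using integrable_add[OF that] by (simp add: algebra_simps)
  have sm: "?I (smult k f)" if "?I f" for k f
    using integrable_cmul[OF that, of 1] integrable_on_mult_right[OF that, of k]
    by (simp add: algebra_simps)
  have w: "?I ([:1, 0, -1:] * g)" for g
  proof -
    have "continuous_on {-1..1} (\<lambda>x. complex_of_real (jweight (a + 1) (c + 1) x) * poly g (of_real x))"
      using assms by (intro continuous_intros continuous_on_jweight) auto
    then have "(\<lambda>x. complex_of_real (jweight (a + 1) (c + 1) x) * poly g (of_real x)) integrable_on {-1..1}"
      by (rule integrable_continuous_interval)
    then show ?thesis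
    proof (rule integrable_eq)
      fix x :: real assume x: "x \<in> {-1..1}"
      show "of_real (jweight (a + 1) (c + 1) x) * poly g (of_real x)
          = of_real (jweight a c x) * poly ([:1, 0, -1:] * g) (of_real x :: complex)"
        unfolding jweight_Suc[OF x] by (simp add: power2_eq_square algebra_simps)
    qed
  qed
  have bp: "?I ([:1, 0, -1:] * pderiv r + [:of_real (c - a), - of_real (a + c + 2):] * r)" for r
    using jweight_by_parts[OF assms, of r] by (auto simp: integrable_on_def)
  \<comment> \<open>modulo multiples of 1 - x^2 the identity for r = 1 and r = x gives two independent linear polynomials\<close>
  define d e :: complex where "d = of_real (c - a)" and "e = of_real (a + c + 2)"
  note bp = bp[folded d_def e_def]
  have 1: "?I [:d, - e:]" using bp[of 1] by simp
  have "?I (([:1, 0, -1:] * pderiv [:0, 1:] + [:d, - e:] * [:0, 1:]) + [:1, 0, -1:] * [:- 1 - e:])"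
    by (intro add bp w)
  also have "([:1, 0, -1:] * pderiv [:0, 1:] + [:d, - e:] * [:0, 1:]) + [:1, 0, -1:] * [:- 1 - e:] = [:- e, d:]"
    by (simp add: pderiv_pCons)
  finally have 2: "?I [:- e, d:]" .
  have det: "d\<^sup>2 - e\<^sup>2 \<noteq> 0"
  proof -
    have "(c - a)\<^sup>2 - (a + c + 2)\<^sup>2 = - 4 * (a + 1) * (c + 1)" by (simp add: power2_eq_square algebra_simps)
    also have "\<dots> \<noteq> 0" using assms by simp
    finally have "complex_of_real ((c - a)\<^sup>2 - (a + c + 2)\<^sup>2) \<noteq> 0" by (simp only: of_real_eq_0_iff not_False_eq_True)
    then show ?thesis by (simp add: d_def e_def)
  qed
  have lin: "?I [:\<alpha>, \<beta>:]" for \<alpha> \<beta>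
  proof -
    let ?s = "(\<alpha> * d + \<beta> * e) / (d\<^sup>2 - e\<^sup>2)" and ?t = "(\<alpha> * e + \<beta> * d) / (d\<^sup>2 - e\<^sup>2)"
    have "?s * d + ?t * (- e) = ((\<alpha> * d + \<beta> * e) * d - (\<alpha> * e + \<beta> * d) * e) / (d\<^sup>2 - e\<^sup>2)"
      by (simp add: diff_divide_distrib)
    also have "(\<alpha> * d + \<beta> * e) * d - (\<alpha> * e + \<beta> * d) * e = \<alpha> * (d\<^sup>2 - e\<^sup>2)"
      by (simp add: power2_eq_square algebra_simps)
    finally have *: "?s * d + ?t * (- e) = \<alpha>" using det by simp
    have "?s * (- e) + ?t * d = ((\<alpha> * e + \<beta> * d) * d - (\<alpha> * d + \<beta> * e) * e) / (d\<^sup>2 - e\<^sup>2)"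
      by (simp add: diff_divide_distrib)
    also have "(\<alpha> * e + \<beta> * d) * d - (\<alpha> * d + \<beta> * e) * e = \<beta> * (d\<^sup>2 - e\<^sup>2)"
      by (simp add: power2_eq_square algebra_simps)
    finally have "?s * (- e) + ?t * d = \<beta>" using det by simp
    with * have "[:\<alpha>, \<beta>:] = smult ?s [:d, - e:] + smult ?t [:- e, d:]"
      by simp
    then show ?thesis using add[OF sm[OF 1] sm[OF 2]] by metis
  qed
  let ?w = "[:1, 0, -1:] :: complex poly"
  have "degree (f mod ?w) < degree ?w \<or> f mod ?w = 0"
    using degree_mod_less[of ?w f] by auto
  then have "degree (f mod ?w) \<le> 1" by auto
  then have "f mod ?w = [:coeff (f mod ?w) 0, coeff (f mod ?w) 1:]"
    by (intro poly_eqI) (auto simp: coeff_pCons coeff_eq_0 split: nat.split)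
  then obtain \<alpha> \<beta> where "f mod ?w = [:\<alpha>, \<beta>:]" by blast
  then have "f = ?w * (f div ?w) + [:\<alpha>, \<beta>:]"
    by (metis mult_div_mod_eq)
  then show ?thesis using add[OF w[of "f div ?w"] lin] by metis
qed

lemma jint_has_integral:
  assumes "a > -1" "c > -1"
  shows "((\<lambda>x. of_real (jweight a c x) * poly f (of_real x)) has_integral jint a c f) {-1..1}"
  unfolding jint_def using jweight_poly_integrable[OF assms] by (rule integrable_integral)

lemma jint_unique:
  assumes "((\<lambda>x. of_real (jweight a c x) * poly f (of_real x)) has_integral v) {-1..1}"
  shows "jint a c f = v"
  unfolding jint_def using assms by (rule integral_unique)

lemma jint_by_parts:
  assumes "a > -1" "c > -1"
  shows "jint a c ([:1, 0, -1:] * pderiv r + [:of_real (c - a), - of_real (a + c + 2):] * r) = 0"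
  by (rule jint_unique[OF jweight_by_parts[OF assms]])

lemma jint_add:
  assumes "a > -1" "c > -1"
  shows "jint a c (f + g) = jint a c f + jint a c g"
  using has_integral_add[OF jint_has_integral[OF assms, of f] jint_has_integral[OF assms, of g]]
  by (intro jint_unique) (simp add: algebra_simps)

lemma jint_smult:
  assumes "a > -1" "c > -1"
  shows "jint a c (smult k f) = k * jint a c f"
  using has_integral_mult_right[OF jint_has_integral[OF assms, of f], of k]
  by (intro jint_unique) (simp add: algebra_simps)

lemma jint_0 [simp]: "jint a c 0 = 0"
  by (simp add: jint_def)

lemma jint_minus:
  assumes "a > -1" "c > -1"
  shows "jint a c (- f) = - jint a c f"
  using jint_smult[OF assms, of "-1" f] by simp

lemma jint_diff:
  assumes "a > -1" "c > -1"
  shows "jint a c (f - g) = jint a c f - jint a c g"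
  using jint_add[OF assms, of f "- g"] jint_minus[OF assms, of g] by simp

lemma jint_sum:
  assumes "a > -1" "c > -1"
  shows "jint a c (\<Sum>i\<in>A. f i) = (\<Sum>i\<in>A. jint a c (f i))"
  by (induction A rule: infinite_finite_induct) (simp_all add: jint_add[OF assms])

lemma jint_cnj:
  assumes "a > -1" "c > -1"
  shows "jint a c (map_poly cnj f) = cnj (jint a c f)"
proof -
  have "((\<lambda>x. cnj (of_real (jweight a c x) * poly f (of_real x))) has_integral cnj (jint a c f)) {-1..1}"
    using has_integral_linear[OF jint_has_integral[OF assms, of f] bounded_linear_cnj]
    by (simp only: o_def)
  then show ?thesis by (intro jint_unique) (simp add: poly_map_poly_cnj)
qed

lemma has_integral_nonneg_eq_0:
  fixes K :: "real \<Rightarrow> real"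
  assumes "(K has_integral I) {-1..1}" "I \<le> 0" "continuous_on {-1<..<1} K"
    "\<And>x. x \<in> {-1<..<1} \<Longrightarrow> K x \<ge> 0" "x \<in> {-1<..<1}"
  shows "K x = 0"
proof -
  have "(K has_integral I) {-1<..<1}"
    using assms(1) has_integral_Icc_iff_Ioo by blast
  then have int: "K integrable_on {-1<..<1}" and I: "integral {-1<..<1} K = I"
    by (auto simp: has_integral_iff)
  define l where "l = (x - 1) / 2"
  define r where "r = (x + 1) / 2"
  have lr: "-1 < l" "l < x" "x < r" "r < 1" using assms(5) by (auto simp: l_def r_def field_simps)
  have cont: "continuous_on {l..r} K" using assms(3) lr by (auto elim: continuous_on_subset)
  then have int': "K integrable_on {l..r}" by (rule integrable_continuous_interval)
  have "integral {l..r} K \<le> integral {-1<..<1} K"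
    using lr assms(4) int int' by (intro integral_subset_le) auto
  moreover have "integral {l..r} K \<ge> 0"
    using lr assms(4) int' by (intro integral_nonneg) auto
  ultimately have "integral {l..r} K = 0" using I assms(2) by linarith
  then have "(K has_integral 0) (cbox l r)" using int' by (auto simp: has_integral_iff)
  then show ?thesis
    using has_integral_0_cbox_imp_0[of l r K x] cont lr assms(4) by auto
qed

lemma poly_of_real_eq_0_imp:
  fixes q :: "complex poly"
  assumes "\<And>x. x \<in> {-1<..<1} \<Longrightarrow> poly q (of_real x) = 0"
  shows "q = 0"
proof -
  have "complex_of_real ` {-1<..<1} \<subseteq> {z. poly q z = 0}" using assms by auto
  moreover have "infinite (complex_of_real ` {-1<..<1})"
    by (subst finite_image_iff) (auto simp: inj_on_def)
  ultimately show ?thesis using poly_roots_finite finite_subset by blast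
qed

lemma jint_norm_eq_0:
  assumes "a > -1" "c > -1" and 0: "jint a c (f * map_poly cnj f) = 0"
  shows "f = 0"
proof -
  let ?K = "\<lambda>x. jweight a c x * (cmod (poly f (of_real x)))\<^sup>2"
  have K: "(?K has_integral 0) {-1..1}"
    using has_integral_Re[OF jint_has_integral[OF assms(1,2), of "f * map_poly cnj f"]] 0
    unfolding cmod_power2 by (simp add: poly_map_poly_cnj power2_eq_square)
  have "?K x = 0" if "x \<in> {-1<..<1}" for x
    by (rule has_integral_nonneg_eq_0[OF K _ _ _ that])
       (auto intro!: continuous_intros continuous_on_jweight_open simp: jweight_nonneg)
  then have "poly f (of_real x) = 0" if "x \<in> {-1<..<1}" for x
    using that jweight_pos[OF that, of a c] by fastforce
  then show ?thesis by (rule poly_of_real_eq_0_imp)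
qed

text \<open>
  The factor \<open>(1 - x\<^sup>2) ^ s\<close> of a test function merges with the weight, so that the inviscid
  Galerkin and the Galerkin method are tau methods with a shifted index.
\<close>

lemma weighted_integral_eq_jint:
  assumes "\<gamma> + s > -1/2"
  shows "weighted_integral \<gamma> f ([:1, 0, -1:] ^ s * q) = jint (\<gamma> + s - 1/2) (\<gamma> + s - 1/2) (f * q)"
proof -
  let ?a = "\<gamma> + s - 1/2"
  let ?h = "\<lambda>x. complex_of_real (jweight ?a ?a x) * poly (f * q) (of_real x)"
  have a: "?a > -1" using assms by simp
  have eq: "poly f (of_real x) * poly ([:1, 0, -1:] ^ s * q) (of_real x) * of_real (gegenbauer_weight \<gamma> x) = ?h x"
    if x: "x \<in> {-1<..<1}" for x
  proof -
    have p: "1 - x > 0" "1 + x > 0" "1 - x\<^sup>2 > 0" using x by (auto simp: abs_square_less_1)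
    have "1 - x\<^sup>2 = (1 - x) * (1 + x)" by (simp add: power2_eq_square algebra_simps)
    then have "jweight ?a ?a x = (1 - x\<^sup>2) powr ?a"
      unfolding jweight_def using p by (simp add: powr_mult)
    also have "\<dots> = (1 - x\<^sup>2) ^ s * gegenbauer_weight \<gamma> x"
      using p by (simp add: gegenbauer_weight_def powr_add powr_diff powr_realpow)
    finally show ?thesis by (simp add: power2_eq_square)
  qed
  have W: "(\<lambda>x. jweight ?a ?a x) integrable_on {-1..1}"
    using has_integral_Re[OF jint_has_integral[OF a a, of 1]] by (auto simp: integrable_on_def)
  have "bounded ((\<lambda>x. poly (f * q) (complex_of_real x)) ` {-1..1})"
    by (intro compact_imp_bounded compact_continuous_image continuous_on_poly_of_real compact_Icc)
  then obtain b where "\<forall>y \<in> (\<lambda>x. poly (f * q) (complex_of_real x)) ` {-1..1}. cmod y \<le> b"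
    unfolding bounded_iff by blast
  then have b: "cmod (poly (f * q) (complex_of_real x)) \<le> b" if "x \<in> {-1..1}" for x
    using that by blast
  have "?h absolutely_integrable_on {-1..1}"
  proof (rule absolutely_integrable_integrable_bound)
    show "?h integrable_on {-1..1}" by (rule jweight_poly_integrable[OF a a])
    show "(\<lambda>x. jweight ?a ?a x * b) integrable_on {-1..1}"
      using W by (rule integrable_on_mult_left)
    fix x :: real assume "x \<in> {-1..1}"
    then show "norm (?h x) \<le> jweight ?a ?a x * b"
      using b[of x] by (simp add: norm_mult jweight_nonneg mult_left_mono)
  qed
  then have "?h absolutely_integrable_on {-1<..<1}"
    by (rule set_integrable_subset) auto
  moreover have "continuous_on {-1<..<1} ?h"
    by (intro continuous_intros continuous_on_jweight_open)
  then have "(\<lambda>x. indicator {-1<..<1} x *\<^sub>R ?h x) \<in> borel_measurable borel"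
    by (intro borel_measurable_continuous_on_indicator) auto
  ultimately have int: "set_integrable lborel {-1<..<1} ?h"
    unfolding set_integrable_def by (simp add: integrable_completion)
  have "weighted_integral \<gamma> f ([:1, 0, -1:] ^ s * q) = (LINT x:{-1<..<1}|lborel. ?h x)"
    unfolding weighted_integral_def
  proof (rule set_lebesgue_integral_cong)
    show "\<forall>x. x \<in> {-1<..<1} \<longrightarrow> poly f (of_real x) * poly ([:1, 0, -1:] ^ s * q) (of_real x)
        * of_real (gegenbauer_weight \<gamma> x) = ?h x"
      using eq by blast
  qed simp
  also have "\<dots> = integral {-1<..<1} ?h"
    using int by (rule set_borel_integral_eq_integral)
  also have "\<dots> = jint ?a ?a (f * q)"
    using jint_has_integral[OF a a, of "f * q"] unfolding has_integral_Icc_iff_Ioo by (rule integral_unique)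
  finally show ?thesis .
qed

section \<open>Taylor coefficients and Jacobi polynomials\<close>

text \<open>
  Expansions at \<open>1\<close> describe values of derivatives at the endpoint, expansions at \<open>-1\<close> describe
  moments and leading coefficients.
\<close>

definition tcoeff :: "complex \<Rightarrow> complex poly \<Rightarrow> nat \<Rightarrow> complex" where
  "tcoeff x0 p k = coeff (pcompose p [:x0, 1:]) k"

lemma tcoeff_0: "tcoeff x0 p 0 = poly p x0"
  by (simp add: tcoeff_def coeff_pcompose_0)

lemma tcoeff_add: "tcoeff x0 (p + q) k = tcoeff x0 p k + tcoeff x0 q k"
  by (simp add: tcoeff_def pcompose_add)

lemma tcoeff_smult: "tcoeff x0 (smult c p) k = c * tcoeff x0 p k"
  by (simp add: tcoeff_def pcompose_smult)

lemma tcoeff_pderiv: "tcoeff x0 (pderiv p) k = of_nat (Suc k) * tcoeff x0 p (Suc k)"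
proof -
  have "pderiv (pcompose p [:x0, 1:]) = pcompose (pderiv p) [:x0, 1:]"
    by (simp add: pderiv_pcompose pderiv_pCons)
  then have "tcoeff x0 (pderiv p) k = coeff (pderiv (pcompose p [:x0, 1:])) k"
    by (simp only: tcoeff_def)
  then show ?thesis by (simp add: tcoeff_def coeff_pderiv)
qed

lemma poly_higher_pderiv: "poly ((pderiv ^^ k) p) x0 = fact k * tcoeff x0 p k"
proof (induction k arbitrary: p)
  case (Suc k)
  have "poly ((pderiv ^^ Suc k) p) x0 = poly ((pderiv ^^ k) (pderiv p)) x0"
    by (simp only: funpow_Suc_right o_apply)
  then show ?case by (simp add: Suc.IH tcoeff_pderiv algebra_simps)
qed (simp add: tcoeff_0)

lemma tcoeff_mult_linear:
  "tcoeff x0 ([:\<alpha>, \<beta>:] * p) 0 = (\<alpha> + \<beta> * x0) * tcoeff x0 p 0"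
  "tcoeff x0 ([:\<alpha>, \<beta>:] * p) (Suc k) = (\<alpha> + \<beta> * x0) * tcoeff x0 p (Suc k) + \<beta> * tcoeff x0 p k"
proof -
  have "pcompose ([:\<alpha>, \<beta>:] * p) [:x0, 1:] = [:\<alpha> + \<beta> * x0, \<beta>:] * pcompose p [:x0, 1:]"
    by (simp only: pcompose_mult) (simp add: pcompose_pCons)
  then show "tcoeff x0 ([:\<alpha>, \<beta>:] * p) 0 = (\<alpha> + \<beta> * x0) * tcoeff x0 p 0"
    "tcoeff x0 ([:\<alpha>, \<beta>:] * p) (Suc k) = (\<alpha> + \<beta> * x0) * tcoeff x0 p (Suc k) + \<beta> * tcoeff x0 p k"
    by (simp_all add: tcoeff_def)
qed

lemma tcoeff_eq_0: "degree p < k \<Longrightarrow> tcoeff x0 p k = 0"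
  unfolding tcoeff_def by (rule coeff_eq_0) (simp add: degree_pcompose)

lemma tcoeff_expand:
  assumes "degree p \<le> d"
  shows "p = (\<Sum>k\<le>d. smult (tcoeff x0 p k) ([:- x0, 1:] ^ k))"
proof -
  have p: "pcompose p [:x0, 1:] = (\<Sum>k\<le>d. monom (tcoeff x0 p k) k)"
    unfolding tcoeff_def using assms by (intro poly_as_sum_of_monoms'[symmetric]) (simp add: degree_pcompose)
  have "poly p x = poly (\<Sum>k\<le>d. smult (tcoeff x0 p k) ([:- x0, 1:] ^ k)) x" for x
    using arg_cong[OF p, of "\<lambda>q. poly q (x - x0)"]
    by (simp add: poly_pcompose poly_sum poly_monom)
  then show ?thesis by (simp add: poly_eq_poly_eq_iff[symmetric] fun_eq_iff)
qed

lemma tcoeff_all_0: "(\<And>k. tcoeff x0 p k = 0) \<Longrightarrow> p = 0"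
  by (subst tcoeff_expand[OF order_refl, of p x0]) simp

text \<open>
  The exponent \<open>b\<close> may be at most \<open>-1\<close> here: the polynomials that govern the eigenvalues have
  \<open>b = a - 2\<close>, for which there is no integrable weight.
\<close>

definition jacobi_ode :: "real \<Rightarrow> real \<Rightarrow> real \<Rightarrow> complex poly \<Rightarrow> bool" where
  "jacobi_ode n a b F \<longleftrightarrow>
     [:1, 0, -1:] * pderiv (pderiv F) + [:of_real (b - a), - of_real (a + b + 2):] * pderiv F
       + smult (of_real (n * (n + a + b + 1))) F = 0"

lemma jacobi_odeI:
  assumes "\<And>x. (1 - x\<^sup>2) * poly (pderiv (pderiv F)) x
      + (of_real (b - a) - of_real (a + b + 2) * x) * poly (pderiv F) x
      + of_real (n * (n + a + b + 1)) * poly F x = 0"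
  shows "jacobi_ode n a b F"
  unfolding jacobi_ode_def poly_eq_poly_eq_iff[symmetric]
proof
  fix x show "poly ([:1, 0, -1:] * pderiv (pderiv F) + [:of_real (b - a), - of_real (a + b + 2):] * pderiv F
       + smult (of_real (n * (n + a + b + 1))) F) x = poly 0 x"
    using assms[of x] by (simp add: algebra_simps power2_eq_square)
qed

lemma jacobi_odeD:
  assumes "jacobi_ode n a b F"
  shows "(1 - x\<^sup>2) * poly (pderiv (pderiv F)) x
      + (of_real (b - a) - of_real (a + b + 2) * x) * poly (pderiv F) x
      + of_real (n * (n + a + b + 1)) * poly F x = 0"
  using arg_cong[OF assms[unfolded jacobi_ode_def], of "\<lambda>p. poly p x"]
  by (simp add: algebra_simps power2_eq_square)

lemma jacobi_ode_pderiv: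
  assumes "jacobi_ode n a b F"
  shows "jacobi_ode (n - 1) (a + 1) (b + 1) (pderiv F)"
proof (rule jacobi_odeI)
  fix x
  have "poly (pderiv ([:1, 0, -1:] * pderiv (pderiv F) + [:of_real (b - a), - of_real (a + b + 2):] * pderiv F
       + smult (of_real (n * (n + a + b + 1))) F)) x = 0"
    using assms by (simp add: jacobi_ode_def)
  then show "(1 - x\<^sup>2) * poly (pderiv (pderiv (pderiv F))) x
      + (of_real (b + 1 - (a + 1)) - of_real (a + 1 + (b + 1) + 2) * x) * poly (pderiv (pderiv F)) x
      + of_real ((n - 1) * (n - 1 + (a + 1) + (b + 1) + 1)) * poly (pderiv F) x = 0"
    by (simp add: pderiv_add pderiv_mult pderiv_pCons pderiv_smult del: mult_pCons_left)
       (simp add: algebra_simps power2_eq_square)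
qed

lemma jacobi_ode_higher_pderiv:
  assumes "jacobi_ode n a b F"
  shows "jacobi_ode (n - real k) (a + real k) (b + real k) ((pderiv ^^ k) F)"
proof (induction k)
  case (Suc k)
  show ?case using jacobi_ode_pderiv[OF Suc.IH] by (simp add: algebra_simps)
qed (use assms in simp)

lemma jacobi_ode_tcoeff_1:
  assumes "jacobi_ode n a b F"
  shows "of_real (2 * (real k + 1) * (real k + 1 + a)) * tcoeff 1 F (Suc k)
     = of_real ((n - real k) * (n + real k + a + b + 1)) * tcoeff 1 F k"
proof -
  have D: "poly (pderiv ((pderiv ^^ k) F)) 1 = fact (Suc k) * tcoeff 1 F (Suc k)"
    using poly_higher_pderiv[of "Suc k" F 1] by simp
  have "fact k * (of_real (2 * (real k + 1) * (real k + 1 + a)) * tcoeff 1 F (Suc k))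
      = fact k * (of_real ((n - real k) * (n + real k + a + b + 1)) * tcoeff 1 F k)"
    using jacobi_odeD[OF jacobi_ode_higher_pderiv[OF assms, of k], of 1]
    by (simp add: poly_higher_pderiv D algebra_simps)
  then show ?thesis by (simp only: mult_cancel_left fact_nonzero simp_thms)
qed

lemma jacobi_ode_tcoeff_m1:
  assumes "jacobi_ode n a b F"
  shows "of_real (2 * (real k + 1) * (real k + 1 + b)) * tcoeff (-1) F (Suc k)
     = - of_real ((n - real k) * (n + real k + a + b + 1)) * tcoeff (-1) F k"
proof -
  have D: "poly (pderiv ((pderiv ^^ k) F)) (-1) = fact (Suc k) * tcoeff (-1) F (Suc k)"
    using poly_higher_pderiv[of "Suc k" F "-1"] by simp
  have "fact k * (of_real (2 * (real k + 1) * (real k + 1 + b)) * tcoeff (-1) F (Suc k))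
      = fact k * (- of_real ((n - real k) * (n + real k + a + b + 1)) * tcoeff (-1) F k)"
    using jacobi_odeD[OF jacobi_ode_higher_pderiv[OF assms, of k], of "-1"]
    by (simp add: poly_higher_pderiv D algebra_simps)
  then show ?thesis by (simp only: mult_cancel_left fact_nonzero simp_thms)
qed

text \<open>
  For \<open>a > -1\<close> the recurrence at \<open>1\<close> never divides by zero, so that the value at \<open>1\<close> determines all
  Taylor coefficients. This replaces normalization arguments: it gives nonvanishing at \<open>1\<close>, and
  later the parity of the Gegenbauer polynomials.
\<close>

lemma jacobi_ode_eq_0:
  assumes "jacobi_ode n a b F" "a > -1" "poly F 1 = 0"
  shows "F = 0"
proof (rule tcoeff_all_0[of 1])
  fix k show "tcoeff 1 F k = 0"
  proof (induction k)
    case (Suc k)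
    have "of_real (2 * (real k + 1) * (real k + 1 + a)) * tcoeff 1 F (Suc k) = 0"
      unfolding jacobi_ode_tcoeff_1[OF assms(1)] Suc by simp
    moreover have "2 * (real k + 1) * (real k + 1 + a) \<noteq> 0" using assms(2) by simp
    ultimately show ?case by (metis mult_eq_0_iff of_real_eq_0_iff)
  qed (simp add: tcoeff_0 assms)
qed

text \<open>
  The Jacobi polynomial scaled to be monic, written in powers of \<open>1 + x\<close>; the product solves the
  two-term recurrence of the Taylor coefficients at \<open>-1\<close> downwards from the leading one.
\<close>

definition jacobi :: "nat \<Rightarrow> real \<Rightarrow> real \<Rightarrow> complex poly" where
  "jacobi N a b = pcompose (\<Sum>k\<le>N. monom (of_real
      (\<Prod>i=k..<N. - 2 * (real i + 1) * (real i + 1 + b) / ((real N - i) * (real N + i + a + b + 1)))) k) [:1, 1:]"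

lemma tcoeff_jacobi:
  "tcoeff (-1) (jacobi N a b) k = (if k \<le> N then of_real
      (\<Prod>i=k..<N. - 2 * (real i + 1) * (real i + 1 + b) / ((real N - i) * (real N + i + a + b + 1))) else 0)"
  by (auto simp: tcoeff_def jacobi_def pcompose_assoc[symmetric] pcompose_pCons pcompose_idR coeff_sum if_distrib cong: if_cong)

lemma degree_jacobi: "degree (jacobi N a b) = N"
proof -
  have "degree (pcompose (jacobi N a b) [:-1, 1:]) = N"
  proof (rule antisym)
    show "degree (pcompose (jacobi N a b) [:-1, 1:]) \<le> N"
      by (rule degree_le) (simp flip: tcoeff_def add: tcoeff_jacobi)
    show "N \<le> degree (pcompose (jacobi N a b) [:-1, 1:])"
      by (rule le_degree) (simp flip: tcoeff_def add: tcoeff_jacobi)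
  qed
  then show ?thesis by (simp add: degree_pcompose)
qed

lemma jacobi_jacobi_ode:
  assumes "\<And>i. i < N \<Longrightarrow> real N + i + a + b + 1 \<noteq> 0"
  shows "jacobi_ode N a b (jacobi N a b)"
proof -
  let ?F = "jacobi N a b"
  define f where "f = tcoeff (-1) ?F"
  have rec: "of_real (2 * (real k + 1) * (real k + 1 + b)) * f (Suc k) + of_real ((real N - real k) * (real N + real k + a + b + 1)) * f k = 0" for k
  proof (cases k N rule: linorder_cases)
    case less
    let ?c = "\<lambda>i. - 2 * (real i + 1) * (real i + 1 + b) / ((real N - i) * (real N + i + a + b + 1))"
    define P where "P = prod ?c {Suc k..<N}"
    have "prod ?c {k..<N} = ?c k * P"
      using less by (simp add: P_def prod.atLeast_Suc_lessThan)
    then have f: "f k = of_real (?c k * P)" "f (Suc k) = of_real P"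
      using less by (simp_all add: f_def tcoeff_jacobi P_def del: of_real_prod of_real_mult)
    have "(real N - real k) * (real N + real k + a + b + 1) \<noteq> 0" using less assms[OF less] by simp
    then have "(real N - real k) * (real N + real k + a + b + 1) * ?c k = - (2 * (real k + 1) * (real k + 1 + b))"
      by (simp add: field_simps)
    then have "2 * (real k + 1) * (real k + 1 + b) * P + (real N - real k) * (real N + real k + a + b + 1) * (?c k * P) = 0"
      by (simp only: mult.assoc[symmetric]) simp
    then show ?thesis unfolding f by (simp only: of_real_mult[symmetric] of_real_add[symmetric] of_real_0)
  qed (simp_all add: f_def tcoeff_jacobi)
  let ?P = "[:1, 0, -1:] * pderiv (pderiv ?F) + [:of_real (b - a), - of_real (a + b + 2):] * pderiv ?F
       + smult (of_real (N * (N + a + b + 1))) ?F"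
  have P: "?P = [:1, 1:] * ([:1, -1:] * pderiv (pderiv ?F)) + [:of_real (b - a), - of_real (a + b + 2):] * pderiv ?F
       + smult (of_real (N * (N + a + b + 1))) ?F"
    by (simp add: mult.assoc[symmetric])
  have "tcoeff (-1) ?P k = 0" for k
  proof -
    consider "k = 0" | "k = 1" | m where "k = Suc (Suc m)" by (metis One_nat_def not0_implies_Suc)
    then show ?thesis
    proof cases
      case 1
      then show ?thesis unfolding P using rec[of 0]
        by (simp add: tcoeff_add tcoeff_smult tcoeff_mult_linear tcoeff_pderiv f_def[symmetric] del: mult_pCons_left)
           (simp add: algebra_simps)?
    next
      case 2
      then show ?thesis unfolding P using rec[of 1]
        by (simp add: tcoeff_add tcoeff_smult tcoeff_mult_linear tcoeff_pderiv f_def[symmetric] del: mult_pCons_left)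
           (simp add: algebra_simps)?
    next
      case 3
      then show ?thesis unfolding P using rec[of k]
        by (simp add: tcoeff_add tcoeff_smult tcoeff_mult_linear tcoeff_pderiv f_def[symmetric] del: mult_pCons_left)
           (simp add: algebra_simps)?
    qed
  qed
  then show ?thesis unfolding jacobi_ode_def by (rule tcoeff_all_0)
qed

lemma map_poly_cnj_jacobi: "map_poly cnj (jacobi N a b) = jacobi N a b"
proof -
  have "tcoeff (-1) (map_poly cnj (jacobi N a b)) k = cnj (tcoeff (-1) (jacobi N a b) k)" for k
  proof -
    have "pcompose (map_poly cnj p) [:-1, 1:] = map_poly cnj (pcompose p [:-1, 1:])" for p :: "complex poly"
      by (simp add: poly_eq_poly_eq_iff[symmetric] fun_eq_iff poly_pcompose poly_map_poly_cnj)
    then show ?thesis by (simp add: tcoeff_def coeff_map_poly)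
  qed
  then have "tcoeff (-1) (map_poly cnj (jacobi N a b) - jacobi N a b) k = 0" for k
    using tcoeff_add[of "-1" "map_poly cnj (jacobi N a b)" "smult (-1) (jacobi N a b)" k]
    by (simp only: tcoeff_smult) (simp add: tcoeff_jacobi)
  then show ?thesis using tcoeff_all_0 by fastforce
qed

text \<open>
  Integration by parts with \<open>r = (1 + x) ^ m * ((1 + x) * F' - i * F)\<close>, \<open>i = m + 1 + j\<close>: the
  differential equation removes the second derivative and the choice of \<open>i\<close> removes the first one.
\<close>

lemma jacobi_moment_rec:
  assumes F: "jacobi_ode n a b F" and "a > -1" "b + real j > -1"
  shows "of_real ((n - real (Suc m + j)) * (n + real (Suc m + j) + a + b + 1)) * jint a (b + real j) (F * [:1, 1:] ^ Suc m)
    = - of_real (2 * real (Suc m + j) * (real (Suc m + j) + b)) * jint a (b + real j) (F * [:1, 1:] ^ m)"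
proof -
  let ?u = "[:1, 1:] :: complex poly" and ?i = "real (Suc m + j)" and ?c = "b + real j"
  let ?r = "?u ^ m * (?u * pderiv F - smult (of_real ?i) F)"
  have "[:1, 0, -1:] * pderiv ?r + [:of_real (?c - a), - of_real (a + ?c + 2):] * ?r
     = smult (- of_real ((n - ?i) * (n + ?i + a + b + 1))) (F * ?u ^ Suc m)
       + smult (- of_real (2 * ?i * (?i + b))) (F * ?u ^ m)"
    unfolding poly_eq_poly_eq_iff[symmetric]
  proof
    fix x :: complex
    let ?U = "(1 + x) ^ m"
    have dU: "(1 + x) * poly (pderiv (?u ^ m)) x = of_nat m * ?U"
      by (cases m) (simp_all add: pderiv_power_Suc pderiv_pCons del: of_nat_Suc power_Suc, simp add: algebra_simps)
    define d d2 e where "d = poly (pderiv F) x" and "d2 = poly (pderiv (pderiv F)) x" and "e = poly F x"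
    have ode: "(1 - x\<^sup>2) * d2 = - ((of_real (b - a) - of_real (a + b + 2) * x) * d + of_real (n * (n + a + b + 1)) * e)"
      using jacobi_odeD[OF F, of x] unfolding d_def d2_def e_def by (simp only: eq_neg_iff_add_eq_0) (simp add: algebra_simps)
    have "poly ([:1, 0, -1:] * pderiv ?r + [:of_real (?c - a), - of_real (a + ?c + 2):] * ?r) x
      = (1 - x) * ((1 + x) * poly (pderiv (?u ^ m)) x) * ((1 + x) * d - of_real ?i * e)
        + ?U * (d * (1 - x\<^sup>2) + (1 + x) * ((1 - x\<^sup>2) * d2) - of_real ?i * ((1 - x\<^sup>2) * d))
        + (of_real (?c - a) - of_real (a + ?c + 2) * x) * ?U * ((1 + x) * d - of_real ?i * e)"
      by (simp add: pderiv_mult pderiv_diff pderiv_smult pderiv_pCons d_def d2_def e_def del: mult_pCons_left)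
         (simp add: algebra_simps power2_eq_square)
    also have "\<dots> = - of_real ((n - ?i) * (n + ?i + a + b + 1)) * (e * (?U * (1 + x)))
        - of_real (2 * ?i * (?i + b)) * (e * ?U)"
      unfolding dU ode by (simp add: algebra_simps power2_eq_square)
    finally have L: "poly ([:1, 0, -1:] * pderiv ?r + [:of_real (?c - a), - of_real (a + ?c + 2):] * ?r) x
      = - of_real ((n - ?i) * (n + ?i + a + b + 1)) * (e * (?U * (1 + x)))
        - of_real (2 * ?i * (?i + b)) * (e * ?U)" .
    show "poly ([:1, 0, -1:] * pderiv ?r + [:of_real (?c - a), - of_real (a + ?c + 2):] * ?r) x =
       poly (smult (- of_real ((n - ?i) * (n + ?i + a + b + 1))) (F * ?u ^ Suc m)
       + smult (- of_real (2 * ?i * (?i + b))) (F * ?u ^ m)) x"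
      unfolding L by (simp only: poly_add poly_smult poly_mult poly_power power_Suc e_def poly_pCons poly_0) (simp add: algebra_simps)
  qed
  then have "jint a ?c (smult (- of_real ((n - ?i) * (n + ?i + a + b + 1))) (F * ?u ^ Suc m)
       + smult (- of_real (2 * ?i * (?i + b))) (F * ?u ^ m)) = 0"
    using jint_by_parts[OF assms(2,3), of ?r] by (simp only:)
  moreover have "C * X = - D * Y" if "- C * X + - D * Y = 0" for C D X Y :: complex
    using that by (metis add.inverse_inverse add_eq_0_iff mult_minus_left)
  ultimately show ?thesis
    unfolding jint_add[OF assms(2,3)] jint_smult[OF assms(2,3)] by blast
qed

text \<open>
  The factor \<open>n - i\<close> of the recurrence vanishes at \<open>i = N\<close>; from there the moments vanish downwards.
  With the weight exponent raised by \<open>j\<close> one loses \<open>j\<close> degrees of orthogonality.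
\<close>

lemma jacobi_moment_eq_0:
  assumes F: "jacobi_ode (real N) a b F" and ab: "a > -1" "b + real j > -1" and "k + j < N"
  shows "jint a (b + real j) (F * [:1, 1:] ^ k) = 0"
  using \<open>k + j < N\<close>
proof (induction "N - Suc (k + j)" arbitrary: k)
  case 0
  then have N: "real N = real (Suc k + j)" by simp
  have "of_real (2 * real (Suc k + j) * (real (Suc k + j) + b)) * jint a (b + real j) (F * [:1, 1:] ^ k) = 0"
    using jacobi_moment_rec[OF F ab, of k] unfolding N by simp
  moreover have "2 * real (Suc k + j) * (real (Suc k + j) + b) \<noteq> 0" using ab by simp
  ultimately show ?case by (metis mult_eq_0_iff of_real_eq_0_iff)
next
  case (Suc n)
  then have "jint a (b + real j) (F * [:1, 1:] ^ Suc k) = 0" by (intro Suc.hyps(1)) auto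
  then have "of_real (2 * real (Suc k + j) * (real (Suc k + j) + b)) * jint a (b + real j) (F * [:1, 1:] ^ k) = 0"
    using jacobi_moment_rec[OF F ab, of k] by simp
  moreover have "2 * real (Suc k + j) * (real (Suc k + j) + b) \<noteq> 0" using ab by simp
  ultimately show ?case by (metis mult_eq_0_iff of_real_eq_0_iff)
qed

lemma jint_mult_expand:
  assumes "a > -1" "c > -1" "degree t \<le> d"
  shows "jint a c (F * t) = (\<Sum>k\<le>d. tcoeff (-1) t k * jint a c (F * [:1, 1:] ^ k))"
proof -
  have "F * t = (\<Sum>k\<le>d. smult (tcoeff (-1) t k) (F * [:1, 1:] ^ k))"
    using tcoeff_expand[OF assms(3), of "-1"] by (metis (no_types, lifting) minus_minus mult_smult_right sum.cong sum_distrib_left)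
  then show ?thesis by (simp add: jint_sum jint_smult assms)
qed

lemma jacobi_orthogonal:
  assumes "jacobi_ode (real N) a b F" "a > -1" "b + real j > -1" "degree t + j < N"
  shows "jint a (b + real j) (F * t) = 0"
proof -
  have "jint a (b + real j) (F * t) = (\<Sum>k\<le>degree t. tcoeff (-1) t k * jint a (b + real j) (F * [:1, 1:] ^ k))"
    using assms by (intro jint_mult_expand) auto
  also have "\<dots> = 0" using assms by (intro sum.neutral ballI) (simp add: jacobi_moment_eq_0)
  finally show ?thesis .
qed

section \<open>An energy identity for the resolvent of differentiation\<close>

lemma pderiv_map_poly_cnj: "pderiv (map_poly cnj p) = map_poly cnj (pderiv p)"
  by (rule poly_eqI) (simp add: coeff_pderiv coeff_map_poly)

lemma poly_map_of_real: "poly (map_poly of_real p) (of_real x) = (of_real (poly p x) :: complex)"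
  by (induction p) (simp_all add: map_poly_pCons)

lemma pderiv_map_of_real: "pderiv (map_poly of_real p) = (map_poly of_real (pderiv p) :: complex poly)"
  by (rule poly_eqI) (simp add: coeff_pderiv coeff_map_poly)

lemma jweight_minus_1:
  assumes "x \<in> {-1<..<1}"
  shows "jweight a c x = (1 + x) * jweight a (c - 1) x"
  using assms by (simp add: jweight_def powr_diff)

text \<open>
  The real part of the equation \<open>z p - p' = z F\<close>, multiplied by the weight and by \<open>M\<close> times the
  conjugate of \<open>q\<close>. The derivative of \<open>q\<close> enters only through the derivative of the squared modulus
  of \<open>q\<close> and is integrated by parts. The boundary value at \<open>1\<close> vanishes because \<open>p\<close> does; the one
  at \<open>-1\<close> survives exactly for \<open>c = 0\<close>.
\<close>

lemma energy_identity:
  fixes q F :: "complex poly" and M :: "real poly"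
  assumes a: "a > -1" and c: "c \<ge> 0" and F: "map_poly cnj F = F"
    and p: "p = [:1, -1:] * q" and eq: "smult z p - pderiv p = smult z F"
  defines "t \<equiv> map_poly of_real M * q"
  shows "((\<lambda>x. jweight a (c - 1) x * (cmod (poly q (of_real x)))\<^sup>2 / 2 *
            (poly M x * ((1 - a) * (1 + x) + c * (1 - x)) + poly (pderiv M) x * (1 - x\<^sup>2)
             + 2 * Re z * (1 - x\<^sup>2) * poly M x))
    has_integral Re (z * cnj (jint a c (F * t)))
       - (if c = 0 then 2 powr (a + 1) * poly M (-1) * (cmod (poly q (-1)))\<^sup>2 / 2 else 0)) {-1..1}"
proof -
  let ?S = "map_poly of_real M * (q * map_poly cnj q) :: complex poly"
  \<comment> \<open>for c = 0 the factor powr would vanish at -1 and lose continuity there\<close>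
  define h where "h x = (if c = 0 then 1 else (1 + x) powr c)" for x :: real
  let ?\<Phi> = "\<lambda>x. of_real ((1 - x) powr (a + 1) * h x) * poly ?S (complex_of_real x)"
  let ?d = "\<lambda>x. of_real (((c - 1 - a) - (a + c + 1) * x) * jweight a (c - 1) x) * poly ?S (complex_of_real x)
      + of_real ((1 - x\<^sup>2) * jweight a (c - 1) x) * poly (pderiv ?S) (complex_of_real x)"
  have S: "poly ?S (of_real x) = of_real (poly M x * (cmod (poly q (of_real x)))\<^sup>2)" for x
    by (simp add: poly_map_of_real poly_map_poly_cnj complex_norm_square flip: of_real_power)
  have D: "(?d has_integral ?\<Phi> 1 - ?\<Phi> (-1)) {-1..1}"
  proof (rule fundamental_theorem_of_calculus_interior)
    have "continuous_on {-1..1} h"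
      unfolding h_def using c by (cases "c = 0") (auto intro!: continuous_intros continuous_on_powr')
    moreover have "continuous_on {-1..1} (\<lambda>x. (1 - x) powr (a + 1))"
      using a by (intro continuous_intros continuous_on_powr') auto
    ultimately show "continuous_on {-1..1} ?\<Phi>"
      by (intro continuous_on_mult continuous_on_of_real continuous_on_poly_of_real)
    fix x :: real assume x: "x \<in> {-1<..<1}"
    have "((\<lambda>x. complex_of_real (jweight (a + 1) (c - 1 + 1) x)) has_vector_derivative
        of_real (((c - 1 - a) - (a + (c - 1) + 2) * x) * jweight a (c - 1) x)) (at x)"
      by (intro has_vector_derivative_of_real has_real_derivative_iff_has_vector_derivative[THEN iffD1] jweight_deriv x)
    note E = has_vector_derivative_mult[OF this poly_of_real_vector_derivative[of ?S x UNIV]]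
    have E': "((\<lambda>x. complex_of_real (jweight (a + 1) (c - 1 + 1) x) * poly ?S (of_real x)) has_vector_derivative ?d x) (at x)"
    proof (rule has_vector_derivative_eq_rhs[OF E])
      have J: "jweight (a + 1) (c - 1 + 1) x = (1 - x\<^sup>2) * jweight a (c - 1) x"
        using x by (intro jweight_Suc) auto
      have "a + (c - 1) + 2 = a + c + 1" by simp
      then show "of_real (jweight (a + 1) (c - 1 + 1) x) * poly (pderiv ?S) (of_real x)
          + of_real ((c - 1 - a - (a + (c - 1) + 2) * x) * jweight a (c - 1) x) * poly ?S (of_real x) = ?d x"
        unfolding J by (simp only: add.commute)
    qed
    show "(?\<Phi> has_vector_derivative ?d x) (at x)"
    proof (rule has_vector_derivative_transform_within_open[OF E' open_greaterThanLessThan x])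
      fix y :: real assume "y \<in> {-1<..<1}"
      then show "of_real (jweight (a + 1) (c - 1 + 1) y) * poly ?S (of_real y) = ?\<Phi> y"
        by (simp add: jweight_def h_def)
    qed
  qed simp
  have \<Phi>1: "?\<Phi> 1 = 0" using a by simp
  have \<Phi>m: "?\<Phi> (-1) = of_real (if c = 0 then 2 powr (a + 1) * poly M (-1) * (cmod (poly q (-1)))\<^sup>2 else 0)"
    using S[of "-1"] by (simp add: h_def)
  have D': "((\<lambda>x. Re (?d x) / 2) has_integral
      - (if c = 0 then 2 powr (a + 1) * poly M (-1) * (cmod (poly q (-1)))\<^sup>2 / 2 else 0)) {-1..1}"
    using has_integral_divide[OF has_integral_Re[OF D], of 2] unfolding \<Phi>1 \<Phi>m by (auto split: if_splits)
  have c': "c > -1" using c by simp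
  have "jint a c (smult z F * map_poly cnj t) = z * cnj (jint a c (F * t))"
  proof -
    have "map_poly cnj (F * t) = map_poly cnj F * map_poly cnj t"
      by (simp add: poly_eq_poly_eq_iff[symmetric] fun_eq_iff poly_map_poly_cnj)
    then show ?thesis using jint_cnj[OF a c', of "F * t"] by (simp add: F jint_smult a c')
  qed
  then have I: "((\<lambda>x. Re (of_real (jweight a c x) * poly ((smult z p - pderiv p) * map_poly cnj t) (of_real x)))
      has_integral Re (z * cnj (jint a c (F * t)))) {-1..1}"
    using has_integral_Re[OF jint_has_integral[OF a c']] unfolding eq by metis
  have K: "Re (of_real (jweight a c x) * poly ((smult z p - pderiv p) * map_poly cnj t) (of_real x)) + Re (?d x) / 2
      = jweight a (c - 1) x * (cmod (poly q (of_real x)))\<^sup>2 / 2 *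
            (poly M x * ((1 - a) * (1 + x) + c * (1 - x)) + poly (pderiv M) x * (1 - x\<^sup>2)
             + 2 * Re z * (1 - x\<^sup>2) * poly M x)" if x: "x \<in> {-1<..<1}" for x
  proof -
    define w \<alpha> \<beta> m m' where "w = jweight a (c - 1) x" and "\<alpha> = poly q (of_real x)"
      and "\<beta> = poly (pderiv q) (of_real x)" and "m = poly M x" and "m' = poly (pderiv M) x"
    have 1: "poly ((smult z p - pderiv p) * map_poly cnj t) (of_real x)
        = (z * (1 - of_real x) * \<alpha> + \<alpha> - (1 - of_real x) * \<beta>) * (of_real m * cnj \<alpha>)"
      unfolding p t_def
      by (simp add: poly_map_poly_cnj poly_map_of_real pderiv_mult pderiv_pCons \<alpha>_def \<beta>_def m_def del: mult_pCons_left)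
    have 2: "poly ?S (of_real x) = of_real m * (\<alpha> * cnj \<alpha>)"
      by (simp add: poly_map_poly_cnj poly_map_of_real \<alpha>_def m_def)
    have 3: "poly (pderiv ?S) (of_real x) = of_real m' * (\<alpha> * cnj \<alpha>) + of_real m * (\<beta> * cnj \<alpha> + \<alpha> * cnj \<beta>)"
      by (simp add: poly_map_poly_cnj poly_map_of_real pderiv_mult pderiv_map_poly_cnj pderiv_map_of_real \<alpha>_def \<beta>_def m_def m'_def algebra_simps)
    define n r where "n = (cmod \<alpha>)\<^sup>2" and "r = Re (\<beta> * cnj \<alpha>)"
    have n: "\<alpha> * cnj \<alpha> = of_real n" by (simp only: n_def complex_norm_square)
    have r: "\<beta> * cnj \<alpha> + \<alpha> * cnj \<beta> = of_real (2 * r)" by (simp add: r_def complex_eq_iff)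
    have "(z * (1 - of_real x) * \<alpha> + \<alpha> - (1 - of_real x) * \<beta>) * (of_real m * cnj \<alpha>)
        = of_real m * (z * of_real (1 - x) * (\<alpha> * cnj \<alpha>) + \<alpha> * cnj \<alpha> - of_real (1 - x) * (\<beta> * cnj \<alpha>))"
      by (simp add: algebra_simps)
    then have E: "(z * (1 - of_real x) * \<alpha> + \<alpha> - (1 - of_real x) * \<beta>) * (of_real m * cnj \<alpha>)
        = of_real m * (z * of_real (1 - x) * of_real n + of_real n - of_real (1 - x) * (\<beta> * cnj \<alpha>))"
      unfolding n .
    have A1: "Re (of_real ((1 + x) * w) * ((z * (1 - of_real x) * \<alpha> + \<alpha> - (1 - of_real x) * \<beta>) * (of_real m * cnj \<alpha>)))
        = (1 + x) * w * (m * (Re z * (1 - x) * n + n - (1 - x) * r))"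
      unfolding E by (simp add: r_def)
    have A2: "Re (of_real ((c - 1 - a - (a + c + 1) * x) * w) * (of_real m * of_real n)
        + of_real ((1 - x\<^sup>2) * w) * (of_real m' * of_real n + of_real m * of_real (2 * r)))
        = (c - 1 - a - (a + c + 1) * x) * w * (m * n) + (1 - x\<^sup>2) * w * (m' * n + m * (2 * r))"
      by simp
    \<comment> \<open>the terms with r, half the derivative of the squared modulus of q, cancel here\<close>
    have A3: "(1 + x) * w * (m * (Z * (1 - x) * n + n - (1 - x) * r))
        + ((c - 1 - a - (a + c + 1) * x) * w * (m * n) + (1 - x\<^sup>2) * w * (m' * n + m * (2 * r))) / 2
        = w * n / 2 * (m * ((1 - a) * (1 + x) + c * (1 - x)) + m' * (1 - x\<^sup>2) + 2 * Z * (1 - x\<^sup>2) * m)" for Z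
      by (simp add: field_simps power2_eq_square)
    show ?thesis
      unfolding 1 2 3 jweight_minus_1[OF x, of a c] w_def[symmetric] \<alpha>_def[symmetric] m_def[symmetric] m'_def[symmetric]
        n r A1 A2 n_def[symmetric] by (rule A3)
  qed
  have "((\<lambda>x. Re (of_real (jweight a c x) * poly ((smult z p - pderiv p) * map_poly cnj t) (of_real x)) + Re (?d x) / 2)
    has_integral Re (z * cnj (jint a c (F * t)))
       + - (if c = 0 then 2 powr (a + 1) * poly M (-1) * (cmod (poly q (-1)))\<^sup>2 / 2 else 0)) {-1..1}"
    by (rule has_integral_add[OF I D'])
  then have "((\<lambda>x. Re (of_real (jweight a c x) * poly ((smult z p - pderiv p) * map_poly cnj t) (of_real x)) + Re (?d x) / 2)
    has_integral Re (z * cnj (jint a c (F * t)))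
       - (if c = 0 then 2 powr (a + 1) * poly M (-1) * (cmod (poly q (-1)))\<^sup>2 / 2 else 0)) {-1<..<1}"
    unfolding has_integral_Icc_iff_Ioo by (simp only: diff_conv_add_uminus)
  then show ?thesis
    unfolding has_integral_Icc_iff_Ioo
    by (rule has_integral_eq[rotated]) (rule K)
qed

text \<open>
  The form in which the identity is used: a multiplier \<open>M\<close> that makes the integrand positive forces
  a sign on a moment of \<open>F\<close> that can also be computed from a few leading coefficients.
\<close>

lemma energy_pos:
  fixes q F :: "complex poly" and M :: "real poly"
  assumes a: "a > -1" and c: "c \<ge> 0" and F: "map_poly cnj F = F"
    and p: "p = [:1, -1:] * q" and eq: "smult z p - pderiv p = smult z F" and q: "q \<noteq> 0"
    and M: "poly M (-1) \<ge> 0"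
    and pos: "\<And>x. x \<in> {-1<..<1} \<Longrightarrow> poly M x * ((1 - a) * (1 + x) + c * (1 - x))
        + poly (pderiv M) x * (1 - x\<^sup>2) + 2 * Re z * (1 - x\<^sup>2) * poly M x > 0"
  shows "Re (z * cnj (jint a c (F * (map_poly of_real M * q)))) > 0"
proof (rule ccontr)
  assume neg: "\<not> ?thesis"
  let ?B = "\<lambda>x. poly M x * ((1 - a) * (1 + x) + c * (1 - x))
        + poly (pderiv M) x * (1 - x\<^sup>2) + 2 * Re z * (1 - x\<^sup>2) * poly M x"
  let ?K = "\<lambda>x. jweight a (c - 1) x * (cmod (poly q (of_real x)))\<^sup>2 / 2 * ?B x"
  note I = energy_identity[OF a c F p eq, of M]
  have "?K x = 0" if "x \<in> {-1<..<1}" for x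
  proof (rule has_integral_nonneg_eq_0[OF I _ _ _ that])
    have "(if c = 0 then 2 powr (a + 1) * poly M (-1) * (cmod (poly q (-1)))\<^sup>2 / 2 else 0) \<ge> 0"
      using M by auto
    with neg show "Re (z * cnj (jint a c (F * (map_poly of_real M * q))))
       - (if c = 0 then 2 powr (a + 1) * poly M (-1) * (cmod (poly q (-1)))\<^sup>2 / 2 else 0) \<le> 0"
      by linarith
    show "continuous_on {-1<..<1} ?K"
      by (intro continuous_intros continuous_on_jweight_open) auto
    show "0 \<le> ?K x" if "x \<in> {-1<..<1}" for x
      using less_imp_le[OF pos[OF that]] by (intro mult_nonneg_nonneg divide_nonneg_nonneg) (auto simp: jweight_nonneg)
  qed
  then have "poly q (of_real x) = 0" if "x \<in> {-1<..<1}" for x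
    using that pos[OF that] jweight_pos[OF that, of a "c - 1"] by fastforce
  then show False using q poly_of_real_eq_0_imp by blast
qed

lemma jint_norm_pos:
  assumes a: "a > -1" "c > -1" and F: "map_poly cnj F = F" "F \<noteq> 0" and L: "jint a c (F * F) = of_real L"
  shows "L > 0"
proof -
  have eq: "Re (of_real (jweight a c x) * poly (F * F) (of_real x)) = jweight a c x * (cmod (poly F (of_real x)))\<^sup>2" for x
  proof -
    have "cnj (poly F (of_real x)) = poly F (of_real x)"
      using poly_map_poly_cnj[of F "of_real x"] F by simp
    then have "Im (poly F (of_real x)) = 0" by (simp add: complex_eq_iff)
    then show ?thesis unfolding cmod_power2 by (simp add: power2_eq_square)
  qed
  have "((\<lambda>x. jweight a c x * (cmod (poly F (of_real x)))\<^sup>2) has_integral L) {-1..1}"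
    using has_integral_Re[OF jint_has_integral[OF a, of "F * F"]] unfolding eq L by simp
  then have "L \<ge> 0"
    by (rule has_integral_nonneg) (simp add: jweight_nonneg)
  moreover have "L \<noteq> 0"
  proof
    assume "L = 0"
    then have "jint a c (F * map_poly cnj F) = 0" using L F by simp
    then show False using jint_norm_eq_0[OF a] F by blast
  qed
  ultimately show ?thesis by simp
qed

text \<open>
  The polynomial solution of \<open>p - \<nu> p' = F\<close>, as a finite Neumann series. Its value at \<open>1\<close> is the
  generating polynomial of the derivatives of \<open>F\<close> at \<open>1\<close>.
\<close>

definition resolvent :: "complex \<Rightarrow> complex poly \<Rightarrow> complex poly" where
  "resolvent \<nu> F = (\<Sum>k\<le>degree F. smult (\<nu> ^ k) ((pderiv ^^ k) F))"

lemma higher_pderiv_eq_0: "degree F < k \<Longrightarrow> (pderiv ^^ k) F = (0 :: complex poly)"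
proof (induction k arbitrary: F)
  case (Suc k)
  show ?case
  proof (cases "degree F = 0")
    case True
    then have "pderiv F = 0" by (simp add: pderiv_eq_0_iff)
    then have "(pderiv ^^ Suc k) F = (pderiv ^^ k) 0" by (simp only: funpow_Suc_right o_apply)
    also have "(pderiv ^^ k) 0 = (0 :: complex poly)" by (induction k) auto
    finally show ?thesis .
  next
    case False
    then have "(pderiv ^^ k) (pderiv F) = 0" using Suc.prems by (intro Suc.IH) (simp add: degree_pderiv)
    then show ?thesis by (simp only: funpow_Suc_right o_apply)
  qed
qed simp

lemma resolvent_eq: "resolvent \<nu> F = F + smult \<nu> (pderiv (resolvent \<nu> F))"
proof -
  have "resolvent \<nu> F = (\<Sum>k\<le>Suc (degree F). smult (\<nu> ^ k) ((pderiv ^^ k) F))"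
    using higher_pderiv_eq_0[of F "Suc (degree F)"] by (simp add: resolvent_def)
  also have "\<dots> = F + (\<Sum>k\<le>degree F. smult (\<nu> ^ Suc k) ((pderiv ^^ Suc k) F))"
    by (simp only: sum.atMost_Suc_shift) simp
  also have "(\<Sum>k\<le>degree F. smult (\<nu> ^ Suc k) ((pderiv ^^ Suc k) F)) = smult \<nu> (pderiv (resolvent \<nu> F))"
    unfolding resolvent_def higher_pderiv_sum[where n = 1, simplified]
    by (rule poly_eqI) (simp add: coeff_sum coeff_pderiv sum_distrib_left algebra_simps)
  finally show ?thesis .
qed

lemma degree_resolvent_le: "degree (resolvent \<nu> F) \<le> degree F"
  unfolding resolvent_def
proof (rule degree_sum_le)
  fix k
  have "degree ((pderiv ^^ k) F) \<le> degree F" by (induction k) (simp_all add: degree_pderiv)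
  then show "degree (smult (\<nu> ^ k) ((pderiv ^^ k) F)) \<le> degree F"
    using degree_smult_le order_trans by blast
qed simp

lemma tcoeff_resolvent:
  "tcoeff x0 (resolvent \<nu> F) k = tcoeff x0 F k + \<nu> * (of_nat (Suc k) * tcoeff x0 (resolvent \<nu> F) (Suc k))"
  by (subst resolvent_eq) (simp add: tcoeff_add tcoeff_smult tcoeff_pderiv)

section \<open>Leading moments of Jacobi polynomials\<close>

text \<open>
  Coefficients of \<open>jacobi N a b\<close> in descending powers of \<open>1 + x\<close>, with the degree replaced by a
  real variable \<open>x\<close>, so that inequalities between them can be proved as inequalities of rational
  functions.
\<close>

primrec top_coeff :: "real \<Rightarrow> real \<Rightarrow> real \<Rightarrow> nat \<Rightarrow> real" where
  "top_coeff a b x 0 = 1"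
| "top_coeff a b x (Suc r) = - (2 * (x - r) * (x - r + b) * top_coeff a b x r / ((real r + 1) * (2 * x - r + a + b)))"

text \<open>
  Moments of \<open>jacobi N a b\<close> from the first nonvanishing one upwards, relative to that one, again
  with a real variable in place of \<open>N\<close>.
\<close>

primrec top_moment :: "real \<Rightarrow> real \<Rightarrow> real \<Rightarrow> nat \<Rightarrow> real" where
  "top_moment a b x 0 = 1"
| "top_moment a b x (Suc r) = 2 * (x + r + 1) * (x + r + 1 + b) / ((real r + 1) * (2 * x + r + a + b + 2)) * top_moment a b x r"

lemma tcoeff_jacobi_top:
  assumes "r \<le> N" "\<And>i. i < N \<Longrightarrow> real N + i + a + b + 1 \<noteq> 0"
  shows "tcoeff (-1) (jacobi N a b) (N - r) = of_real (top_coeff a b N r)"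
  using assms(1)
proof (induction r)
  case 0
  then show ?case by (simp add: tcoeff_jacobi)
next
  case (Suc r)
  let ?k = "N - Suc r" and ?f = "tcoeff (-1) (jacobi N a b)"
  have k: "real ?k = real N - r - 1" "Suc ?k = N - r" using Suc.prems by auto
  have "of_real (2 * (real ?k + 1) * (real ?k + 1 + b)) * ?f (Suc ?k)
      = - of_real ((real N - real ?k) * (real N + real ?k + a + b + 1)) * ?f ?k"
    by (rule jacobi_ode_tcoeff_m1[OF jacobi_jacobi_ode]) (rule assms)
  then have *: "of_real (2 * (real N - r) * (real N - r + b)) * complex_of_real (top_coeff a b N r)
      = - of_real ((real r + 1) * (2 * real N - r + a + b)) * ?f ?k"
    unfolding k Suc.IH[OF Suc_leD[OF Suc.prems]] by (simp add: algebra_simps)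
  have "real N + real ?k + a + b + 1 \<noteq> 0" using assms(2)[of ?k] Suc.prems by simp
  then have "2 * real N - r + a + b \<noteq> 0" unfolding k by (simp add: algebra_simps)
  then have ne: "(real r + 1) * (2 * real N - r + a + b) \<noteq> 0" by simp
  have "?f ?k = - (of_real (2 * (real N - r) * (real N - r + b)) * complex_of_real (top_coeff a b N r))
      / of_real ((real r + 1) * (2 * real N - r + a + b))"
    unfolding * using ne by (simp del: of_real_mult of_real_add of_real_diff)
  then show ?case by simp
qed

lemma jacobi_moment_top:
  assumes F: "jacobi_ode (real N) a b F" and ab: "a > -1" "b + real j > -1" and j: "j \<le> N"
    and pos: "2 * real N + a + b + 2 > 0"
  shows "jint a (b + real j) (F * [:1, 1:] ^ (N - j + r))
     = of_real (top_moment a b N r) * jint a (b + real j) (F * [:1, 1:] ^ (N - j))"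
proof (induction r)
  case (Suc r)
  let ?L = "\<lambda>k. jint a (b + real j) (F * [:1, 1:] ^ k)"
  have i: "real (Suc (N - j + r) + j) = real N + r + 1" using j by simp
  have "of_real ((real r + 1) * (2 * real N + r + a + b + 2)) * ?L (Suc (N - j + r))
     = of_real (2 * (real N + r + 1) * (real N + r + 1 + b)) * ?L (N - j + r)"
    using jacobi_moment_rec[OF F ab, of "N - j + r"] unfolding i
    by (simp add: algebra_simps)
  moreover have "(real r + 1) * (2 * real N + r + a + b + 2) \<noteq> 0" using pos by simp
  ultimately have "?L (Suc (N - j + r)) = of_real (2 * (real N + r + 1) * (real N + r + 1 + b)) * ?L (N - j + r)
      / of_real ((real r + 1) * (2 * real N + r + a + b + 2))"
    by (metis nonzero_mult_div_cancel_left of_real_eq_0_iff)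
  then show ?case unfolding Suc.IH by simp
qed simp

text \<open>
  Only the Taylor coefficients of \<open>t\<close> of index at least \<open>N - j\<close> meet a nonvanishing moment.
\<close>

lemma jacobi_jint_top:
  assumes F: "jacobi_ode (real N) a b F" and ab: "a > -1" "b + real j > -1" and j: "j \<le> N"
    and pos: "2 * real N + a + b + 2 > 0" and t: "degree t \<le> N + m"
  shows "jint a (b + real j) (F * t) = jint a (b + real j) (F * [:1, 1:] ^ (N - j)) *
     (\<Sum>r\<le>j + m. tcoeff (-1) t (N + m - r) * of_real (top_moment a b N (j + m - r)))"
proof -
  let ?L = "\<lambda>k. jint a (b + real j) (F * [:1, 1:] ^ k)"
  let ?g = "\<lambda>r. tcoeff (-1) t (N + m - r) * ?L (N + m - r)"
  have "jint a (b + real j) (F * t) = (\<Sum>k\<le>N + m. tcoeff (-1) t k * ?L k)"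
    using ab t by (rule jint_mult_expand)
  also have "\<dots> = (\<Sum>r\<le>N + m. ?g r)"
    by (rule sum.nat_diff_reindex[where n = "Suc (N + m)", symmetric, unfolded lessThan_Suc_atMost, simplified])
  also have "\<dots> = (\<Sum>r\<le>j + m. ?g r)"
    using j by (intro sum.mono_neutral_right) (auto simp: jacobi_moment_eq_0[OF F ab])
  also have "\<dots> = ?L (N - j) * (\<Sum>r\<le>j + m. tcoeff (-1) t (N + m - r) * of_real (top_moment a b N (j + m - r)))"
    unfolding sum_distrib_left
  proof (rule sum.cong)
    fix r assume "r \<in> {..j + m}"
    then have "N + m - r = N - j + (j + m - r)" using j by auto
    then have "?L (N + m - r) = of_real (top_moment a b N (j + m - r)) * ?L (N - j)"
      using jacobi_moment_top[OF F ab j pos] by presburger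
    then show "?g r = ?L (N - j) * (tcoeff (-1) t (N + m - r) * of_real (top_moment a b N (j + m - r)))"
      by (simp only: mult_ac)
  qed simp
  finally show ?thesis .
qed

lemma jint_real:
  assumes "a > -1" "c > -1" "map_poly cnj f = f"
  obtains r where "jint a c f = of_real r"
  using jint_cnj[OF assms(1,2), of f] assms(3) by (metis Reals_cnj_iff Reals_cases)

lemma map_poly_cnj_mult: "map_poly cnj (p * q) = map_poly cnj p * map_poly cnj q"
  by (simp add: poly_eq_poly_eq_iff[symmetric] fun_eq_iff poly_map_poly_cnj)

lemma map_poly_cnj_power: "map_poly cnj (p ^ n) = map_poly cnj p ^ n"
  by (simp add: poly_eq_poly_eq_iff[symmetric] fun_eq_iff poly_map_poly_cnj)

lemma jacobi_nonzero: "jacobi N a b \<noteq> 0"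
proof
  assume "jacobi N a b = 0"
  then have "tcoeff (-1) (jacobi N a b) N = 0" by (simp add: tcoeff_def)
  then show False by (simp add: tcoeff_jacobi)
qed

text \<open>
  Integrals against the resolvent are polynomials in \<open>1 / z\<close>; conjugation turns \<open>1 / z\<close> into a
  positive multiple of \<open>z\<close>, so that the signs are governed by the real parts of powers of \<open>z\<close>.
\<close>

lemma Re_mult_cnj_inverse_poly:
  fixes e0 e1 e2 e3 e4 h :: real
  assumes "z \<noteq> 0"
  defines "s \<equiv> 1 / (cmod z)\<^sup>2"
  shows "Re (z * cnj (of_real h * (of_real e0 + of_real e1 * (1 / z) + of_real e2 * (1 / z) ^ 2
            + of_real e3 * (1 / z) ^ 3 + of_real e4 * (1 / z) ^ 4)))
   = h * (e0 * Re z + e1 * s * Re (z ^ 2) + e2 * s ^ 2 * Re (z ^ 3) + e3 * s ^ 3 * Re (z ^ 4) + e4 * s ^ 4 * Re (z ^ 5))"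
proof -
  have "of_real ((cmod z)\<^sup>2) * cnj (1 / z) = z"
    unfolding complex_norm_square using assms(1) by simp
  then have c: "cnj (1 / z) = of_real s * z"
    using assms(1) by (simp add: s_def field_simps)
  have "z * cnj (of_real h * (of_real e0 + of_real e1 * (1 / z) + of_real e2 * (1 / z) ^ 2
            + of_real e3 * (1 / z) ^ 3 + of_real e4 * (1 / z) ^ 4))
     = z * (of_real h * (of_real e0 + of_real e1 * (of_real s * z) + of_real e2 * (of_real s * z) ^ 2
            + of_real e3 * (of_real s * z) ^ 3 + of_real e4 * (of_real s * z) ^ 4))"
    by (simp only: complex_cnj_mult complex_cnj_add complex_cnj_power complex_cnj_complex_of_real c)
  also have "\<dots> = of_real h * (of_real e0 * z + of_real (e1 * s) * z ^ 2 + of_real (e2 * s ^ 2) * z ^ 3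
            + of_real (e3 * s ^ 3) * z ^ 4 + of_real (e4 * s ^ 4) * z ^ 5)"
    by (simp add: algebra_simps power_mult_distrib eval_nat_numeral)
  finally show ?thesis by (simp only: Re_complex_of_real plus_complex.sel times_complex.sel Im_complex_of_real) simp
qed

lemma Re_powers:
  "Re (z ^ 2) = (Re z)\<^sup>2 - (Im z)\<^sup>2"
  "Re (z ^ 3) = Re z * ((Re z)\<^sup>2 - 3 * (Im z)\<^sup>2)"
  "Re (z ^ 4) = ((Re z)\<^sup>2)\<^sup>2 - 6 * (Re z)\<^sup>2 * (Im z)\<^sup>2 + ((Im z)\<^sup>2)\<^sup>2"
  "Re (z ^ 5) = Re z * (((Re z)\<^sup>2)\<^sup>2 - 10 * (Re z)\<^sup>2 * (Im z)\<^sup>2 + 5 * ((Im z)\<^sup>2)\<^sup>2)"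
  by (simp_all add: eval_nat_numeral algebra_simps)

text \<open>
  The setting of the energy identity: a zero of the resolvent at \<open>1\<close> is divided out. The
  coefficients of the quotient follow from those of the resolvent from the top downwards.
\<close>

lemma resolvent_root_factor:
  fixes F :: "complex poly"
  assumes F: "F = jacobi N a b" and N: "N > 0" and z: "z \<noteq> 0" and root: "poly (resolvent (1 / z) F) 1 = 0"
  obtains q where "resolvent (1 / z) F = [:1, -1:] * q" "q \<noteq> 0" "degree q < N"
    "smult z (resolvent (1 / z) F) - pderiv (resolvent (1 / z) F) = smult z F"
    "\<And>k. tcoeff (-1) q k = 2 * tcoeff (-1) q (Suc k) - tcoeff (-1) (resolvent (1 / z) F) (Suc k)"
proof -
  let ?p = "resolvent (1 / z) F"
  obtain q' where "?p = [:-1, 1:] * q'" using root by (auto simp: poly_eq_0_iff_dvd elim: dvdE)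
  then have q: "?p = [:1, -1:] * (- q')" by simp
  have dF: "degree F = N" by (simp add: F degree_jacobi)
  have "tcoeff (-1) ?p N = tcoeff (-1) F N"
    using degree_resolvent_le[of "1 / z" F] dF tcoeff_eq_0[of ?p "Suc N"] by (simp add: tcoeff_resolvent[of _ _ _ N])
  also have "tcoeff (-1) F N = 1" by (simp add: F tcoeff_jacobi)
  finally have "?p \<noteq> 0" by (auto simp: tcoeff_def)
  then have q0: "- q' \<noteq> 0" using q by auto
  have "degree ?p = 1 + degree (- q')" unfolding q using q0 by (subst degree_mult_eq) auto
  then have "degree (- q') < N" using degree_resolvent_le[of "1 / z" F] dF by simp
  moreover have "smult z ?p - pderiv ?p = smult z F"
    using arg_cong[OF resolvent_eq[of "1 / z" F], of "smult z"] z by (simp add: smult_add_right)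
  moreover have "tcoeff (-1) (- q') k = 2 * tcoeff (-1) (- q') (Suc k) - tcoeff (-1) ?p (Suc k)" for k
    unfolding q tcoeff_mult_linear by simp
  ultimately show ?thesis using that[OF q q0] by blast
qed

lemma tcoeff_resolvent_top:
  assumes F: "F = jacobi N a b" and ne: "\<And>i. i < N \<Longrightarrow> real N + i + a + b + 1 \<noteq> 0"
  shows "tcoeff (-1) (resolvent \<nu> F) N = 1"
    "r < N \<Longrightarrow> tcoeff (-1) (resolvent \<nu> F) (N - Suc r)
        = of_real (top_coeff a b N (Suc r)) + \<nu> * of_real (real N - r) * tcoeff (-1) (resolvent \<nu> F) (N - r)"
proof -
  show "tcoeff (-1) (resolvent \<nu> F) N = 1"
    using degree_resolvent_le[of \<nu> F] tcoeff_eq_0[of "resolvent \<nu> F" "Suc N"]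
    by (simp add: tcoeff_resolvent[of _ _ _ N] F degree_jacobi tcoeff_jacobi)
  assume r: "r < N"
  then have *: "Suc (N - Suc r) = N - r" "real (N - r) = real N - r" by auto
  show "tcoeff (-1) (resolvent \<nu> F) (N - Suc r)
        = of_real (top_coeff a b N (Suc r)) + \<nu> * of_real (real N - r) * tcoeff (-1) (resolvent \<nu> F) (N - r)"
    using r tcoeff_jacobi_top[OF _ ne, of "Suc r"]
    unfolding tcoeff_resolvent[of _ _ _ "N - Suc r"] * F
    by (simp only: *(2)[symmetric] of_real_of_nat_eq mult.assoc Suc_leI)
qed

section \<open>Inequalities between leading moments\<close>

text \<open>
  With \<open>x = y + 3\<close> each difference of the two sides is a quotient of polynomials in \<open>y\<close> with
  nonnegative coefficients.
\<close>

lemma sector_ineq_nonneg: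
  fixes a x :: real
  assumes a: "a = 0 \<or> a = 1/2" and x: "x \<ge> 3"
  defines "T \<equiv> top_moment a (a - 2) x" and "f \<equiv> top_coeff a (a - 2) x"
  shows "0 \<le> 2 + T 1 + f 1" "0 < T 2 + f 1 * T 1 + f 2"
    "T 2 + f 1 * T 1 + f 2 \<le> 2 + T 1 + f 1" "x \<le> x * T 1 + (x - 1) * f 1"
proof -
  define y where "y = x - 3"
  have y: "y \<ge> 0" "x = y + 3" using x by (auto simp: y_def)
  have ne: "y + 2 \<noteq> 0" "y + 3 \<noteq> 0" "2*y + 3 \<noteq> 0" "2*y + 5 \<noteq> 0" "2*y + 7 \<noteq> 0" using y by auto
  have *: "0 \<le> 2 + T 1 + f 1 \<and> 0 < T 2 + f 1 * T 1 + f 2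
    \<and> T 2 + f 1 * T 1 + f 2 \<le> 2 + T 1 + f 1 \<and> x \<le> x * T 1 + (x - 1) * f 1"
    using a
  proof
    assume a: "a = 0"
    have 1: "T 1 = (8 + 6*y + y^2) / (y+3)" "f 1 = (-3 - 4*y - y^2) / (y+2)"
      using ne unfolding T_def f_def a y(2) One_nat_def top_moment.simps top_coeff.simps
      by (simp_all add: field_simps power2_eq_square)
    have "T 2 = 2 * (x + 2) * (x + 2 - 2) / (2 * (2 * x + 1)) * T 1" "f 2 = - (2 * (x - 1) * (x - 1 - 2) * f 1 / (2 * (2 * x - 1 - 2)))"
      unfolding T_def f_def a numeral_2_eq_2 One_nat_def by (simp_all add: algebra_simps)
    moreover have "2 * (x + 2) * (x + 2 - 2) / (2 * (2 * x + 1)) * T 1 = (40 + 38*y + 11*y^2 + y^3) / (2*y+7)"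
      unfolding 1 y(2) using ne by (simp add: divide_simps) (simp add: algebra_simps power2_eq_square power3_eq_cube)
    moreover have "- (2 * (x - 1) * (x - 1 - 2) * f 1 / (2 * (2 * x - 1 - 2))) = (3*y + 4*y^2 + y^3) / (2*y+3)"
      unfolding 1 y(2) using ne by (simp add: divide_simps) (simp add: algebra_simps power2_eq_square power3_eq_cube)
    ultimately have 2: "T 2 = (40 + 38*y + 11*y^2 + y^3) / (2*y+7)" "f 2 = (3*y + 4*y^2 + y^3) / (2*y+3)" by simp_all
    have c0: "2 + T 1 + f 1 = (19 + 15*y + 3*y^2) / ((y+2)*(y+3))"
      unfolding 1 using ne by (simp add: divide_simps) (simp add: algebra_simps power2_eq_square)
    have d0: "T 2 + f 1 * T 1 + f 2 = (36 + 30*y + 6*y^2) / ((2*y+3)*(2*y+7))"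
      unfolding 1 2 using ne by (simp add: divide_simps) (simp add: algebra_simps eval_nat_numeral)
    have "(2 + T 1 + f 1) - (T 2 + f 1 * T 1 + f 2) = (183 + 335*y + 217*y^2 + 60*y^3 + 6*y^4) / ((y+2)*(y+3)*(2*y+3)*(2*y+7))"
      unfolding c0 d0 using ne by (simp add: divide_simps) (simp add: algebra_simps eval_nat_numeral)
    also have "\<dots> \<ge> 0" using y by simp
    finally have "T 2 + f 1 * T 1 + f 2 \<le> 2 + T 1 + f 1" by simp
    moreover have "x * T 1 + (x - 1) * f 1 - x = y + 2"
      unfolding 1 y(2) using ne by (simp add: divide_simps) (simp add: algebra_simps eval_nat_numeral)
    then have "x \<le> x * T 1 + (x - 1) * f 1" using y by linarith
    moreover have "0 \<le> 2 + T 1 + f 1" unfolding c0 using y by simp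
    moreover have "0 < T 2 + f 1 * T 1 + f 2" unfolding d0 using y by (intro divide_pos_pos mult_pos_pos; simp add: add_pos_nonneg add_nonneg_pos)
    ultimately show ?thesis by blast
  next
    assume a: "a = 1/2"
    have 1: "T 1 = (20 + 13*y + 2*y^2) / (2*y+7)" "f 1 = (-9 - 9*y - 2*y^2) / (2*y+5)"
      using ne unfolding T_def f_def a y(2) One_nat_def top_moment.simps top_coeff.simps
      by (simp_all add: field_simps power2_eq_square)
    have "T 2 = 2 * (x + 2) * (x + 2 - 3/2) / (2 * (2 * x + 2)) * T 1" "f 2 = - (2 * (x - 1) * (x - 1 - 3/2) * f 1 / (2 * (2 * x - 2)))"
      unfolding T_def f_def a numeral_2_eq_2 One_nat_def by (simp_all add: algebra_simps)
    moreover have "2 * (x + 2) * (x + 2 - 3/2) / (2 * (2 * x + 2)) * T 1 = (25 + 15*y + 2*y^2) / 4"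
      unfolding 1 y(2) using ne y(1) by (simp add: divide_simps) (simp add: algebra_simps power2_eq_square power3_eq_cube)
    moreover have "- (2 * (x - 1) * (x - 1 - 3/2) * f 1 / (2 * (2 * x - 2))) = (9 + 27*y + 20*y^2 + 4*y^3) / (4*(2*y+5))"
      unfolding 1 y(2) using ne by (simp add: divide_simps) (simp add: algebra_simps power2_eq_square power3_eq_cube)
    ultimately have 2: "T 2 = (25 + 15*y + 2*y^2) / 4" "f 2 = (9 + 27*y + 20*y^2 + 4*y^3) / (4*(2*y+5))" by simp_all
    have c0: "2 + T 1 + f 1 = (107 + 72*y + 12*y^2) / ((2*y+5)*(2*y+7))"
      unfolding 1 using ne by (simp add: divide_simps) (simp add: algebra_simps power2_eq_square)
    have d0: "T 2 + f 1 * T 1 + f 2 = (109 + 72*y + 12*y^2) / (2*(2*y+5)*(2*y+7))"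
      unfolding 1 2 using ne by (simp add: divide_simps) (simp add: algebra_simps eval_nat_numeral)
    have "(2 + T 1 + f 1) - (T 2 + f 1 * T 1 + f 2) = 3 / 2"
      unfolding c0 d0 using ne by (simp add: divide_simps) (simp add: algebra_simps eval_nat_numeral)
    then have "T 2 + f 1 * T 1 + f 2 \<le> 2 + T 1 + f 1" by simp
    moreover have "x * T 1 + (x - 1) * f 1 - x = (69 + 83*y + 32*y^2 + 4*y^3) / ((2*y+5)*(2*y+7))"
      unfolding 1 y(2) using ne by (simp add: divide_simps) (simp add: algebra_simps eval_nat_numeral)
    then have "x * T 1 + (x - 1) * f 1 - x \<ge> 0" using y by simp
    moreover have "0 \<le> 2 + T 1 + f 1" unfolding c0 using y by simp
    moreover have "0 < T 2 + f 1 * T 1 + f 2" unfolding d0 using y by (intro divide_pos_pos mult_pos_pos; simp add: add_pos_nonneg add_nonneg_pos)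
    ultimately show ?thesis by simp
  qed
  then show "0 \<le> 2 + T 1 + f 1" "0 < T 2 + f 1 * T 1 + f 2"
    "T 2 + f 1 * T 1 + f 2 \<le> 2 + T 1 + f 1" "x \<le> x * T 1 + (x - 1) * f 1" by blast+
qed

text \<open>
  The numbers \<open>c\<close>, \<open>d\<close>, \<open>g\<close> are the coefficients, as polynomials in \<open>1 / z\<close> and up to sign and a common factor, of the
  integrals of the polynomial \<open>F\<close> against \<open>q\<close>, \<open>p = (1 - x) q\<close> and \<open>(1 + x) p\<close> in the energy
  argument with \<open>a = -1/2\<close>; \<open>B\<close> and \<open>\<delta>\<close> are the parameters of a quadratic multiplier, where \<open>B\<close> is
  chosen to cancel the cubic coefficients. Again everything is a quotient of polynomials in \<open>y = x - 3\<close>. At \<open>x = 3\<close> the recurrence for the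
  fourth coefficient divides zero by zero, which the case distinction accounts for.
\<close>

lemma sector_ineq_minus_half:
  fixes x :: real
  assumes x: "x \<ge> 3" "x = 3 \<or> x \<ge> 4"
  defines "T \<equiv> top_moment (-1/2) (-5/2) x" and "f \<equiv> top_coeff (-1/2) (-5/2) x"
  defines "c0 \<equiv> T 2 + (2 + f 1) * T 1 + 4 + 2 * f 1 + f 2"
    and "c1 \<equiv> x * T 1 + 2 * x + (x - 1) * f 1" and "c2 \<equiv> x * (x - 1)"
    and "d0 \<equiv> T 3 + f 1 * T 2 + f 2 * T 1 + f 3"
    and "d1 \<equiv> x * T 2 + (x - 1) * f 1 * T 1 + (x - 2) * f 2"
    and "d2 \<equiv> x * (x - 1) * T 1 + (x - 2) * (x - 1) * f 1"
    and "d3 \<equiv> x * (x - 1) * (x - 2)"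
    and "g0 \<equiv> T 4 + f 1 * T 3 + f 2 * T 2 + f 3 * T 1 + f 4"
    and "g1 \<equiv> x * T 3 + (x - 1) * f 1 * T 2 + (x - 2) * f 2 * T 1 + (x - 3) * f 3"
    and "g2 \<equiv> x * (x - 1) * T 2 + (x - 2) * (x - 1) * f 1 * T 1 + (x - 3) * (x - 2) * f 2"
    and "g3 \<equiv> x * (x - 1) * (x - 2) * T 1 + (x - 3) * (x - 2) * (x - 1) * f 1"
    and "\<delta> \<equiv> (x - 2) / x" and "B \<equiv> 4 * (4 * x - 3) * (x - 2) / ((2 * x - 3) * (2 * x - 1))"
  shows "c0 > 0" "c1 > 0" "c2 > 0" "d0 > 0" "d1 > 0" "d3 > 0"
    "c1 * d0 \<le> d1 * c0" "d1 * c2 \<le> c1 * d2"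
    "B \<ge> 9/4" "\<delta> > 0" "B * d0 - g0 \<le> \<delta> * c0" "\<delta> * c1 \<le> B * d1 - g1" "\<delta> * c2 \<le> B * d2 - g2" "g3 = B * d3"
proof -
  define y where "y = x - 3"
  have y: "y \<ge> 0" "x = y + 3" "y = 0 \<or> y \<ge> 1" using x by (auto simp: y_def)
  have ne: "y + 1 \<noteq> 0" "y + 2 \<noteq> 0" "y + 3 \<noteq> 0" "2*y + 1 \<noteq> 0" "2*y + 3 \<noteq> 0" "2*y + 5 \<noteq> 0" "2*y + 7 \<noteq> 0" using y by auto
  have T1: "T 1 = (12 + 11*y + 2*y^2) / (2*y+5)"
    using ne unfolding T_def y(2) One_nat_def top_moment.simps by (simp add: field_simps power2_eq_square)
  have "T 2 = 2 * (x + 2) * (x + 2 - 5/2) / (2 * (2 * x)) * T 1"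
    unfolding T_def numeral_2_eq_2 One_nat_def by simp
  also have "\<dots> = (60 + 67*y + 21*y^2 + 2*y^3) / (4*(y+3))"
    unfolding T1 y(2) using ne by (simp add: divide_simps) (simp add: algebra_simps eval_nat_numeral)
  finally have T2: "T 2 = (60 + 67*y + 21*y^2 + 2*y^3) / (4*(y+3))" .
  have "T 3 = 2 * (x + 3) * (x + 3 - 5/2) / (3 * (2 * x + 1)) * T 2"
    unfolding T_def numeral_3_eq_3 numeral_2_eq_2 One_nat_def by (simp add: algebra_simps)
  also have "\<dots> = (360 + 462*y + 193*y^2 + 33*y^3 + 2*y^4) / (12*(y+3))"
    unfolding T2 y(2) using ne by (simp add: divide_simps) (simp add: algebra_simps eval_nat_numeral)
  finally have T3: "T 3 = (360 + 462*y + 193*y^2 + 33*y^3 + 2*y^4) / (12*(y+3))" .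
  have "T (Suc 3) = 2 * (x + 4) * (x + 4 - 5/2) / (4 * (2 * x + 2)) * T 3"
    unfolding T_def top_moment.simps(2) by simp
  also have "\<dots> = (5670 + 7929*y + 3894*y^2 + 887*y^3 + 96*y^4 + 4*y^5) / (96*(y+3))"
    unfolding T3 y(2) using ne y(1) by (simp add: divide_simps) (simp add: algebra_simps eval_nat_numeral)
  finally have T4: "T 4 = (5670 + 7929*y + 3894*y^2 + 887*y^3 + 96*y^4 + 4*y^5) / (96*(y+3))" by simp
  have f1: "f 1 = (-3 - 7*y - 2*y^2) / (2*y+3)"
    using ne unfolding f_def y(2) One_nat_def top_coeff.simps by (simp add: field_simps power2_eq_square)
  have "f 2 = - (2 * (x - 1) * (x - 1 - 5/2) * f 1 / (2 * (2 * x - 1 - 3)))"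
    unfolding f_def numeral_2_eq_2 One_nat_def by simp
  also have "\<dots> = (-6 - 5*y + 23*y^2 + 20*y^3 + 4*y^4) / (4*(y+1)*(2*y+3))"
    unfolding f1 y(2) using ne by (simp add: divide_simps) (simp add: algebra_simps eval_nat_numeral)
  finally have f2: "f 2 = (-6 - 5*y + 23*y^2 + 20*y^3 + 4*y^4) / (4*(y+1)*(2*y+3))" .
  have "f 3 = - (2 * (x - 2) * (x - 2 - 5/2) * f 2 / (3 * (2 * x - 2 - 3)))"
    unfolding f_def numeral_3_eq_3 numeral_2_eq_2 One_nat_def by (simp add: algebra_simps)
  also have "\<dots> = (-18 + 33*y + 13*y^2 - 12*y^3 - 4*y^4) / (12*(2*y+3))"
    unfolding f2 y(2) using ne by (simp add: divide_simps) (simp add: algebra_simps eval_nat_numeral)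
  finally have f3: "f 3 = (-18 + 33*y + 13*y^2 - 12*y^3 - 4*y^4) / (12*(2*y+3))" .
  have f4': "f (Suc 3) = - (2 * (x - 3) * (x - 3 - 5/2) * f 3 / (4 * (2 * x - 3 - 3)))"
    unfolding f_def top_coeff.simps(2) by simp
  have f4: "f 4 \<ge> (-90 + 201*y - y^2 - 86*y^3 + 4*y^4 + 8*y^5) / (96*(2*y+3))"
  proof (cases "y = 0")
    case True
    then show ?thesis using f4' by (simp add: y(2))
  next
    case False
    then have "y > 0" using y by simp
    note f4'
    also have "- (2 * (x - 3) * (x - 3 - 5/2) * f 3 / (4 * (2 * x - 3 - 3))) = (-90 + 201*y - y^2 - 86*y^3 + 4*y^4 + 8*y^5) / (96*(2*y+3))"
      unfolding f3 y(2) using ne \<open>y > 0\<close> by (simp add: divide_simps) (simp add: algebra_simps eval_nat_numeral)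
    finally show ?thesis by simp
  qed
  have c0: "c0 = (801 + 1764*y + 1401*y^2 + 480*y^3 + 60*y^4) / (2*(y+1)*(y+3)*(2*y+3)*(2*y+5))"
    unfolding c0_def T1 T2 f1 f2 y(2) using ne by (simp add: divide_simps) (simp add: algebra_simps eval_nat_numeral)
  have c1: "c1 = (168 + 236*y + 108*y^2 + 16*y^3) / ((2*y+3)*(2*y+5))"
    unfolding c1_def T1 f1 y(2) using ne by (simp add: divide_simps) (simp add: algebra_simps eval_nat_numeral)
  have c2: "c2 = 6 + 5*y + y^2" unfolding c2_def y(2) by (simp add: algebra_simps power2_eq_square)
  have d0: "d0 = (297 + 612*y + 473*y^2 + 160*y^3 + 20*y^4) / (2*(y+1)*(y+3)*(2*y+3)*(2*y+5))"
    unfolding d0_def T1 T2 T3 f1 f2 f3 y(2) using ne by (simp add: divide_simps) (simp add: algebra_simps eval_nat_numeral)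
  have d1: "d1 = (291 + 424*y + 204*y^2 + 32*y^3) / (2*(2*y+3)*(2*y+5))"
    unfolding d1_def T1 T2 f1 f2 y(2) using ne by (simp add: divide_simps) (simp add: algebra_simps eval_nat_numeral)
  have d2: "d2 = (186 + 395*y + 303*y^2 + 100*y^3 + 12*y^4) / ((2*y+3)*(2*y+5))"
    unfolding d2_def T1 f1 y(2) using ne by (simp add: divide_simps) (simp add: algebra_simps eval_nat_numeral)
  have d3: "d3 = 6 + 11*y + 6*y^2 + y^3" unfolding d3_def y(2) by (simp add: algebra_simps eval_nat_numeral)
  have g1: "g1 = (282 + 416*y + 202*y^2 + 32*y^3) / ((2*y+3)*(2*y+5))"
    unfolding g1_def T1 T2 T3 f1 f2 f3 y(2) using ne by (simp add: divide_simps) (simp add: algebra_simps eval_nat_numeral)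
  have g2: "g2 = (756 + 1716*y + 1389*y^2 + 480*y^3 + 60*y^4) / (2*(2*y+3)*(2*y+5))"
    unfolding g2_def T1 T2 f1 f2 y(2) using ne by (simp add: divide_simps) (simp add: algebra_simps eval_nat_numeral)
  have g3: "g3 = (216 + 708*y + 884*y^2 + 524*y^3 + 148*y^4 + 16*y^5) / ((2*y+3)*(2*y+5))"
    unfolding g3_def T1 f1 y(2) using ne by (simp add: divide_simps) (simp add: algebra_simps eval_nat_numeral)
  have B: "B = (36 + 52*y + 16*y^2) / ((2*y+3)*(2*y+5))"
    unfolding B_def y(2) using ne by (simp add: divide_simps) (simp add: algebra_simps eval_nat_numeral)
  have \<delta>: "\<delta> = (y+1) / (y+3)" unfolding \<delta>_def y(2) by simp
  have "g0 \<ge> T 4 + f 1 * T 3 + f 2 * T 2 + f 3 * T 1 + (-90 + 201*y - y^2 - 86*y^3 + 4*y^4 + 8*y^5) / (96*(2*y+3))"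
    using f4 unfolding g0_def by simp
  also have "T 4 + f 1 * T 3 + f 2 * T 2 + f 3 * T 1 + (-90 + 201*y - y^2 - 86*y^3 + 4*y^4 + 8*y^5) / (96*(2*y+3))
      = (2043 + 4260*y + 3305*y^2 + 1120*y^3 + 140*y^4) / (8*(y+1)*(y+3)*(2*y+3)*(2*y+5))"
    unfolding T1 T2 T3 T4 f1 f2 f3 using ne by (simp add: divide_simps) (simp add: algebra_simps eval_nat_numeral)
  finally have g0: "g0 \<ge> (2043 + 4260*y + 3305*y^2 + 1120*y^3 + 140*y^4) / (8*(y+1)*(y+3)*(2*y+3)*(2*y+5))" .
  show "c0 > 0" unfolding c0 using y by (intro divide_pos_pos mult_pos_pos; simp add: add_pos_nonneg add_nonneg_pos)
  show "c1 > 0" unfolding c1 using y by (intro divide_pos_pos mult_pos_pos; simp add: add_pos_nonneg add_nonneg_pos)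
  show "c2 > 0" unfolding c2 using y by (simp add: add_pos_nonneg)
  show "d0 > 0" unfolding d0 using y by (intro divide_pos_pos mult_pos_pos; simp add: add_pos_nonneg add_nonneg_pos)
  show "d1 > 0" unfolding d1 using y by (intro divide_pos_pos mult_pos_pos; simp add: add_pos_nonneg add_nonneg_pos)
  show "d3 > 0" unfolding d3 using y by (simp add: add_pos_nonneg)
  show "\<delta> > 0" unfolding \<delta> using y by simp
  have "d1 * c0 - c1 * d0 = (133299 + 507132*y + 807087*y^2 + 700480*y^3 + 359240*y^4 + 109056*y^5 + 18160*y^6 + 1280*y^7)
      / (4*(y+1)*(y+3)*(2*y+3)*(2*y+3)*(2*y+5)*(2*y+5))"
    unfolding c0 c1 d0 d1 using ne by (simp add: divide_simps) (simp add: algebra_simps eval_nat_numeral)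
  also have "\<dots> \<ge> 0" using y by simp
  finally show "c1 * d0 \<le> d1 * c0" by simp
  have "c1 * d2 - d1 * c2 = (36306 + 132591*y + 202931*y^2 + 169192*y^3 + 83144*y^4 + 24112*y^5 + 3824*y^6 + 256*y^7)
      / (2*(2*y+3)*(2*y+3)*(2*y+5)*(2*y+5))"
    unfolding c1 c2 d1 d2 using ne by (simp add: divide_simps) (simp add: algebra_simps eval_nat_numeral)
  also have "\<dots> \<ge> 0" using y by simp
  finally show "d1 * c2 \<le> c1 * d2" by simp
  have "B - 9/4 = (9 + 64*y + 28*y^2) / (4*(2*y+3)*(2*y+5))"
    unfolding B using ne by (simp add: divide_simps) (simp add: algebra_simps eval_nat_numeral)
  also have "\<dots> \<ge> 0" using y by simp
  finally show "B \<ge> 9/4" by simp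
  have "\<delta> * c0 - (B * d0 - (2043 + 4260*y + 3305*y^2 + 1120*y^3 + 140*y^4) / (8*(y+1)*(y+3)*(2*y+3)*(2*y+5)))
    = (11691 + 33093*y + 48033*y^2 + 46335*y^3 + 29976*y^4 + 12024*y^5 + 2640*y^6 + 240*y^7)
      / (8*(y+1)*(y+3)*(y+3)*(2*y+3)*(2*y+3)*(2*y+5)*(2*y+5))"
    unfolding B \<delta> c0 d0 using ne by (simp add: divide_simps) (simp add: algebra_simps eval_nat_numeral)
  also have "\<dots> \<ge> 0" using y by simp
  finally show "B * d0 - g0 \<le> \<delta> * c0" using g0 by linarith
  have "B * d1 - g1 - \<delta> * c1 = (168 + 1810*y + 2990*y^2 + 1976*y^3 + 584*y^4 + 64*y^5) / ((2*y+3)*(2*y+3)*(2*y+5)*(2*y+5))"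
    unfolding B \<delta> c1 d1 g1 using ne by (simp add: divide_simps) (simp add: algebra_simps eval_nat_numeral)
  also have "\<dots> \<ge> 0" using y by simp
  finally show "\<delta> * c1 \<le> B * d1 - g1" by simp
  have "B * d2 - g2 - \<delta> * c2 = (1152 + 6678*y + 12699*y^2 + 11336*y^3 + 5240*y^4 + 1216*y^5 + 112*y^6)
      / (2*(2*y+3)*(2*y+3)*(2*y+5)*(2*y+5))"
    unfolding B \<delta> c2 d2 g2 using ne by (simp add: divide_simps) (simp add: algebra_simps eval_nat_numeral)
  also have "\<dots> \<ge> 0" using y by simp
  finally show "\<delta> * c2 \<le> B * d2 - g2" by simp
  show "g3 = B * d3"
    unfolding B g3 d3 using ne by (simp add: divide_simps) (simp add: algebra_simps eval_nat_numeral)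
qed

section \<open>Endpoint values of the resolvent are Hurwitz in the reciprocal parameter\<close>

lemma map_poly_pCons_real: "map_poly complex_of_real [:a, b:] = [:of_real a, of_real b:]"
  by (simp add: map_poly_pCons)

text \<open>
  A zero at \<open>1\<close> for some \<open>z\<close> in the closed right half plane contradicts the energy identity with
  both weight exponents equal to \<open>a\<close>. The multiplier \<open>1\<close> serves the sector where \<open>z\<^sup>2\<close> has nonnegative real part,
  the multiplier \<open>2 - x\<close> the complementary sector. In each case the computed moment has the wrong
  sign.
\<close>

lemma hurwitz_resolvent_nonneg:
  assumes a: "a = 0 \<or> a = 1/2" and N: "N \<ge> 3" and z: "z \<noteq> 0" "Re z \<ge> 0"
  shows "poly (resolvent (1 / z) (jacobi N a (a - 2))) 1 \<noteq> 0"
proof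
  define F p where "F = jacobi N a (a - 2)" and "p = resolvent (1 / z) F"
  define x where "x = real N"
  define T f where "T = top_moment a (a - 2) x" and "f = top_coeff a (a - 2) x"
  assume root: "poly (resolvent (1 / z) (jacobi N a (a - 2))) 1 = 0"
  have ne: "real N + real i + a + (a - 2) + 1 \<noteq> 0" for i using a N by auto
  have ode: "jacobi_ode (real N) a (a - 2) F" unfolding F_def by (rule jacobi_jacobi_ode[OF ne])
  have real: "map_poly cnj F = F" by (simp add: F_def map_poly_cnj_jacobi)
  have dF: "degree F = N" by (simp add: F_def degree_jacobi)
  have a1: "a > -1" "a \<ge> 0" and b1: "a - 2 + real 2 > -1" and ab: "2 * real N + a + (a - 2) + 2 > 0" and j: "2 \<le> N"
    using a N by auto
  have c: "a - 2 + real 2 = a" by simp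
  obtain q where q: "p = [:1, -1:] * q" "q \<noteq> 0" "degree q < N" "smult z p - pderiv p = smult z F"
    "\<And>k. tcoeff (-1) q k = 2 * tcoeff (-1) q (Suc k) - tcoeff (-1) p (Suc k)"
    using resolvent_root_factor[of F N a "a - 2" z] root N z unfolding p_def F_def by auto
  have "map_poly cnj (F * [:1, 1:] ^ (N - 2)) = F * [:1, 1:] ^ (N - 2)"
    by (simp add: map_poly_cnj_mult map_poly_cnj_power real map_poly_pCons)
  then obtain h where h: "jint a (a - 2 + real 2) (F * [:1, 1:] ^ (N - 2)) = of_real h"
    using jint_real[OF a1(1) b1] by metis
  note top = jacobi_jint_top[OF ode a1(1) b1 j ab, of _ 0, unfolded h x_def[symmetric] T_def[symmetric], simplified c]
  define P where "P r = tcoeff (-1) p (N - r)" for r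
  have P0: "P 0 = 1" and Pr: "\<And>r. r < N \<Longrightarrow> P (Suc r) = of_real (f (Suc r)) + 1 / z * of_real (x - r) * P r"
    using tcoeff_resolvent_top(1)[of F N a "a - 2" "1 / z"] tcoeff_resolvent_top(2)[of F N a "a - 2" _ "1 / z"] ne unfolding P_def p_def F_def f_def x_def by auto
  have P1: "P 1 = of_real (f 1) + 1 / z * of_real x" using Pr[of 0] N P0 by simp
  have P2: "P 2 = of_real (f 2) + 1 / z * of_real (x - 1) * P 1" using Pr[of 1] N by (simp add: numeral_2_eq_2)
  have S: "tcoeff (-1) q N = 0" "tcoeff (-1) q (N - 1) = -1" "tcoeff (-1) q (N - 2) = - 2 - P 1"
  proof -
    show 0: "tcoeff (-1) q N = 0" using q(3) by (rule tcoeff_eq_0)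
    show 1: "tcoeff (-1) q (N - 1) = -1" using q(5)[of "N - 1"] N P0 0 by (simp add: P_def)
    have "Suc (N - 2) = N - 1" using N by simp
    then show "tcoeff (-1) q (N - 2) = - 2 - P 1" using q(5)[of "N - 2"] 1 by (simp add: P_def)
  qed
  have T0: "T 0 = 1" by (simp add: T_def)
  have Jq: "jint a a (F * q) = of_real h * (of_real (- (2 + T 1 + f 1)) + of_real (- x) * (1 / z))"
  proof -
    have "jint a a (F * q) = of_real h * (tcoeff (-1) q N * of_real (T 2) + tcoeff (-1) q (N - 1) * of_real (T 1) + tcoeff (-1) q (N - 2))"
      using top[of q] q(3) T0 by (simp add: eval_nat_numeral)
    then show ?thesis unfolding S P1 by (simp add: algebra_simps)
  qed
  have dp: "degree p \<le> N" using degree_resolvent_le[of "1 / z" F] dF by (simp add: p_def)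
  have Jp: "jint a a (F * p) = of_real h * (of_real (T 2 + f 1 * T 1 + f 2) + of_real (x * T 1 + (x - 1) * f 1) * (1 / z)
      + of_real (x * (x - 1)) * (1 / z) ^ 2)"
  proof -
    have "jint a a (F * p) = of_real h * (P 0 * of_real (T 2) + P 1 * of_real (T 1) + P 2)"
      using top[of p] dp T0 by (simp add: eval_nat_numeral P_def)
    then show ?thesis unfolding P2 P1 P0 by (simp add: algebra_simps power2_eq_square)
  qed
  have JF: "jint a a (F * F) = of_real (h * (T 2 + f 1 * T 1 + f 2))"
  proof -
    have "tcoeff (-1) F (N - r) = of_real (f r)" if "r \<le> N" for r
      using tcoeff_jacobi_top[OF that ne] by (simp add: F_def f_def x_def)
    then show ?thesis using top[of F] dF N T0 by (simp add: numeral_2_eq_2 algebra_simps f_def)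
  qed
  note ineq = sector_ineq_nonneg[OF a, of x, folded T_def f_def]
  have x3: "x \<ge> 3" using N by (simp add: x_def)
  have "h * (T 2 + f 1 * T 1 + f 2) > 0"
    by (rule jint_norm_pos[OF a1(1) a1(1) real _ JF]) (simp add: F_def jacobi_nonzero)
  then have hpos: "h > 0" using ineq(2)[OF x3] by (simp add: zero_less_mult_iff)
  define s where "s = 1 / (cmod z)\<^sup>2"
  have spos: "s > 0" using z by (simp add: s_def)
  define X Y where "X = (Re z)\<^sup>2" and "Y = (Im z)\<^sup>2"
  have XY: "X \<ge> 0" "Y \<ge> 0" by (simp_all add: X_def Y_def)
  \<comment> \<open>X - Y is the real part of the square of z\<close>
  show False
  proof (cases "X \<ge> Y")
    case True
    have "Re (z * cnj (jint a a (F * (map_poly of_real 1 * q)))) > 0"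
    proof (rule energy_pos[OF a1(1,2) real q(1) q(4) q(2)])
      fix y :: real assume y: "y \<in> {-1<..<1}"
      have "(1 - a) * (1 + y) + a * (1 - y) > 0"
        using a
      proof
        assume "a = 1/2"
        then have "(1 - a) * (1 + y) + a * (1 - y) = 1" by (simp add: algebra_simps)
        then show ?thesis by simp
      qed (use y in simp)
      moreover have "1 - y\<^sup>2 \<ge> 0" using y by (simp add: abs_square_le_1 abs_le_iff)
      ultimately show "0 < poly 1 y * ((1 - a) * (1 + y) + a * (1 - y)) + poly (pderiv 1) y * (1 - y\<^sup>2) + 2 * Re z * (1 - y\<^sup>2) * poly 1 y"
        using z(2) by (simp add: pderiv_1 add_pos_nonneg)
    qed simp
    also have "map_poly complex_of_real 1 * q = q" by simp
    also have "Re (z * cnj (jint a a (F * q))) = h * (- (2 + T 1 + f 1) * Re z - x * s * (X - Y))"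
      using Re_mult_cnj_inverse_poly[OF z(1), of h "- (2 + T 1 + f 1)" "- x" 0 0 0] Jq
      by (simp add: s_def Re_powers X_def Y_def)
    finally have "- (2 + T 1 + f 1) * Re z - x * s * (X - Y) > 0" using hpos by (simp add: zero_less_mult_iff)
    moreover have "(2 + T 1 + f 1) * Re z \<ge> 0" using ineq(1)[OF x3] z(2) by simp
    moreover have "x * s * (X - Y) \<ge> 0" using x3 spos True by simp
    ultimately show False by linarith
  next
    case False
    have M: "map_poly complex_of_real [:2, -1:] * q = q + p"
      unfolding map_poly_pCons_real q(1) poly_eq_poly_eq_iff[symmetric] by (rule ext) (simp add: algebra_simps del: mult_pCons_left)
    have "Re (z * cnj (jint a a (F * (map_poly of_real [:2, -1:] * q)))) > 0"
    proof (rule energy_pos[OF a1(1,2) real q(1) q(4) q(2)])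
      fix y :: real assume y: "y \<in> {-1<..<1}"
      have y2: "1 - y\<^sup>2 \<ge> 0" using y by (simp add: abs_square_le_1 abs_le_iff)
      have pM: "poly [:2, -1:] y = 2 - y" "poly (pderiv [:2, -1:]) y = -1" by (simp_all add: pderiv_pCons)
      have "(2 - y) * ((1 - a) * (1 + y) + a * (1 - y)) + -1 * (1 - y\<^sup>2) > 0"
        using a
      proof
        assume "a = 0"
        then have "(2 - y) * ((1 - a) * (1 + y) + a * (1 - y)) + -1 * (1 - y\<^sup>2) = 1 + y" by (simp add: algebra_simps power2_eq_square)
        then show ?thesis using y by simp
      next
        assume "a = 1/2"
        then have "(2 - y) * ((1 - a) * (1 + y) + a * (1 - y)) + -1 * (1 - y\<^sup>2) = (1 - y) + y\<^sup>2"
            by (simp only:) (simp add: field_simps power2_eq_square)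
        then show ?thesis using y zero_le_power2[of y] by (simp only: greaterThanLessThan_iff) linarith
      qed
      moreover have "2 * Re z * (1 - y\<^sup>2) * (2 - y) \<ge> 0" using y2 y z(2) by simp
      ultimately show "0 < poly [:2, -1:] y * ((1 - a) * (1 + y) + a * (1 - y)) + poly (pderiv [:2, -1:]) y * (1 - y\<^sup>2) + 2 * Re z * (1 - y\<^sup>2) * poly [:2, -1:] y"
        unfolding pM by (rule add_pos_nonneg)
    qed simp
    also have "jint a a (F * (map_poly complex_of_real [:2, -1:] * q)) = jint a a (F * q) + jint a a (F * p)"
      unfolding M using a1 by (simp add: distrib_left jint_add)
    also have "\<dots> = of_real h * (of_real ((T 2 + f 1 * T 1 + f 2) - (2 + T 1 + f 1)) + of_real (x * T 1 + (x - 1) * f 1 - x) * (1 / z)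
      + of_real (x * (x - 1)) * (1 / z) ^ 2)"
      unfolding Jq Jp by (simp add: algebra_simps)
    also have "Re (z * cnj \<dots>) = h * (((T 2 + f 1 * T 1 + f 2) - (2 + T 1 + f 1)) * Re z + (x * T 1 + (x - 1) * f 1 - x) * s * (X - Y)
       + x * (x - 1) * s\<^sup>2 * (Re z * (X - 3 * Y)))"
      using Re_mult_cnj_inverse_poly[OF z(1), of h "(T 2 + f 1 * T 1 + f 2) - (2 + T 1 + f 1)" "x * T 1 + (x - 1) * f 1 - x" "x * (x - 1)" 0 0]
      by (simp add: s_def Re_powers X_def Y_def)
    finally have "((T 2 + f 1 * T 1 + f 2) - (2 + T 1 + f 1)) * Re z + (x * T 1 + (x - 1) * f 1 - x) * s * (X - Y)
       + x * (x - 1) * s\<^sup>2 * (Re z * (X - 3 * Y)) > 0" using hpos by (simp add: zero_less_mult_iff)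
    moreover have "((T 2 + f 1 * T 1 + f 2) - (2 + T 1 + f 1)) * Re z \<le> 0"
      using ineq(3)[OF x3] z(2) by (intro mult_nonpos_nonneg) auto
    moreover have "(x * T 1 + (x - 1) * f 1 - x) * s * (X - Y) \<le> 0"
      using ineq(4)[OF x3] spos False by (intro mult_nonneg_nonpos mult_nonneg_nonneg) auto
    moreover have "x * (x - 1) * s\<^sup>2 * (Re z * (X - 3 * Y)) \<le> 0"
      using x3 z(2) False XY by (intro mult_nonneg_nonpos mult_nonneg_nonneg) auto
    ultimately show False by linarith
  qed
qed

text \<open>
  Here the weight exponent at \<open>-1\<close> must be raised by three, which brings in one more power of
  \<open>1 / z\<close>. With \<open>X\<close> and \<open>Y\<close> the squares of the real and imaginary part of \<open>z\<close>, three multipliers cover the half plane: the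
  constant \<open>1\<close> for \<open>X \<ge> 3 * Y\<close>, a linear one for \<open>Y / 3 \<le> X \<le> 3 * Y\<close> and a quadratic one near
  the imaginary axis.
\<close>

lemma hurwitz_resolvent_minus_half:
  assumes N: "N \<ge> 3" and z: "z \<noteq> 0" "Re z \<ge> 0"
  shows "poly (resolvent (1 / z) (jacobi N (-1/2) (-5/2))) 1 \<noteq> 0"
proof
  define a c :: real where "a = -1/2" and "c = 1/2"
  define F p where "F = jacobi N (-1/2) (-5/2)" and "p = resolvent (1 / z) F"
  define x where "x = real N"
  define T f where "T = top_moment (-1/2) (-5/2) x" and "f = top_coeff (-1/2) (-5/2) x"
  assume root: "poly (resolvent (1 / z) (jacobi N (-1/2) (-5/2))) 1 = 0"
  have ne: "real N + real i + (-1/2) + (-5/2) + 1 \<noteq> 0" for i using N by auto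
  have ode: "jacobi_ode (real N) a (-5/2) F" unfolding F_def a_def by (rule jacobi_jacobi_ode[OF ne])
  have real: "map_poly cnj F = F" by (simp add: F_def map_poly_cnj_jacobi)
  have dF: "degree F = N" by (simp add: F_def degree_jacobi)
  have a1: "a > -1" and c0: "c \<ge> 0" "c > -1" and b1: "-5/2 + real 3 > -1" and ab: "2 * real N + a + (-5/2) + 2 > 0"
    using N by (auto simp: a_def c_def)
  have c: "-5/2 + real 3 = c" by (simp add: c_def)
  obtain q where q: "p = [:1, -1:] * q" "q \<noteq> 0" "degree q < N" "smult z p - pderiv p = smult z F"
    "\<And>k. tcoeff (-1) q k = 2 * tcoeff (-1) q (Suc k) - tcoeff (-1) p (Suc k)"
    using resolvent_root_factor[of F N "-1/2" "-5/2" z] root N z unfolding p_def F_def by auto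
  have "map_poly cnj (F * [:1, 1:] ^ (N - 3)) = F * [:1, 1:] ^ (N - 3)"
    by (simp add: map_poly_cnj_mult map_poly_cnj_power real map_poly_pCons)
  then obtain h where h: "jint a (-5/2 + real 3) (F * [:1, 1:] ^ (N - 3)) = of_real h"
    using jint_real[OF a1 b1] by metis
  have top: "jint a c (F * t) = of_real h * (\<Sum>r\<le>3 + m. tcoeff (-1) t (N + m - r) * of_real (T (3 + m - r)))"
    if "degree t \<le> N + m" for t m
    using jacobi_jint_top[OF ode a1 b1 N ab that, unfolded h] unfolding c T_def x_def a_def by simp
  define P where "P r = tcoeff (-1) p (N - r)" for r
  have P0: "P 0 = 1" and Pr: "\<And>r. r < N \<Longrightarrow> P (Suc r) = of_real (f (Suc r)) + 1 / z * of_real (x - r) * P r"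
    using tcoeff_resolvent_top(1)[of F N "-1/2" "-5/2" "1 / z"] tcoeff_resolvent_top(2)[of F N "-1/2" "-5/2" _ "1 / z"] ne unfolding P_def p_def F_def f_def x_def by auto
  have P1: "P 1 = of_real (f 1) + 1 / z * of_real x" using Pr[of 0] N P0 by simp
  have P2: "P 2 = of_real (f 2) + 1 / z * of_real (x - 1) * P 1" using Pr[of 1] N by (simp add: numeral_2_eq_2)
  have P3: "P 3 = of_real (f 3) + 1 / z * of_real (x - 2) * P 2" using Pr[of 2] N by (simp add: numeral_3_eq_3 numeral_2_eq_2)
  have dp: "degree p \<le> N" using degree_resolvent_le[of "1 / z" F] dF by (simp add: p_def)
  let ?u = "[:1, 1:] :: complex poly"
  \<comment> \<open>for N = 3 the coefficient below the constant one is absent, in accordance with the factor x - 3\<close>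
  have P4: "tcoeff (-1) (?u * p) (N - 3) = of_real (f 4) + 1 / z * of_real (x - 3) * P 3"
  proof (cases "N = 3")
    case True
    have "f (Suc 3) = 0" unfolding f_def top_coeff.simps(2) using True by (simp add: x_def)
    then show ?thesis using True tcoeff_mult_linear(1)[of "-1" 1 1 p] by (simp add: x_def)
  next
    case False
    with N have N4: "N - 3 = Suc (N - 4)" "N > 3" by auto
    have "tcoeff (-1) (?u * p) (N - 3) = P 4"
      unfolding N4(1) tcoeff_mult_linear(2) by (simp add: P_def)
    then show ?thesis using Pr[of 3] N4 by (simp add: eval_nat_numeral)
  qed
  have S: "tcoeff (-1) q N = 0" "tcoeff (-1) q (N - 1) = -1" "tcoeff (-1) q (N - 2) = - 2 - P 1"
    "tcoeff (-1) q (N - 3) = - 4 - 2 * P 1 - P 2"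
  proof -
    show 0: "tcoeff (-1) q N = 0" using q(3) by (rule tcoeff_eq_0)
    show 1: "tcoeff (-1) q (N - 1) = -1" using q(5)[of "N - 1"] N P0 0 by (simp add: P_def)
    have "Suc (N - 2) = N - 1" using N by simp
    then show 2: "tcoeff (-1) q (N - 2) = - 2 - P 1" using q(5)[of "N - 2"] 1 by (simp add: P_def)
    have "Suc (N - 3) = N - 2" using N by simp
    then show "tcoeff (-1) q (N - 3) = - 4 - 2 * P 1 - P 2" using q(5)[of "N - 3"] 2 by (simp add: P_def)
  qed
  define c0' c1 c2 d0 d1 d2 d3 g0 g1 g2 g3 g4 where
    "c0' = T 2 + (2 + f 1) * T 1 + 4 + 2 * f 1 + f 2"
    and "c1 = x * T 1 + 2 * x + (x - 1) * f 1" and "c2 = x * (x - 1)"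
    and "d0 = T 3 + f 1 * T 2 + f 2 * T 1 + f 3"
    and "d1 = x * T 2 + (x - 1) * f 1 * T 1 + (x - 2) * f 2"
    and "d2 = x * (x - 1) * T 1 + (x - 2) * (x - 1) * f 1"
    and "d3 = x * (x - 1) * (x - 2)"
    and "g0 = T 4 + f 1 * T 3 + f 2 * T 2 + f 3 * T 1 + f 4"
    and "g1 = x * T 3 + (x - 1) * f 1 * T 2 + (x - 2) * f 2 * T 1 + (x - 3) * f 3"
    and "g2 = x * (x - 1) * T 2 + (x - 2) * (x - 1) * f 1 * T 1 + (x - 3) * (x - 2) * f 2"
    and "g3 = x * (x - 1) * (x - 2) * T 1 + (x - 3) * (x - 2) * (x - 1) * f 1"
    and "g4 = x * (x - 1) * (x - 2) * (x - 3)"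
  define \<delta> B where "\<delta> = (x - 2) / x" and "B = 4 * (4 * x - 3) * (x - 2) / ((2 * x - 3) * (2 * x - 1))"
  have x3: "x \<ge> 3" "x = 3 \<or> x \<ge> 4" using N by (auto simp: x_def)
  note ineq = sector_ineq_minus_half[OF x3, folded T_def f_def, folded c0'_def c1_def c2_def d0_def d1_def d2_def d3_def g0_def g1_def g2_def g3_def \<delta>_def B_def]
  define \<nu> where "\<nu> = 1 / z"
  have T0: "T 0 = 1" by (simp add: T_def)
  note P = P0 P1[folded \<nu>_def] P2[folded \<nu>_def] P3[folded \<nu>_def]
  have Jq: "jint a c (F * q) = of_real h * (- of_real c0' - of_real c1 * \<nu> - of_real c2 * \<nu> ^ 2)"
  proof -
    have "jint a c (F * q) = of_real h * (tcoeff (-1) q N * of_real (T 3) + tcoeff (-1) q (N - 1) * of_real (T 2)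
       + tcoeff (-1) q (N - 2) * of_real (T 1) + tcoeff (-1) q (N - 3))"
      using top[of q 0] q(3) T0 by (simp add: eval_nat_numeral)
    then show ?thesis unfolding S P c0'_def c1_def c2_def by (simp add: algebra_simps power2_eq_square)
  qed
  have Jp: "jint a c (F * p) = of_real h * (of_real d0 + of_real d1 * \<nu> + of_real d2 * \<nu> ^ 2 + of_real d3 * \<nu> ^ 3)"
  proof -
    have "jint a c (F * p) = of_real h * (P 0 * of_real (T 3) + P 1 * of_real (T 2) + P 2 * of_real (T 1) + P 3)"
      using top[of p 0] dp T0 by (simp add: eval_nat_numeral P_def)
    then show ?thesis unfolding P d0_def d1_def d2_def d3_def by (simp add: algebra_simps power2_eq_square power3_eq_cube)
  qed
  have Ju: "jint a c (F * (?u * p)) = of_real h * (of_real g0 + of_real g1 * \<nu> + of_real g2 * \<nu> ^ 2 + of_real g3 * \<nu> ^ 3 + of_real g4 * \<nu> ^ 4)"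
  proof -
    have du: "degree (?u * p) \<le> N + 1"
      using degree_mult_le[of ?u p] dp by simp
    have up: "tcoeff (-1) (?u * p) (Suc k) = tcoeff (-1) p k" for k
      unfolding tcoeff_mult_linear by simp
    have "tcoeff (-1) (?u * p) (N + 1) = P 0" "tcoeff (-1) (?u * p) N = P 1" "tcoeff (-1) (?u * p) (N - 1) = P 2" "tcoeff (-1) (?u * p) (N - 2) = P 3"
      using up[of N] up[of "N - 1"] up[of "N - 2"] up[of "N - 3"] N
      by (simp_all add: P_def Suc_diff_Suc numeral_2_eq_2 numeral_3_eq_3)
    then have "jint a c (F * (?u * p)) = of_real h * (P 0 * of_real (T 4) + P 1 * of_real (T 3) + P 2 * of_real (T 2) + P 3 * of_real (T 1)
        + tcoeff (-1) (?u * p) (N - 3))"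
      using top[OF du] T0 by (simp add: eval_nat_numeral)
    then show ?thesis unfolding P4 \<nu>_def[symmetric] P g0_def g1_def g2_def g3_def g4_def by (simp add: algebra_simps eval_nat_numeral)
  qed
  have JF: "jint a c (F * F) = of_real (h * d0)"
  proof -
    have "tcoeff (-1) F (N - r) = of_real (f r)" if "r \<le> N" for r
      using tcoeff_jacobi_top[OF that ne] by (simp add: F_def f_def x_def)
    then show ?thesis using top[of F 0] dF N T0 unfolding d0_def by (simp add: eval_nat_numeral algebra_simps f_def)
  qed
  have "h * d0 > 0"
    by (rule jint_norm_pos[OF a1 c0(2) real _ JF]) (simp add: F_def jacobi_nonzero)
  then have hpos: "h > 0" using ineq(4) by (simp add: zero_less_mult_iff)
  define s where "s = 1 / (cmod z)\<^sup>2"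
  have spos: "s > 0" using z by (simp add: s_def)
  define X Y where "X = (Re z)\<^sup>2" and "Y = (Im z)\<^sup>2"
  have XY: "X \<ge> 0" "Y \<ge> 0" by (simp_all add: X_def Y_def)
  have val: "Re (z * cnj (of_real h * (of_real e0 + of_real e1 * \<nu> + of_real e2 * \<nu> ^ 2 + of_real e3 * \<nu> ^ 3 + of_real e4 * \<nu> ^ 4)))
    = h * (e0 * Re z + e1 * s * (X - Y) + e2 * s\<^sup>2 * (Re z * (X - 3 * Y)) + e3 * s ^ 3 * (X\<^sup>2 - 6 * X * Y + Y\<^sup>2)
        + e4 * s ^ 4 * (Re z * (X\<^sup>2 - 10 * X * Y + 5 * Y\<^sup>2)))" for e0 e1 e2 e3 e4
    unfolding \<nu>_def using Re_mult_cnj_inverse_poly[OF z(1), of h e0 e1 e2 e3 e4] by (simp only: s_def Re_powers X_def Y_def)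
  have nonpos: False if "Re (z * cnj (of_real h * (of_real e0 + of_real e1 * \<nu> + of_real e2 * \<nu> ^ 2 + of_real e3 * \<nu> ^ 3 + of_real e4 * \<nu> ^ 4))) > 0"
    "e0 \<le> 0" "e1 * (X - Y) \<le> 0" "e2 * (X - 3 * Y) \<le> 0" "e3 * (X\<^sup>2 - 6 * X * Y + Y\<^sup>2) \<le> 0"
    "e4 * (X\<^sup>2 - 10 * X * Y + 5 * Y\<^sup>2) \<le> 0" for e0 e1 e2 e3 e4
  proof -
    have "e0 * Re z \<le> 0" "s * (e1 * (X - Y)) \<le> 0" "s\<^sup>2 * Re z * (e2 * (X - 3 * Y)) \<le> 0"
      "s ^ 3 * (e3 * (X\<^sup>2 - 6 * X * Y + Y\<^sup>2)) \<le> 0" "s ^ 4 * Re z * (e4 * (X\<^sup>2 - 10 * X * Y + 5 * Y\<^sup>2)) \<le> 0"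
      using mult_nonpos_nonneg[OF that(2) z(2)] mult_nonneg_nonpos[OF _ that(3), of s]
        mult_nonneg_nonpos[OF _ that(4), of "s\<^sup>2 * Re z"] mult_nonneg_nonpos[OF _ that(5), of "s ^ 3"]
        mult_nonneg_nonpos[OF _ that(6), of "s ^ 4 * Re z"] spos z(2) by simp_all
    then have "e0 * Re z + e1 * s * (X - Y) + e2 * s\<^sup>2 * (Re z * (X - 3 * Y)) + e3 * s ^ 3 * (X\<^sup>2 - 6 * X * Y + Y\<^sup>2)
        + e4 * s ^ 4 * (Re z * (X\<^sup>2 - 10 * X * Y + 5 * Y\<^sup>2)) \<le> 0"
      by (simp add: mult_ac)
    then show False using that(1) hpos unfolding val by (simp add: zero_less_mult_iff)
  qed
  have num: "(1 - a) * (1 + y) + c * (1 - y) = 2 + y" for y by (simp add: a_def c_def field_simps)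
  note energy = energy_pos[OF a1 c0(1) real q(1) q(4) q(2)]
  consider "X \<ge> 3 * Y" | "X \<le> 3 * Y" "3 * X \<ge> Y" | "3 * X \<le> Y" by linarith
  then show False
  proof cases
    case 1
    have "Re (z * cnj (jint a c (F * (map_poly of_real 1 * q)))) > 0"
    proof (rule energy)
      fix y :: real assume y: "y \<in> {-1<..<1}"
      then have "1 - y\<^sup>2 \<ge> 0" by (simp add: abs_square_le_1 abs_le_iff)
      then show "0 < poly 1 y * ((1 - a) * (1 + y) + c * (1 - y)) + poly (pderiv 1) y * (1 - y\<^sup>2) + 2 * Re z * (1 - y\<^sup>2) * poly 1 y"
        unfolding num using z(2) y by (simp add: pderiv_1 add_pos_nonneg)
    qed simp
    also have "map_poly complex_of_real 1 * q = q" by simp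
    finally show False
      using nonpos[of "- c0'" "- c1" "- c2" 0 0] ineq(1-3) 1 XY unfolding Jq by simp
  next
    case 2
    \<comment> \<open>the multiplier d1 + c1 * (1 - x) cancels the term linear in the inverse of z\<close>
    have M: "map_poly complex_of_real [:d1 + c1, - c1:] * q = smult (of_real d1) q + smult (of_real c1) p"
      unfolding map_poly_pCons_real q(1) poly_eq_poly_eq_iff[symmetric] by (rule ext) (simp add: algebra_simps del: mult_pCons_left)
    have "Re (z * cnj (jint a c (F * (map_poly of_real [:d1 + c1, - c1:] * q)))) > 0"
    proof (rule energy)
      show "0 \<le> poly [:d1 + c1, - c1:] (-1)" using ineq(2,5) by simp
      fix y :: real assume y: "y \<in> {-1<..<1}"
      then have y2: "1 - y\<^sup>2 \<ge> 0" by (simp add: abs_square_le_1 abs_le_iff)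
      have "poly [:d1 + c1, - c1:] y * (2 + y) + poly (pderiv [:d1 + c1, - c1:]) y * (1 - y\<^sup>2) = d1 * (2 + y) + c1 * (1 - y)"
        by (simp add: pderiv_pCons algebra_simps power2_eq_square)
      moreover have "d1 * (2 + y) > 0" "c1 * (1 - y) > 0" using ineq(2,5) y by auto
      moreover have "poly [:d1 + c1, - c1:] y = d1 + c1 * (1 - y)" by (simp add: algebra_simps)
      then have "2 * Re z * (1 - y\<^sup>2) * poly [:d1 + c1, - c1:] y \<ge> 0" using \<open>c1 * (1 - y) > 0\<close> ineq(5) z(2) y2 by simp
      ultimately show "0 < poly [:d1 + c1, - c1:] y * ((1 - a) * (1 + y) + c * (1 - y)) + poly (pderiv [:d1 + c1, - c1:]) y * (1 - y\<^sup>2)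
          + 2 * Re z * (1 - y\<^sup>2) * poly [:d1 + c1, - c1:] y"
        unfolding num by linarith
    qed
    also have "jint a c (F * (map_poly complex_of_real [:d1 + c1, - c1:] * q)) = of_real d1 * jint a c (F * q) + of_real c1 * jint a c (F * p)"
      unfolding M using a1 c0 by (simp add: distrib_left jint_add jint_smult)
    also have "\<dots> = of_real h * (of_real (c1 * d0 - d1 * c0') + of_real 0 * \<nu> + of_real (c1 * d2 - d1 * c2) * \<nu> ^ 2 + of_real (c1 * d3) * \<nu> ^ 3 + of_real 0 * \<nu> ^ 4)"
      unfolding Jq Jp by (simp add: algebra_simps)
    finally show False
    proof (rule nonpos)
      show "c1 * d0 - d1 * c0' \<le> 0" using ineq(7) by simp
      show "(c1 * d2 - d1 * c2) * (X - 3 * Y) \<le> 0" using ineq(8) 2 by (intro mult_nonneg_nonpos) auto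
      have "3 * (X\<^sup>2 - 6 * X * Y + Y\<^sup>2) = - ((3 * Y - X) * (3 * X - Y)) - 8 * (X * Y)"
        by (simp add: algebra_simps power2_eq_square)
      also have "\<dots> \<le> 0"
        using mult_nonneg_nonneg[of "3 * Y - X" "3 * X - Y"] mult_nonneg_nonneg[OF XY] 2 by linarith
      finally show "c1 * d3 * (X\<^sup>2 - 6 * X * Y + Y\<^sup>2) \<le> 0" using ineq(2,6) by (intro mult_nonneg_nonpos) auto
    qed simp_all
  next
    case 3
    \<comment> \<open>the quadratic multiplier \<delta> + (1 - x) * (B - 1 - x) gives the combination of q, p and (1 + x) p below\<close>
    let ?M = "[:\<delta> + B - 1, - B, 1:] :: real poly"
    have M: "map_poly complex_of_real ?M * q = smult (of_real \<delta>) q + smult (of_real B) p - ?u * p"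
      unfolding q(1) poly_eq_poly_eq_iff[symmetric] by (rule ext) (simp add: map_poly_pCons algebra_simps del: mult_pCons_left)
    have "Re (z * cnj (jint a c (F * (map_poly of_real ?M * q)))) > 0"
    proof (rule energy)
      show "0 \<le> poly ?M (-1)" using ineq(9,10) by simp
      fix y :: real assume y: "y \<in> {-1<..<1}"
      then have y2: "1 - y\<^sup>2 \<ge> 0" by (simp add: abs_square_le_1 abs_le_iff)
      have "poly ?M y * (2 + y) + poly (pderiv ?M) y * (1 - y\<^sup>2) = \<delta> * (2 + y) + (1 - y) * ((y - 1/2)\<^sup>2 + (B - 9/4))"
        by (simp add: pderiv_pCons algebra_simps power2_eq_square)
      moreover have "\<delta> * (2 + y) > 0" "(1 - y) * ((y - 1/2)\<^sup>2 + (B - 9/4)) \<ge> 0" using ineq(9,10) y by auto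
      moreover have eq: "poly ?M y = \<delta> + (1 - y) * (B - 1 - y)" by (simp add: algebra_simps)
      have M0: "poly ?M y \<ge> 0"
        unfolding eq using ineq(9,10) y by (intro add_nonneg_nonneg mult_nonneg_nonneg) auto
      have "2 * Re z * (1 - y\<^sup>2) * poly ?M y \<ge> 0"
        by (rule mult_nonneg_nonneg[OF mult_nonneg_nonneg[OF _ y2] M0]) (use z(2) in simp)
      ultimately show "0 < poly ?M y * ((1 - a) * (1 + y) + c * (1 - y)) + poly (pderiv ?M) y * (1 - y\<^sup>2)
          + 2 * Re z * (1 - y\<^sup>2) * poly ?M y"
        unfolding num by linarith
    qed
    also have "jint a c (F * (map_poly complex_of_real ?M * q)) = of_real \<delta> * jint a c (F * q) + of_real B * jint a c (F * p) - jint a c (F * (?u * p))"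
      unfolding M using a1 c0 by (simp only: distrib_left right_diff_distrib jint_add jint_diff jint_smult mult_smult_right)
    also have "\<dots> = of_real h * (of_real (B * d0 - g0 - \<delta> * c0') + of_real (B * d1 - g1 - \<delta> * c1) * \<nu> + of_real (B * d2 - g2 - \<delta> * c2) * \<nu> ^ 2 + of_real 0 * \<nu> ^ 3 + of_real (- g4) * \<nu> ^ 4)"
      unfolding Jq Jp Ju ineq(14) by (simp add: algebra_simps)
    finally show False
    proof (rule nonpos)
      show "B * d0 - g0 - \<delta> * c0' \<le> 0" using ineq(11) by simp
      show "(B * d1 - g1 - \<delta> * c1) * (X - Y) \<le> 0" using ineq(12) 3 XY by (intro mult_nonneg_nonpos) auto
      show "(B * d2 - g2 - \<delta> * c2) * (X - 3 * Y) \<le> 0" using ineq(13) 3 XY by (intro mult_nonneg_nonpos) auto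
      \<comment> \<open>positivity for 3 * X \<le> Y, that is, within 30 degrees of the imaginary axis\<close>
      have "9 * (X\<^sup>2 - 10 * X * Y + 5 * Y\<^sup>2) = (Y - 3 * X) * (29 * Y - 3 * X) + 16 * Y\<^sup>2"
        by (simp add: algebra_simps power2_eq_square)
      also have "\<dots> \<ge> 0" using 3 XY by (intro add_nonneg_nonneg mult_nonneg_nonneg) auto
      finally show "- g4 * (X\<^sup>2 - 10 * X * Y + 5 * Y\<^sup>2) \<le> 0" using x3 unfolding g4_def by (intro mult_nonpos_nonneg) auto
    qed simp
  qed
qed

text \<open>
  The multiplier \<open>1\<close> with weight exponents \<open>1\<close> and \<open>0\<close> gives the moment \<open>- h\<close>, hence a
  contradiction for \<open>Re z > 0\<close>. On the imaginary axis the identity degenerates and yields a second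
  zero, at \<open>-1\<close>. Then \<open>p = (1 - x\<^sup>2) r\<close>, and testing with the conjugate of \<open>r\<close>, to which \<open>F\<close> is
  orthogonal, shows that the integral of \<open>(1 - x)\<^sup>2\<close> times the squared modulus of \<open>r\<close> vanishes.
\<close>

lemma hurwitz_resolvent_one:
  assumes N: "N \<ge> 2" and z: "z \<noteq> 0" "Re z \<ge> 0"
  shows "poly (resolvent (1 / z) (jacobi N 1 (-1))) 1 \<noteq> 0"
proof
  define F p where "F = jacobi N 1 (-1)" and "p = resolvent (1 / z) F"
  define x where "x = real N"
  define T f where "T = top_moment 1 (-1) x" and "f = top_coeff 1 (-1) x"
  assume root: "poly (resolvent (1 / z) (jacobi N 1 (-1))) 1 = 0"
  have ne: "real N + real i + 1 + (-1) + 1 \<noteq> 0" for i by simp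
  have ode: "jacobi_ode (real N) 1 (-1) F" unfolding F_def by (rule jacobi_jacobi_ode[OF ne])
  have real: "map_poly cnj F = F" by (simp add: F_def map_poly_cnj_jacobi)
  have dF: "degree F = N" by (simp add: F_def degree_jacobi)
  have x2: "x \<ge> 2" using N by (simp add: x_def)
  have c: "-1 + real 1 = 0" by simp
  have b1: "-1 + real 1 > -1" and ab: "2 * real N + 1 + (-1) + 2 > 0" and j: "1 \<le> N" using N by auto
  obtain q where q: "p = [:1, -1:] * q" "q \<noteq> 0" "degree q < N" "smult z p - pderiv p = smult z F"
    "\<And>k. tcoeff (-1) q k = 2 * tcoeff (-1) q (Suc k) - tcoeff (-1) p (Suc k)"
    using resolvent_root_factor[of F N 1 "-1" z] root N z unfolding p_def F_def by auto
  have "map_poly cnj (F * [:1, 1:] ^ (N - 1)) = F * [:1, 1:] ^ (N - 1)"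
    by (simp add: map_poly_cnj_mult map_poly_cnj_power real map_poly_pCons)
  then obtain h where h: "jint 1 (-1 + real 1) (F * [:1, 1:] ^ (N - 1)) = of_real h"
    using jint_real[OF _ b1, of 1] by fastforce
  have top: "jint 1 0 (F * t) = of_real h * (\<Sum>r\<le>1. tcoeff (-1) t (N - r) * of_real (T (1 - r)))"
    if "degree t \<le> N" for t
    using jacobi_jint_top[OF ode _ b1 j ab, of t 0, unfolded h] that unfolding c T_def x_def by simp
  have T0: "T 0 = 1" "f 0 = 1" by (simp_all add: T_def f_def)
  have T1: "T 1 = x" "f 1 = - (x - 1)"
    using x2 by (simp_all add: T_def f_def field_simps)
  have S: "tcoeff (-1) q N = 0" "tcoeff (-1) q (N - 1) = -1"
  proof -
    show 0: "tcoeff (-1) q N = 0" using q(3) by (rule tcoeff_eq_0)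
    have "tcoeff (-1) p N = 1"
      unfolding p_def using tcoeff_resolvent_top(1)[of F N 1 "-1" "1 / z"] ne F_def by auto
    then show 1: "tcoeff (-1) q (N - 1) = -1" using q(5)[of "N - 1"] N 0 by simp
  qed
  have Jq: "jint 1 0 (F * q) = - of_real h"
    using top[of q] q(3) S T0 by simp
  have "jint 1 0 (F * F) = of_real h"
  proof -
    have "tcoeff (-1) F (N - r) = of_real (f r)" if "r \<le> N" for r
      using tcoeff_jacobi_top[OF that ne] by (simp add: F_def f_def x_def)
    from this[of 0] this[of 1] have "jint 1 0 (F * F) = of_real h * (of_real (T 1) + of_real (f 1))"
      using top[of F] dF N T0 by simp
    also have "\<dots> = of_real h * of_real (T 1 + f 1)" by (simp only: of_real_add)
    also have "T 1 + f 1 = 1" using T1 by simp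
    finally show ?thesis by simp
  qed
  then have hpos: "h > 0"
    by (rule jint_norm_pos[OF _ _ real, rotated 3]) (simp_all add: F_def jacobi_nonzero)
  show False
  proof (cases "Re z > 0")
    case True
    have "Re (z * cnj (jint 1 0 (F * (map_poly of_real 1 * q)))) > 0"
    proof (rule energy_pos[OF _ _ real q(1) q(4) q(2)])
      fix y :: real assume y: "y \<in> {-1<..<1}"
      then have "1 - y\<^sup>2 > 0" by (simp add: abs_square_less_1 abs_less_iff)
      then show "0 < poly 1 y * ((1 - 1) * (1 + y) + 0 * (1 - y)) + poly (pderiv 1) y * (1 - y\<^sup>2) + 2 * Re z * (1 - y\<^sup>2) * poly 1 y"
        using True by (simp add: pderiv_1)
    qed simp_all
    then show False using Jq hpos True by (simp add: mult_less_0_iff)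
  next
    case False
    with z have Rez: "Re z = 0" by simp
    \<comment> \<open>on the imaginary axis the energy identity only leaves its boundary term at -1\<close>
    have "((\<lambda>y::real. 0) has_integral Re (z * cnj (jint 1 0 (F * (map_poly of_real (1 :: real poly) * q))))
       - 2 powr (1 + 1) * poly 1 (-1) * (cmod (poly q (-1)))\<^sup>2 / 2) {-1..1}"
      using energy_identity[OF _ _ real q(1) q(4), of 1 0 1] Rez by (simp add: pderiv_1)
    then have "Re (z * cnj (jint 1 0 (F * (map_poly of_real (1 :: real poly) * q))))
       - 2 powr (1 + 1) * poly 1 (-1) * (cmod (poly q (-1)))\<^sup>2 / 2 = 0"
      using has_integral_unique has_integral_0 by metis
    then have "poly q (-1) = 0" using Jq Rez by simp
    then obtain r where r: "q = [:1, 1:] * r" by (auto simp: poly_eq_0_iff_dvd elim: dvdE)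
    have r0: "r \<noteq> 0" using q(2) r by auto
    have "degree q = 1 + degree r" unfolding r using r0 by (subst degree_mult_eq) auto
    then have dr: "degree r + 1 < N" using q(3) by simp
    let ?J = "jint 1 0" and ?r = "map_poly cnj r"
    have lin: "?J (f + g) = ?J f + ?J g" "?J (f - g) = ?J f - ?J g" "?J (smult k f) = k * ?J f" for f g k
      by (simp_all add: jint_add jint_diff jint_smult)
    have "degree ?r = degree r" by (rule degree_map_poly) simp
    then have "jint 1 (-1 + real 1) (F * ?r) = 0"
      using jacobi_orthogonal[OF ode _ b1, of ?r] dr by simp
    then have 0: "?J (smult z F * ?r) = 0" by (simp add: lin)
    define S where "S = r * ?r"
    have p: "p = [:1, 0, -1:] * r" by (simp add: q(1) r algebra_simps)
    have "(smult z p - pderiv p) * ?r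
      = smult z ([:1, 0, -1:] * S) + smult 2 ([:0, 1:] * S) - [:1, 0, -1:] * (pderiv r * ?r)"
      unfolding p S_def pderiv_mult poly_eq_poly_eq_iff[symmetric]
      by (rule ext) (simp add: pderiv_pCons algebra_simps del: mult_pCons_left mult_pCons_right)
    then have 1: "z * ?J ([:1, 0, -1:] * S) + 2 * ?J ([:0, 1:] * S) - ?J ([:1, 0, -1:] * (pderiv r * ?r)) = 0"
      using 0 unfolding q(4) by (simp only: lin)
    have Sc: "map_poly cnj S = S" by (simp add: S_def map_poly_cnj_mult mult.commute map_poly_map_poly o_def)
    have cnj2: "map_poly cnj [:a, b, c:] = [:cnj a, cnj b, cnj c:]" for a b c by (simp add: map_poly_pCons)
    have J1: "cnj (?J ([:1, 0, -1:] * S)) = ?J ([:1, 0, -1:] * S)" "cnj (?J ([:0, 1:] * S)) = ?J ([:0, 1:] * S)"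
      "cnj (?J ([:1, 0, -1:] * (pderiv r * ?r))) = ?J ([:1, 0, -1:] * (r * pderiv ?r))"
      by (simp_all only: jint_cnj[symmetric] map_poly_cnj_mult Sc map_poly_pCons,
          simp_all add: map_poly_pCons map_poly_cnj_mult Sc pderiv_map_poly_cnj map_poly_map_poly o_def mult.commute)
    have "cnj z = - z" using Rez by (simp add: complex_eq_iff)
    then have 2: "- z * ?J ([:1, 0, -1:] * S) + 2 * ?J ([:0, 1:] * S) - ?J ([:1, 0, -1:] * (r * pderiv ?r)) = 0"
      using arg_cong[OF 1, of cnj] by (simp only: complex_cnj_add complex_cnj_diff complex_cnj_mult J1 complex_cnj_numeral complex_cnj_zero)
    have "pderiv S = pderiv r * ?r + r * pderiv ?r" by (simp add: S_def pderiv_mult algebra_simps)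
    then have "?J ([:1, 0, -1:] * pderiv S) = ?J ([:1, 0, -1:] * (pderiv r * ?r)) + ?J ([:1, 0, -1:] * (r * pderiv ?r))"
      by (simp only: distrib_left lin)
    also have "\<dots> = 4 * ?J ([:0, 1:] * S)"
      unfolding 1[unfolded right_minus_eq, symmetric] 2[unfolded right_minus_eq, symmetric] by simp
    finally have 3: "?J ([:1, 0, -1:] * pderiv S) = 4 * ?J ([:0, 1:] * S)" .
    have "?J ([:1, 0, -1:] * pderiv S + [:of_real (0 - 1), - of_real (1 + 0 + 2):] * S) = 0"
      by (rule jint_by_parts) simp_all
    then have "4 * ?J ([:0, 1:] * S) + ?J ([:of_real (0 - 1), - of_real (1 + 0 + 2):] * S) = 0"
      unfolding lin 3 .
    also have "[:of_real (0 - 1), - of_real (1 + 0 + 2):] * S = smult (-3) ([:0, 1:] * S) - S" by (simp add: algebra_simps)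
    finally have 4: "?J ([:0, 1:] * S) = ?J S" unfolding lin by simp
    have "[:1, -1:] = 1 - ([:0, 1:] :: complex poly)" by (simp add: one_pCons)
    then have 5: "?J ([:1, -1:] * S) = 0" by (simp only: left_diff_distrib mult_1_left lin 4) simp
    let ?K = "\<lambda>y. jweight 1 0 y * ((1 - y) * (cmod (poly r (of_real y)))\<^sup>2)"
    have eq: "Re (of_real (jweight 1 0 y) * poly ([:1, -1:] * S) (of_real y)) = ?K y" for y
      unfolding cmod_power2 by (simp add: S_def poly_map_poly_cnj algebra_simps power2_eq_square)
    have K: "(?K has_integral 0) {-1..1}"
      using has_integral_Re[OF jint_has_integral[of 1 0 "[:1, -1:] * S"]] unfolding eq 5 by simp
    have "?K y = 0" if "y \<in> {-1<..<1}" for y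
    proof (rule has_integral_nonneg_eq_0[OF K _ _ _ that])
      show "continuous_on {-1<..<1} ?K" by (intro continuous_intros continuous_on_jweight_open)
    qed (simp_all add: jweight_nonneg)
    then have "poly r (of_real y) = 0" if "y \<in> {-1<..<1}" for y
      using that jweight_pos[OF that, of 1 0] by fastforce
    then show False using r0 poly_of_real_eq_0_imp by blast
  qed
qed

section \<open>Hermite--Biehler and operators that preserve simple negative roots\<close>

lemma log_deriv_eq:
  fixes p :: "complex poly"
  assumes p: "poly p z \<noteq> 0"
  shows "poly (pderiv p) z / poly p z = (\<Sum>a | poly p a = 0. of_nat (order a p) / (z - a))"
proof -
  let ?R = "{a. poly p a = 0}"
  have p0: "p \<noteq> 0" using p by auto
  have fin: "finite ?R" using poly_roots_finite[OF p0] .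
  have za: "z - a \<noteq> 0" if "a \<in> ?R" for a using that p by auto
  have dec: "smult (lead_coeff p) (\<Prod>a\<in>?R. [:- a, 1:] ^ order a p) = p"
    by (rule complex_poly_decompose)
  have pz: "poly p z = lead_coeff p * (\<Prod>a\<in>?R. (z - a) ^ order a p)"
    using arg_cong[OF dec, of "\<lambda>q. poly q z"] by (simp add: poly_prod)
  have "((\<lambda>w. lead_coeff p * (\<Prod>a\<in>?R. (w - a) ^ order a p)) has_field_derivative
      lead_coeff p * ((\<Prod>a\<in>?R. (z - a) ^ order a p) * (\<Sum>a\<in>?R. (of_nat (order a p) * (z - a) ^ (order a p - 1)) / (z - a) ^ order a p))) (at z)"
    using za by (intro DERIV_cmult has_field_derivative_prod') (auto intro!: derivative_eq_intros)
  also have "(\<lambda>w. lead_coeff p * (\<Prod>a\<in>?R. (w - a) ^ order a p)) = poly p"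
  proof
    fix w
    have "poly p w = poly (smult (lead_coeff p) (\<Prod>a\<in>?R. [:- a, 1:] ^ order a p)) w" by (simp only: dec)
    then show "lead_coeff p * (\<Prod>a\<in>?R. (w - a) ^ order a p) = poly p w" by (simp add: poly_prod)
  qed
  finally have "poly (pderiv p) z = poly p z * (\<Sum>a\<in>?R. (of_nat (order a p) * (z - a) ^ (order a p - 1)) / (z - a) ^ order a p)"
    unfolding pz mult.assoc by (rule DERIV_unique[OF poly_DERIV])
  also have "(\<Sum>a\<in>?R. (of_nat (order a p) * (z - a) ^ (order a p - 1)) / (z - a) ^ order a p)
      = (\<Sum>a\<in>?R. of_nat (order a p) / (z - a))"
  proof (rule sum.cong)
    fix a assume a: "a \<in> ?R"
    then have "order a p \<noteq> 0" using p0 by (simp add: order_root)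
    then obtain k where "order a p = Suc k" by (metis not0_implies_Suc)
    then show "(of_nat (order a p) * (z - a) ^ (order a p - 1)) / (z - a) ^ order a p = of_nat (order a p) / (z - a)"
      using za[OF a] by simp
  qed simp
  finally show ?thesis using p by simp
qed

definition simple_negative_roots :: "complex poly \<Rightarrow> bool" where
  "simple_negative_roots p \<longleftrightarrow> p \<noteq> 0 \<and>
     (\<forall>z. poly p z = 0 \<longrightarrow> z \<in> \<real> \<and> Re z < 0 \<and> poly (pderiv p) z \<noteq> 0)"

text \<open>
  Each root is nearer to the reflection of \<open>z\<close> in the imaginary axis than to \<open>z\<close>, and by reality the
  value at that reflection has the same modulus as the value at \<open>- z\<close>.
\<close>

lemma norm_reflect_less:
  assumes hurwitz: "\<And>r. poly p r = 0 \<Longrightarrow> Re r < 0" and real: "map_poly cnj p = p"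
    and z: "Re z > 0" and deg: "degree p > 0"
  shows "cmod (poly p (- z)) < cmod (poly p z)"
proof -
  let ?R = "{a. poly p a = 0}"
  have p0: "p \<noteq> 0" using deg by auto
  have fin: "finite ?R" using poly_roots_finite[OF p0] .
  have pw: "cmod (poly p w) = cmod (lead_coeff p) * (\<Prod>a\<in>?R. cmod (w - a) ^ order a p)" for w
    using arg_cong[OF complex_poly_decompose[of p], of "\<lambda>q. cmod (poly q w)"]
    by (simp add: poly_prod norm_mult norm_power flip: prod_norm)
  have "cnj (poly p (- z)) = poly p (- cnj z)"
    using poly_map_poly_cnj[of p "- cnj z"] real by simp
  then have "cmod (poly p (- z)) = cmod (poly p (- cnj z))" by (metis complex_mod_cnj)
  also have "\<dots> < cmod (poly p z)"
  proof -
    have less: "cmod (- cnj z - a) < cmod (z - a)" if "a \<in> ?R" for a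
    proof -
      have "Re a < 0" using that hurwitz by auto
      then have "Re z * Re a < 0" using z by (simp add: mult_pos_neg)
      then have "(cmod (- cnj z - a))\<^sup>2 < (cmod (z - a))\<^sup>2"
        unfolding cmod_power2 by (simp add: power2_eq_square algebra_simps)
      then show ?thesis by (rule power2_less_imp_less) simp
    qed
    have "(\<Prod>a\<in>?R. cmod (- cnj z - a) ^ order a p) < (\<Prod>a\<in>?R. cmod (z - a) ^ order a p)"
    proof -
      obtain r where r: "r \<in> ?R" using deg fundamental_theorem_of_algebra[of p] by (auto simp: constant_degree)
      have pos: "order a p > 0" if "a \<in> ?R" for a using p0 that by (simp add: order_root)
      show ?thesis
      proof (rule prod_mono_strict[OF r _ fin])
        show "cmod (- cnj z - r) ^ order r p < cmod (z - r) ^ order r p"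
          using less[OF r] pos[OF r] by (intro power_strict_mono) auto
        show "0 \<le> cmod (- cnj z - a) ^ order a p \<and> cmod (- cnj z - a) ^ order a p \<le> cmod (z - a) ^ order a p" if "a \<in> ?R" for a
          using less[OF that] by (auto intro!: power_mono)
        show "0 < cmod (z - a) ^ order a p" if "a \<in> ?R" for a
          using less[OF that] norm_ge_zero[of "- cnj z - a"] by (intro zero_less_power) linarith
      qed
    qed
    then show ?thesis unfolding pw using p0 by simp
  qed
  finally show ?thesis .
qed

lemma Re_log_deriv_pos:
  assumes hurwitz: "\<And>r. poly p r = 0 \<Longrightarrow> Re r < 0" and z: "Re z \<ge> 0" and deg: "degree p > 0"
  shows "Re (poly (pderiv p) z / poly p z) > 0"
proof -
  have p0: "p \<noteq> 0" using deg by auto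
  have pz: "poly p z \<noteq> 0" using hurwitz z by fastforce
  obtain r where r: "poly p r = 0" using deg fundamental_theorem_of_algebra[of p] by (auto simp: constant_degree)
  have "Re (of_nat (order a p) / (z - a)) > 0" if "poly p a = 0" for a
  proof -
    have "Re (z - a) > 0" using hurwitz[OF that] z by simp
    moreover have "order a p > 0" using that p0 by (simp add: order_root)
    moreover have "(cmod (z - a))\<^sup>2 > 0" using that pz by auto
    ultimately show ?thesis by (simp add: Re_divide cmod_power2)
  qed
  then show ?thesis
    unfolding log_deriv_eq[OF pz] Re_sum using r p0
    by (intro sum_pos) (auto simp: poly_roots_finite)
qed

text \<open>
  At a root \<open>w\<^sup>2\<close> of the even part the values \<open>p w\<close> and \<open>p (- w)\<close> are opposite, so that \<open>w\<close> lies on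
  the imaginary axis. If the root were multiple, the logarithmic derivative of \<open>p\<close> at \<open>w\<close> would be purely
  imaginary, although each of its partial fractions has positive real part.
\<close>

lemma hermite_biehler_even_part:
  fixes p e :: "complex poly"
  assumes hurwitz: "\<And>r. poly p r = 0 \<Longrightarrow> Re r < 0" and real: "map_poly cnj p = p"
    and even: "\<And>w. poly p w + poly p (- w) = 2 * poly e (w\<^sup>2)"
  shows "simple_negative_roots e"
proof -
  have e0: "poly e 0 \<noteq> 0" using even[of 0] hurwitz[of 0] by auto
  have "z \<in> \<real> \<and> Re z < 0 \<and> poly (pderiv e) z \<noteq> 0" if z: "poly e z = 0" for z
  proof -
    define w where "w = csqrt z"
    have w: "w\<^sup>2 = z" "Re w \<ge> 0" unfolding w_def using csqrt_principal[of z] by (auto simp del: csqrt.sel)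
    have pw: "poly p (- w) = - poly p w" using even[of w] z w by (simp add: add_eq_0_iff)
    have deg: "degree p > 0"
    proof (rule ccontr)
      assume "\<not> degree p > 0"
      then obtain c where c: "p = [:c:]" by (metis degree_eq_zeroE gr0I)
      then have "c \<noteq> 0" using hurwitz[of 0] by auto
      then show False using pw c by simp
    qed
    have "\<not> Re w > 0"
      using norm_reflect_less[OF hurwitz real _ deg, of w] pw by auto
    with w have Rew: "Re w = 0" by simp
    have "z = - of_real ((Im w)\<^sup>2)"
      using Rew by (simp add: w(1)[symmetric] complex_eq_iff power2_eq_square)
    moreover have "z \<noteq> 0" using e0 z by auto
    ultimately have 1: "z \<in> \<real>" "Re z < 0" by (auto simp: complex_eq_iff complex_is_Real_iff)
    have cw: "cnj w = - w" using Rew by (simp add: complex_eq_iff)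
    have nz: "poly p w \<noteq> 0" using hurwitz Rew by fastforce
    have "poly (pderiv e) z \<noteq> 0"
    proof
      assume e': "poly (pderiv e) z = 0"
      have "((\<lambda>w. poly p w + poly p (- w)) has_field_derivative poly (pderiv p) w - poly (pderiv p) (- w)) (at w)"
        by (auto intro!: derivative_eq_intros)
      moreover have "((\<lambda>w. 2 * poly e (w\<^sup>2)) has_field_derivative 0) (at w)"
        using e' w by (auto intro!: derivative_eq_intros)
      ultimately have "poly (pderiv p) w - poly (pderiv p) (- w) = 0"
        unfolding even by (rule DERIV_unique)
      then have pd: "poly (pderiv p) (- w) = poly (pderiv p) w" by simp
      have r1: "cnj (poly p w) = poly p (- w)"
        using poly_map_poly_cnj[of p "cnj w"] real cw by simp
      have "map_poly cnj (pderiv p) = pderiv p"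
        using real by (metis pderiv_map_poly_cnj)
      then have r2: "cnj (poly (pderiv p) w) = poly (pderiv p) (- w)"
        using poly_map_poly_cnj[of "pderiv p" "cnj w"] cw by simp
      have "cnj (poly (pderiv p) w / poly p w) = - (poly (pderiv p) w / poly p w)"
        by (simp add: r1 r2 pd pw)
      then have "Re (cnj (poly (pderiv p) w / poly p w)) = Re (- (poly (pderiv p) w / poly p w))" by (rule arg_cong)
      then have "Re (poly (pderiv p) w / poly p w) = 0" by (simp only: cnj.sel uminus_complex.sel)
      then show False using Re_log_deriv_pos[OF hurwitz w(2) deg] by simp
    qed
    with 1 show ?thesis by simp
  qed
  moreover have "e \<noteq> 0" using e0 by auto
  ultimately show ?thesis unfolding simple_negative_roots_def by blast
qed

text \<open>
  The operator \<open>s + z d/dz\<close>; it multiplies the coefficients by a linear function of the index.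
\<close>

definition theta :: "real \<Rightarrow> complex poly \<Rightarrow> complex poly" where
  "theta s p = smult (of_real s) p + [:0, 1:] * pderiv p"

lemma poly_theta: "poly (theta s p) z = of_real s * poly p z + z * poly (pderiv p) z"
proof -
  show ?thesis unfolding theta_def poly_add poly_smult poly_mult by simp
qed

lemma coeff_theta: "coeff (theta s p) k = of_real (s + real k) * coeff p k"
proof -
  have *: "[:0, 1:] * pderiv p = pCons 0 (pderiv p)" by simp
  show ?thesis
  proof (cases k)
    case 0
    show ?thesis unfolding theta_def * 0 by simp
  next
    case (Suc m)
    show ?thesis unfolding theta_def * Suc coeff_add coeff_smult coeff_pCons_Suc coeff_pderiv
      by (simp add: distrib_right del: of_nat_Suc)
  qed
qed

lemma sum_order_roots:
  fixes p :: "complex poly"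
  assumes "p \<noteq> 0"
  shows "(\<Sum>a | poly p a = 0. order a p) = degree p"
proof -
  let ?P = "\<Prod>a | poly p a = 0. [:- a, 1:] ^ order a p"
  have 1: "degree p = degree (smult (lead_coeff p) ?P)"
    by (rule arg_cong[OF complex_poly_decompose[of p], of degree, symmetric])
  have 2: "degree (smult (lead_coeff p) ?P) = degree ?P"
    using assms by (subst degree_smult_eq) simp
  have 3: "degree ?P = (\<Sum>a | poly p a = 0. degree ([:- a, 1:] ^ order a p))"
    by (rule degree_prod_eq_sum_degree) simp
  have 4: "\<dots> = (\<Sum>a | poly p a = 0. order a p)"
    by (simp only: degree_linear_power)
  show ?thesis using 1 2 3 4 by (simp only:)
qed

text \<open>
  Away from the roots of \<open>p\<close> one has \<open>theta s p / p = s + (\<Sum>a. z / (z - a))\<close> with negative \<open>a\<close>.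
  This function has nonreal values off the real axis and positive derivative on it. For \<open>z \<ge> 0\<close> the
  sum lies in \<open>[0, degree p)\<close>, which excludes nonnegative roots under either condition on \<open>s\<close>.
\<close>

lemma simple_negative_roots_theta:
  assumes p: "simple_negative_roots p" and s: "s > 0 \<or> (s < 0 \<and> real (degree p) \<le> - s)"
  shows "simple_negative_roots (theta s p)"
proof -
  let ?R = "{a. poly p a = 0}"
  let ?g = "\<lambda>z. \<Sum>a\<in>?R. of_nat (order a p) * (z / (z - a))"
  have p0: "p \<noteq> 0" and neg: "\<And>a. a \<in> ?R \<Longrightarrow> a \<in> \<real> \<and> Re a < 0"
    and simple: "\<And>a. a \<in> ?R \<Longrightarrow> poly (pderiv p) a \<noteq> 0"
    using p by (auto simp: simple_negative_roots_def)
  have fin: "finite ?R" using poly_roots_finite[OF p0] .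
  have ord: "order a p > 0" if "a \<in> ?R" for a using that p0 by (simp add: order_root)
  have p00: "poly p 0 \<noteq> 0" using neg[of 0] by auto
  have g: "poly (theta s p) z = poly p z * (of_real s + ?g z)" if "poly p z \<noteq> 0" for z
  proof -
    have "z * (poly (pderiv p) z / poly p z) = ?g z"
      unfolding log_deriv_eq[OF that] sum_distrib_left by (intro sum.cong) simp_all
    then show ?thesis using that unfolding poly_theta by (simp add: field_simps)
  qed
  have "poly (theta s p) 0 \<noteq> 0" using p00 s by (auto simp: poly_theta)
  then have nz: "theta s p \<noteq> 0" by auto
  have "z \<in> \<real> \<and> Re z < 0 \<and> poly (pderiv (theta s p)) z \<noteq> 0" if root: "poly (theta s p) z = 0" for z
  proof -
    have pz: "poly p z \<noteq> 0"
    proof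
      assume *: "poly p z = 0"
      then have "z * poly (pderiv p) z = 0" using root by (simp add: poly_theta)
      then show False using simple[of z] neg[of z] * by auto
    qed
    then have sg: "of_real s + ?g z = 0" using root g by auto
    have R: "?R \<noteq> {}"
    proof
      assume "?R = {}"
      then have "?g z = 0" by (simp only: sum.empty)
      then show False using sg s by auto
    qed
    have za: "z - a \<noteq> 0" if "a \<in> ?R" for a using that pz by auto
    have term_eq: "z / (z - a) = 1 + of_real (Re a) / (z - a)" if "a \<in> ?R" for a
    proof -
      have "of_real (Re a) = a" using neg[OF that] by (simp add: complex_is_Real_iff complex_eq_iff)
      then show ?thesis using za[OF that] by (simp add: field_simps)
    qed
    have Im_term: "Im (of_nat (order a p) * (z / (z - a))) = Im z * (real (order a p) * - Re a / (cmod (z - a))\<^sup>2)" if "a \<in> ?R" for a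
    proof -
      have "Im (z - a) = Im z" using neg[OF that] by (simp add: complex_is_Real_iff)
      then show ?thesis unfolding term_eq[OF that] by (simp add: Im_divide cmod_power2)
    qed
    have "0 = Im (?g z)" using arg_cong[OF sg, of Im] by simp
    also have "Im (?g z) = Im z * (\<Sum>a\<in>?R. real (order a p) * - Re a / (cmod (z - a))\<^sup>2)"
      unfolding Im_sum sum_distrib_left by (intro sum.cong Im_term) auto
    finally have "Im z * (\<Sum>a\<in>?R. real (order a p) * - Re a / (cmod (z - a))\<^sup>2) = 0" by simp
    moreover have pos: "(\<Sum>a\<in>?R. real (order a p) * - Re a / (cmod (z - a))\<^sup>2) > 0"
      using fin R ord neg za by (intro sum_pos divide_pos_pos mult_pos_pos) auto
    ultimately have Imz: "Im z = 0" by simp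
    then have zr: "z = of_real (Re z)" by (simp add: complex_eq_iff)
    have ar: "a = of_real (Re a)" if "a \<in> ?R" for a
      using neg[OF that] by (simp add: complex_is_Real_iff complex_eq_iff)
    have "Re z < 0"
    proof (rule ccontr)
      assume "\<not> Re z < 0"
      then have zn: "Re z \<ge> 0" by simp
      have Re_term: "Re (of_nat (order a p) * (z / (z - a))) = real (order a p) * (Re z / (Re z - Re a))" if "a \<in> ?R" for a
      proof -
        have "z / (z - a) = of_real (Re z / (Re z - Re a))"
          using ar[OF that] zr by (metis of_real_diff of_real_divide)
        then show ?thesis by simp
      qed
      have Reg: "Re (?g z) = (\<Sum>a\<in>?R. real (order a p) * (Re z / (Re z - Re a)))"
        unfolding Re_sum by (intro sum.cong Re_term) auto
      have s': "s + Re (?g z) = 0" using arg_cong[OF sg, of Re] by simp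
      have "Re (?g z) \<ge> 0"
        unfolding Reg using neg zn by (intro sum_nonneg mult_nonneg_nonneg divide_nonneg_nonneg) force+
      moreover have "Re (?g z) < (\<Sum>a\<in>?R. real (order a p))"
        unfolding Reg
      proof (rule sum_strict_mono[OF fin R])
        fix a assume a: "a \<in> ?R"
        have "Re z / (Re z - Re a) < 1" using neg[OF a] zn by (simp add: divide_simps)
        then have "real (order a p) * (Re z / (Re z - Re a)) < real (order a p) * 1"
          using ord[OF a] by (intro mult_strict_left_mono) auto
        then show "real (order a p) * (Re z / (Re z - Re a)) < real (order a p)" by simp
      qed
      then have "Re (?g z) < real (degree p)"
        using sum_order_roots[OF p0] by (metis of_nat_sum)
      ultimately show False using s s' by linarith
    qed
    moreover have "poly (pderiv (theta s p)) z \<noteq> 0"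
    proof -
      let ?d = "\<Sum>a\<in>?R. of_nat (order a p) * (- a / (z - a)\<^sup>2)"
      have "((\<lambda>w. of_real s + ?g w) has_field_derivative 0 + ?d) (at z)"
        using za by (intro DERIV_add DERIV_const DERIV_sum DERIV_cmult)
          (auto intro!: derivative_eq_intros simp: power2_eq_square field_simps)
      then have "((\<lambda>w. poly (theta s p) w / poly p w) has_field_derivative 0 + ?d) (at z)"
      proof (rule has_field_derivative_transform_within_open)
        show "open {w. poly p w \<noteq> 0}" by (intro open_Collect_neq continuous_intros)
      qed (use pz g in auto)
      moreover have "((\<lambda>w. poly (theta s p) w / poly p w) has_field_derivative poly (pderiv (theta s p)) z / poly p z) (at z)"
        using pz root by (auto intro!: derivative_eq_intros simp: field_simps)
      ultimately have e1: "poly (pderiv (theta s p)) z / poly p z = 0 + ?d"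
        by (rule DERIV_unique[rotated])
      have e2: "?d = of_real (\<Sum>a\<in>?R. real (order a p) * (- Re a / (Re z - Re a)\<^sup>2))"
        unfolding of_real_sum
      proof (rule sum.cong)
        fix a assume a: "a \<in> ?R"
        show "of_nat (order a p) * (- a / (z - a)\<^sup>2) = of_real (real (order a p) * (- Re a / (Re z - Re a)\<^sup>2))"
          by (subst (1 2) ar[OF a], subst zr) simp
      qed simp
      have "(\<Sum>a\<in>?R. real (order a p) * (- Re a / (Re z - Re a)\<^sup>2)) > 0"
      proof (rule sum_pos[OF fin R])
        fix a assume a: "a \<in> ?R"
        have "Re z \<noteq> Re a" using za[OF a] zr ar[OF a] by (metis right_minus_eq)
        then show "0 < real (order a p) * (- Re a / (Re z - Re a)\<^sup>2)"
          using ord[OF a] neg[OF a] by (intro mult_pos_pos divide_pos_pos) auto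
      qed
      then have d: "?d \<noteq> 0" unfolding e2 of_real_eq_0_iff by (rule less_imp_neq[symmetric])
      show ?thesis
      proof
        assume z0: "poly (pderiv (theta s p)) z = 0"
        have "?d = 0 + ?d" by (rule add_0[symmetric])
        also have "\<dots> = poly (pderiv (theta s p)) z / poly p z" by (rule e1[symmetric])
        also have "\<dots> = 0" unfolding z0 by (rule div_0)
        finally show False using d by contradiction
      qed
    qed
    moreover have "z \<in> \<real>" using Imz by (simp add: complex_is_Real_iff)
    ultimately show ?thesis by blast
  qed
  then show ?thesis using nz unfolding simple_negative_roots_def by blast
qed

lemma theta_no_common_root:
  assumes "simple_negative_roots p" "s \<noteq> t" "poly (theta s p) z = 0" "poly (theta t p) z = 0"
  shows False
proof -
  have "of_real s * poly p z = of_real t * poly p z"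
    using assms(3,4) unfolding poly_theta by (metis add_right_cancel)
  then have "poly p z = 0" using assms(2) by simp
  with assms show False by (auto simp: simple_negative_roots_def poly_theta)
qed

section \<open>The even part of the endpoint polynomial\<close>

lemma even_part_identity:
  fixes p :: "complex poly"
  assumes "\<And>k. coeff e k = coeff p (2 * k)"
  shows "poly p w + poly p (- w) = 2 * poly e (w\<^sup>2)"
proof -
  have "poly p w + poly p (- w) = 2 * poly e (w\<^sup>2)" if "degree p \<le> n" "\<And>k. coeff e k = coeff p (2 * k)" for n and p e :: "complex poly"
    using that
  proof (induction n arbitrary: p e rule: less_induct)
    case (less n)
    obtain a p1 where p1: "p = pCons a p1" by (cases p)
    obtain b q where q: "p1 = pCons b q" by (cases p1)
    obtain c d where e: "e = pCons c d" by (cases e)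
    have c: "c = a" using less.prems(2)[of 0] by (simp add: e p1)
    have d: "coeff d k = coeff q (2 * k)" for k
      using less.prems(2)[of "Suc k"] by (simp add: e p1 q)
    have "poly q w + poly q (- w) = 2 * poly d (w\<^sup>2)"
    proof (cases "q = 0")
      case True
      then have "d = 0" using d by (simp add: poly_eq_iff)
      then show ?thesis using True by simp
    next
      case False
      then have "degree p = Suc (Suc (degree q))" by (simp add: p1 q)
      then have "degree q < n" using less.prems(1) by simp
      then show ?thesis using less.IH[OF _ order_refl d] by blast
    qed
    then have "w\<^sup>2 * (poly q w + poly q (- w)) = w\<^sup>2 * (2 * poly d (w\<^sup>2))" by simp
    then show ?case unfolding p1 q e c by (simp add: algebra_simps power2_eq_square)
  qed
  then show ?thesis using assms by blast
qed

definition poly_upto :: "(nat \<Rightarrow> real) \<Rightarrow> nat \<Rightarrow> complex poly" where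
  "poly_upto f n = (\<Sum>k\<le>n. monom (of_real (f k)) k)"

lemma coeff_poly_upto: "coeff (poly_upto f n) k = (if k \<le> n then of_real (f k) else 0)"
  by (simp add: poly_upto_def coeff_sum if_distrib sum.delta cong: if_cong)

lemma map_poly_cnj_poly_upto: "map_poly cnj (poly_upto f n) = poly_upto f n"
  by (simp add: poly_eq_iff coeff_map_poly coeff_poly_upto)

text \<open>
  The ratio of the \<open>k\<close>-th derivative to the value at \<open>1\<close> of a solution of the Jacobi equation of
  degree \<open>N\<close> with first exponent \<open>a\<close> and \<open>\<sigma> = N + a + b + 1\<close>. The parameters \<open>N\<close> and \<open>\<sigma>\<close> are kept
  separate because the identities below shift them independently.
\<close>

definition jet :: "real \<Rightarrow> real \<Rightarrow> real \<Rightarrow> nat \<Rightarrow> real" where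
  "jet N \<sigma> a k = (\<Prod>i<k. (N - real i) * (\<sigma> + real i) / (2 * (a + 1 + real i)))"

lemma jet_0 [simp]: "jet N \<sigma> a 0 = 1"
  by (simp add: jet_def)

lemma jet_Suc: "jet N \<sigma> a (Suc k) = jet N \<sigma> a k * ((N - real k) * (\<sigma> + real k) / (2 * (a + 1 + real k)))"
  by (simp add: jet_def)

lemma jet_pos:
  assumes "\<sigma> > 0" "a > -1" "real k \<le> N"
  shows "jet N \<sigma> a k > 0"
  unfolding jet_def using assms by (intro prod_pos) (auto intro!: divide_pos_pos mult_pos_pos)

lemma jet_eq_0: "N < k \<Longrightarrow> jet (real N) \<sigma> a k = 0"
  unfolding jet_def by (rule prod_zero) (auto intro!: bexI[of _ N])

lemma jet_shift_sigma: "jet N (\<sigma> + 1) a k * \<sigma> = jet N \<sigma> a k * (\<sigma> + real k)"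
proof (induction k)
  case (Suc k)
  have "jet N (\<sigma> + 1) a (Suc k) * \<sigma> = (jet N (\<sigma> + 1) a k * \<sigma>) * ((N - real k) * (\<sigma> + 1 + real k) / (2 * (a + 1 + real k)))"
    by (simp add: jet_Suc)
  also have "\<dots> = jet N \<sigma> a (Suc k) * (\<sigma> + real (Suc k))"
    unfolding Suc.IH jet_Suc by simp
  finally show ?case .
qed simp

lemma jet_shift_degree: "jet N \<sigma> a k * (N + 1) = jet (N + 1) \<sigma> a k * (N + 1 - real k)"
proof (induction k)
  case (Suc k)
  have "jet N \<sigma> a (Suc k) * (N + 1) = (jet N \<sigma> a k * (N + 1)) * ((N - real k) * (\<sigma> + real k) / (2 * (a + 1 + real k)))"
    by (simp add: jet_Suc)
  also have "\<dots> = jet (N + 1) \<sigma> a (Suc k) * (N + 1 - real (Suc k))"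
    unfolding Suc.IH jet_Suc by (simp add: algebra_simps)
  finally show ?case .
qed simp

lemma higher_pderiv_jacobi_ode_1:
  assumes F: "jacobi_ode n a b F" and a: "a > -1"
  shows "poly ((pderiv ^^ k) F) 1 = of_real (jet n (n + a + b + 1) a k) * poly F 1"
proof (induction k)
  case (Suc k)
  have a1: "2 * (a + 1 + real k) \<noteq> 0" using a by auto
  have "jacobi_ode (n - real k) (a + real k) (b + real k) ((pderiv ^^ k) F)"
    by (rule jacobi_ode_higher_pderiv[OF F])
  from jacobi_odeD[OF this, of 1]
  have "of_real (2 * (a + 1 + real k)) * poly ((pderiv ^^ Suc k) F) 1
      = of_real ((n - real k) * (n + a + b + 1 + real k)) * poly ((pderiv ^^ k) F) 1"
    by (simp add: algebra_simps)
  then have "poly ((pderiv ^^ Suc k) F) 1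
      = of_real ((n - real k) * (n + a + b + 1 + real k)) * poly ((pderiv ^^ k) F) 1 / of_real (2 * (a + 1 + real k))"
    using a1 by (metis nonzero_mult_div_cancel_left of_real_eq_0_iff)
  then show ?case unfolding Suc.IH jet_Suc by simp
qed simp

lemma poly_resolvent_jacobi_1:
  assumes F: "jacobi_ode (real N) a b F" "degree F = N" and a: "a > -1"
  shows "poly (resolvent \<nu> F) 1 = poly F 1 * poly (poly_upto (jet N (N + a + b + 1) a) N) \<nu>"
  unfolding resolvent_def F(2) poly_upto_def poly_sum poly_smult poly_monom higher_pderiv_jacobi_ode_1[OF F(1) a] sum_distrib_left
  by (rule sum.cong) simp_all

text \<open>
  The even part of the generating polynomial of the jets of \<open>jacobi (2 * m + 1) a (a - 2)\<close>.
\<close>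

definition even_jet_poly :: "nat \<Rightarrow> real \<Rightarrow> complex poly" where
  "even_jet_poly m a = poly_upto (\<lambda>k. jet (real (2 * m + 1)) (2 * real m + 2 * a) a (2 * k)) m"

lemma degree_even_jet_poly: "degree (even_jet_poly m a) \<le> m"
  by (rule degree_le) (simp add: even_jet_poly_def coeff_poly_upto)

text \<open>
  Hermite--Biehler applies since the generating polynomial is, up to a nonzero constant, the value at
  \<open>1\<close> of the resolvent; a root \<open>r\<close> in the closed right half plane would give \<open>z = 1 / r\<close> there.
\<close>

lemma even_jet_poly_simple_negative_roots:
  assumes a: "a \<in> {-1/2, 0, 1/2, 1}" and m: "m \<ge> 1"
  shows "simple_negative_roots (even_jet_poly m a)"
proof (rule hermite_biehler_even_part)
  let ?N = "2 * m + 1"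
  let ?F = "jacobi ?N a (a - 2)"
  let ?p = "poly_upto (jet (real ?N) (real ?N + a + (a - 2) + 1) a) ?N"
  have a1: "a > -1" using a by auto
  have "real m \<ge> 1" "a \<ge> -1/2" "real ?N = 2 * real m + 1" using a m by auto
  then have "real ?N + real i + a + (a - 2) + 1 \<noteq> 0" for i by linarith
  then have ode: "jacobi_ode (real ?N) a (a - 2) ?F" by (rule jacobi_jacobi_ode)
  have F1: "poly ?F 1 \<noteq> 0"
    using jacobi_ode_eq_0[OF ode a1] jacobi_nonzero by blast
  have res: "poly (resolvent \<nu> ?F) 1 = poly ?F 1 * poly ?p \<nu>" for \<nu>
    by (rule poly_resolvent_jacobi_1[OF ode degree_jacobi a1])
  have N: "?N \<ge> 3" "?N \<ge> 2" using m by auto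
  show "Re r < 0" if r: "poly ?p r = 0" for r
  proof (rule ccontr)
    assume neg: "\<not> Re r < 0"
    have "coeff ?p 0 = 1" by (simp add: coeff_poly_upto)
    then have r0: "r \<noteq> 0" using r by (auto simp: poly_0_coeff_0)
    have "Re (1 / r) \<ge> 0" using neg by (simp add: Re_divide)
    moreover have "poly (resolvent (1 / (1 / r)) ?F) 1 = 0" unfolding res using r by simp
    ultimately show False
      using a r0 hurwitz_resolvent_nonneg[of a ?N "1 / r"] hurwitz_resolvent_minus_half[of ?N "1 / r"]
        hurwitz_resolvent_one[of ?N "1 / r"] N by auto
  qed
  show "map_poly cnj ?p = ?p" by (rule map_poly_cnj_poly_upto)
  show "poly ?p w + poly ?p (- w) = 2 * poly (even_jet_poly m a) (w\<^sup>2)" for w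
  proof (rule even_part_identity)
    fix k
    have eq: "real ?N + a + (a - 2) + 1 = 2 * real m + 2 * a" by simp
    show "coeff (even_jet_poly m a) k = coeff ?p (2 * k)"
      unfolding even_jet_poly_def eq coeff_poly_upto by auto
  qed
qed

section \<open>Parity and unweighted moments\<close>

lemma jint_0_0: "jint 0 0 f = integral {-1..1} (\<lambda>x. poly f (of_real x))"
  unfolding jint_def
  by (rule integral_spike[of "{-1, 1}"]) (auto simp: jweight_def)

lemma jint_pderiv: "jint 0 0 (pderiv P) = poly P 1 - poly P (-1)"
proof -
  have "((\<lambda>x. poly (pderiv P) (of_real x)) has_integral poly P (of_real 1) - poly P (of_real (-1))) {-1..1}"
    by (rule fundamental_theorem_of_calculus) (simp_all add: poly_of_real_vector_derivative)
  then show ?thesis unfolding jint_0_0 by (simp add: integral_unique)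
qed

lemma jint_x_pderiv2: "jint 0 0 ([:0, 1:] * pderiv (pderiv P))
   = (poly (pderiv P) 1 + poly (pderiv P) (-1)) - (poly P 1 - poly P (-1))"
proof -
  have "[:0, 1:] * pderiv (pderiv P) = pderiv ([:0, 1:] * pderiv P - P)"
    unfolding pderiv_diff pderiv_mult poly_eq_poly_eq_iff[symmetric]
    by (rule ext) (simp add: pderiv_pCons algebra_simps)
  then show ?thesis by (simp only: jint_pderiv) simp
qed

definition has_parity :: "nat \<Rightarrow> complex poly \<Rightarrow> bool" where
  "has_parity n p \<longleftrightarrow> pcompose p [:0, -1:] = smult ((-1) ^ n) p"

lemma poly_has_parity: "has_parity n p \<Longrightarrow> poly p (- x) = (-1) ^ n * poly p x"
proof -
  assume p: "has_parity n p"
  have "poly p (- x) = poly (pcompose p [:0, -1:]) x" by (simp add: poly_pcompose)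
  then show ?thesis using p by (simp add: has_parity_def)
qed

lemma pderiv_pcompose_minus:
  fixes p :: "complex poly"
  shows "pcompose (pderiv p) [:0, -1:] = - pderiv (pcompose p [:0, -1:])"
  by (simp add: pderiv_pcompose pderiv_pCons)

lemma has_parity_pderiv: "has_parity n p \<Longrightarrow> has_parity (Suc n) (pderiv p)"
  unfolding has_parity_def pderiv_pcompose_minus by (simp add: pderiv_smult)

lemma has_parity_higher_pderiv: "has_parity n p \<Longrightarrow> has_parity (n + k) ((pderiv ^^ k) p)"
  by (induction k) (simp_all add: has_parity_pderiv)

lemma poly_jacobi_1_nonzero:
  assumes "jacobi_ode (real N) a b (jacobi N a b)" "a > -1"
  shows "poly (jacobi N a b) 1 \<noteq> 0"
  using jacobi_ode_eq_0[OF assms] jacobi_nonzero by blast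

lemma lead_coeff_jacobi: "coeff (jacobi N a b) N = 1"
proof -
  have "coeff (pcompose (jacobi N a b) [:-1, 1:]) (degree (pcompose (jacobi N a b) [:-1, 1:])) = coeff (jacobi N a b) N"
    using lead_coeff_comp[of "[:-1, 1:]" "jacobi N a b"] by (simp add: degree_jacobi)
  moreover have "coeff (pcompose (jacobi N a b) [:-1, 1:]) N = 1"
    using tcoeff_jacobi[of N a b N] by (simp add: tcoeff_def)
  ultimately show ?thesis by (simp add: degree_pcompose degree_jacobi)
qed

text \<open>
  The reflected polynomial solves the same equation, hence is a multiple of the polynomial itself; the
  leading coefficients determine the factor.
\<close>

lemma has_parity_jacobi:
  assumes ode: "jacobi_ode (real N) a a (jacobi N a a)" and a: "a > -1"
  shows "has_parity N (jacobi N a a)"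
proof -
  let ?G = "jacobi N a a"
  define H where "H = pcompose ?G [:0, -1:]"
  define c where "c = poly H 1 / poly ?G 1"
  have G1: "poly ?G 1 \<noteq> 0" by (rule poly_jacobi_1_nonzero[OF ode a])
  have H': "poly (pderiv H) x = - poly (pderiv ?G) (- x)" "poly (pderiv (pderiv H)) x = poly (pderiv (pderiv ?G)) (- x)" for x
  proof -
    have 1: "pderiv H = - pcompose (pderiv ?G) [:0, -1:]" unfolding pderiv_pcompose_minus H_def by simp
    show "poly (pderiv H) x = - poly (pderiv ?G) (- x)" unfolding 1 by (simp add: poly_pcompose)
    have "pderiv (pderiv H) = pcompose (pderiv (pderiv ?G)) [:0, -1:]"
      unfolding 1 pderiv_minus pderiv_pcompose_minus by simp
    then show "poly (pderiv (pderiv H)) x = poly (pderiv (pderiv ?G)) (- x)" by (simp add: poly_pcompose)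
  qed
  have Hx: "poly H x = poly ?G (- x)" for x by (simp add: H_def poly_pcompose)
  have "jacobi_ode (real N) a a (H - smult c ?G)"
  proof (rule jacobi_odeI)
    fix x
    let ?D = "H - smult c ?G"
    have "(1 - x\<^sup>2) * poly (pderiv (pderiv ?D)) x + (of_real (a - a) - of_real (a + a + 2) * x) * poly (pderiv ?D) x
      + of_real (real N * (real N + a + a + 1)) * poly ?D x
     = ((1 - (- x)\<^sup>2) * poly (pderiv (pderiv ?G)) (- x) + (of_real (a - a) - of_real (a + a + 2) * (- x)) * poly (pderiv ?G) (- x)
      + of_real (real N * (real N + a + a + 1)) * poly ?G (- x))
      - c * ((1 - x\<^sup>2) * poly (pderiv (pderiv ?G)) x + (of_real (a - a) - of_real (a + a + 2) * x) * poly (pderiv ?G) x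
      + of_real (real N * (real N + a + a + 1)) * poly ?G x)"
      unfolding pderiv_diff pderiv_smult poly_diff poly_smult H' Hx by (simp add: algebra_simps)
    also have "\<dots> = 0" unfolding jacobi_odeD[OF ode] by simp
    finally show "(1 - x\<^sup>2) * poly (pderiv (pderiv ?D)) x + (of_real (a - a) - of_real (a + a + 2) * x) * poly (pderiv ?D) x
      + of_real (real N * (real N + a + a + 1)) * poly ?D x = 0" .
  qed
  then have "H - smult c ?G = 0"
    by (rule jacobi_ode_eq_0) (use a G1 in \<open>simp_all add: c_def\<close>)
  then have Hc: "H = smult c ?G" by simp
  have "coeff H N = (-1) ^ N"
  proof -
    have "coeff H (degree H) = coeff ?G N * (-1) ^ N"
      unfolding H_def using lead_coeff_comp[of "[:0, -1:]" ?G] by (simp add: degree_jacobi)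
    then show ?thesis by (simp add: H_def degree_pcompose degree_jacobi lead_coeff_jacobi)
  qed
  then have "c = (-1) ^ N" unfolding Hc by (simp add: lead_coeff_jacobi)
  then show ?thesis using Hc by (simp add: has_parity_def H_def)
qed

text \<open>
  By the differential equation the integrand on the left is an exact derivative. The factor \<open>4 * a\<close> on the
  right is the source of the spurious eigenvalues: it is negative for the Chebyshev tau method and
  zero for the Legendre tau method.
\<close>

lemma jint_jacobi_even:
  assumes ode: "jacobi_ode (real N) a a G" and par: "has_parity N G" and N: "even N" and a: "a > -1"
  shows "of_real ((real N + 1) * (real N + 2 * a)) * jint 0 0 G = of_real (4 * a) * poly G 1"
proof -
  have "smult (of_real ((real N + 1) * (real N + 2 * a))) G = pderiv (smult (of_real (2 * a)) ([:0, 1:] * G) - [:1, 0, -1:] * pderiv G)"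
    unfolding poly_eq_poly_eq_iff[symmetric]
  proof (rule ext)
    fix x
    show "poly (smult (of_real ((real N + 1) * (real N + 2 * a))) G) x
      = poly (pderiv (smult (of_real (2 * a)) ([:0, 1:] * G) - [:1, 0, -1:] * pderiv G)) x"
      using jacobi_odeD[OF ode, of x]
      unfolding pderiv_diff pderiv_mult pderiv_smult
      by (simp add: pderiv_pCons power2_eq_square algebra_simps del: mult_pCons_left mult_pCons_right)
  qed
  then have "jint 0 0 (smult (of_real ((real N + 1) * (real N + 2 * a))) G)
     = of_real (2 * a) * (poly G 1 + poly G (-1))"
    by (simp only: jint_pderiv) (simp add: algebra_simps)
  moreover have "poly G (-1) = poly G 1" using poly_has_parity[OF par, of 1] N by simp
  ultimately show ?thesis by (simp add: jint_smult)
qed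

lemma jint_jacobi_odd:
  assumes ode: "jacobi_ode (real N) a a G" and par: "has_parity N G" and N: "odd N" and a: "a > -1"
  shows "of_real ((real N + 2) * (real N + 2 * a - 1)) * jint 0 0 ([:0, 1:] * G) = of_real (4 * a) * poly G 1"
proof -
  have "smult (of_real ((real N + 2) * (real N + 2 * a - 1))) ([:0, 1:] * G)
      = pderiv ([:1, 0, of_real (2 * a - 1):] * G - [:0, 1, 0, -1:] * pderiv G)"
    unfolding poly_eq_poly_eq_iff[symmetric]
  proof (rule ext)
    fix x
    show "poly (smult (of_real ((real N + 2) * (real N + 2 * a - 1))) ([:0, 1:] * G)) x
      = poly (pderiv ([:1, 0, of_real (2 * a - 1):] * G - [:0, 1, 0, -1:] * pderiv G)) x"
      using arg_cong[OF jacobi_odeD[OF ode, of x], of "\<lambda>y. x * y"]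
      unfolding pderiv_diff pderiv_mult pderiv_smult
      by (simp add: pderiv_pCons power2_eq_square algebra_simps del: mult_pCons_left mult_pCons_right)
  qed
  then have "jint 0 0 (smult (of_real ((real N + 2) * (real N + 2 * a - 1))) ([:0, 1:] * G))
     = of_real (2 * a) * (poly G 1 - poly G (-1))"
    by (simp only: jint_pderiv) (simp add: algebra_simps)
  moreover have "poly G (-1) = - poly G 1" using poly_has_parity[OF par, of 1] N by simp
  ultimately show ?thesis by (simp add: jint_smult del: mult_pCons_left)
qed

lemma jint_higher_pderiv_even:
  assumes par: "has_parity N G" and N: "even N" and k: "k > 0"
  shows "jint 0 0 ((pderiv ^^ (2 * k)) G) = 2 * poly ((pderiv ^^ (2 * k - 1)) G) 1"
proof -
  have "(pderiv ^^ (2 * k)) G = pderiv ((pderiv ^^ (2 * k - 1)) G)"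
    using k by (cases k) simp_all
  moreover have "poly ((pderiv ^^ (2 * k - 1)) G) (-1) = - poly ((pderiv ^^ (2 * k - 1)) G) 1"
    using poly_has_parity[OF has_parity_higher_pderiv[OF par, of "2 * k - 1"], of 1] N k by simp
  ultimately show ?thesis by (simp add: jint_pderiv)
qed

lemma jint_higher_pderiv_odd:
  assumes par: "has_parity N G" and N: "odd N" and k: "k > 0"
  shows "jint 0 0 ([:0, 1:] * (pderiv ^^ (2 * k)) G)
     = 2 * (poly ((pderiv ^^ (2 * k - 1)) G) 1 - poly ((pderiv ^^ (2 * k - 2)) G) 1)"
proof -
  obtain j where j: "k = Suc j" using k by (cases k) auto
  have "jint 0 0 ([:0, 1:] * (pderiv ^^ (2 * k)) G) = jint 0 0 ([:0, 1:] * pderiv (pderiv ((pderiv ^^ (2 * j)) G)))"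
    by (simp add: j)
  also have "\<dots> = (poly (pderiv ((pderiv ^^ (2 * j)) G)) 1 + poly (pderiv ((pderiv ^^ (2 * j)) G)) (-1))
     - (poly ((pderiv ^^ (2 * j)) G) 1 - poly ((pderiv ^^ (2 * j)) G) (-1))"
    by (rule jint_x_pderiv2)
  also have "poly ((pderiv ^^ (2 * j)) G) (-1) = - poly ((pderiv ^^ (2 * j)) G) 1"
    using poly_has_parity[OF has_parity_higher_pderiv[OF par, of "2 * j"], of 1] N by simp
  also have "poly (pderiv ((pderiv ^^ (2 * j)) G)) (-1) = poly (pderiv ((pderiv ^^ (2 * j)) G)) 1"
    using poly_has_parity[OF has_parity_pderiv[OF has_parity_higher_pderiv[OF par, of "2 * j"]], of 1] N by simp
  finally show ?thesis by (simp add: j)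
qed

lemma jint_even_odd_eq_0:
  shows "has_parity n p \<Longrightarrow> odd n \<Longrightarrow> jint 0 0 p = 0"
    "has_parity n p \<Longrightarrow> even n \<Longrightarrow> jint 0 0 ([:0, 1:] * p) = 0"
proof -
  have refl: "jint 0 0 (pcompose p [:0, -1:]) = jint 0 0 p" for p
    using Henstock_Kurzweil_Integration.integral_reflect_real[of 1 "-1" "\<lambda>x. poly p (of_real x)"]
    unfolding jint_0_0 by (simp add: poly_pcompose)
  show 1: "has_parity n p \<Longrightarrow> odd n \<Longrightarrow> jint 0 0 p = 0" for n p
    using refl[of p] by (simp add: has_parity_def jint_minus)
  assume "has_parity n p" "even n"
  then have "has_parity (Suc n) ([:0, 1:] * p)"
    unfolding has_parity_def pcompose_mult by (simp add: pcompose_pCons)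
  then show "jint 0 0 ([:0, 1:] * p) = 0" using 1 \<open>even n\<close> by fastforce
qed

section \<open>Reduction of the tau problem to two scalar equations\<close>

text \<open>
  The polynomial solution of \<open>w - \<mu> w'' = G\<close>.
\<close>

definition resolvent2 :: "complex \<Rightarrow> complex poly \<Rightarrow> complex poly" where
  "resolvent2 \<mu> G = (\<Sum>k\<le>degree G. smult (\<mu> ^ k) ((pderiv ^^ (2 * k)) G))"

lemma smult_sum_right: "smult c (\<Sum>i\<in>A. f i) = (\<Sum>i\<in>A. smult c (f i))"
  by (rule poly_eqI) (simp add: coeff_sum sum_distrib_left)

lemma resolvent2_eq: "resolvent2 \<mu> G - smult \<mu> (D2 (resolvent2 \<mu> G)) = G"
proof -
  let ?t = "\<lambda>k. smult (\<mu> ^ k) ((pderiv ^^ (2 * k)) G)"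
  have t: "smult \<mu> (D2 (?t k)) = ?t (Suc k)" for k
    by (simp add: numeral_2_eq_2 pderiv_smult)
  have D: "smult \<mu> (D2 (resolvent2 \<mu> G)) = (\<Sum>k\<le>degree G. ?t (Suc k))"
    unfolding resolvent2_def higher_pderiv_sum smult_sum_right t ..
  have "resolvent2 \<mu> G = (\<Sum>k\<le>Suc (degree G). ?t k)"
    using higher_pderiv_eq_0[of G "2 * Suc (degree G)"] by (simp add: resolvent2_def)
  also have "\<dots> = G + smult \<mu> (D2 (resolvent2 \<mu> G))"
    unfolding D by (simp only: sum.atMost_Suc_shift) simp
  finally show ?thesis by (simp add: algebra_simps)
qed

lemma degree_resolvent2_le: "degree (resolvent2 \<mu> G) \<le> degree G"
  unfolding resolvent2_def
proof (rule degree_sum_le)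
  fix k
  have "degree ((pderiv ^^ (2 * k)) G) \<le> degree G"
    by (simp add: degree_higher_pderiv)
  then show "degree (smult (\<mu> ^ k) ((pderiv ^^ (2 * k)) G)) \<le> degree G"
    using degree_smult_le order_trans by blast
qed simp

lemma eq_smult_D2_imp_0:
  assumes "d = smult \<mu> (D2 d)"
  shows "d = 0"
proof (rule ccontr)
  assume "d \<noteq> 0"
  have "degree (smult \<mu> (D2 d)) \<le> degree (D2 d)" by (rule degree_smult_le)
  also have "\<dots> = degree d - 2" by (simp add: degree_higher_pderiv)
  finally have "degree d = 0" using assms by simp
  then obtain c where "d = [:c:]" by (rule degree_eq_zeroE)
  then have "D2 d = 0" by (simp add: numeral_2_eq_2)
  then show False using assms \<open>d \<noteq> 0\<close> by simp
qed

lemma resolvent2_unique: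
  assumes "w - smult \<mu> (D2 w) = G"
  shows "w = resolvent2 \<mu> G"
proof -
  have "w - resolvent2 \<mu> G = smult \<mu> (D2 w) - smult \<mu> (D2 (resolvent2 \<mu> G))"
    using assms resolvent2_eq[of \<mu> G] by (metis add_diff_cancel_left' diff_add_cancel diff_diff_eq2 diff_eq_eq)
  also have "\<dots> = smult \<mu> (D2 (w - resolvent2 \<mu> G))"
    by (simp add: numeral_2_eq_2 pderiv_diff smult_diff_right)
  finally have "w - resolvent2 \<mu> G = 0" by (rule eq_smult_D2_imp_0)
  then show ?thesis by simp
qed

lemma resolvent2_linear: "resolvent2 \<mu> (smult a G + smult b H) = smult a (resolvent2 \<mu> G) + smult b (resolvent2 \<mu> H)"
proof (rule resolvent2_unique[symmetric])
  have "smult a (resolvent2 \<mu> G) + smult b (resolvent2 \<mu> H) - smult \<mu> (D2 (smult a (resolvent2 \<mu> G) + smult b (resolvent2 \<mu> H)))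
     = smult a (resolvent2 \<mu> G - smult \<mu> (D2 (resolvent2 \<mu> G))) + smult b (resolvent2 \<mu> H - smult \<mu> (D2 (resolvent2 \<mu> H)))"
    by (simp add: numeral_2_eq_2 pderiv_add pderiv_smult smult_diff_right smult_add_right algebra_simps)
  then show "smult a (resolvent2 \<mu> G) + smult b (resolvent2 \<mu> H) - smult \<mu> (D2 (smult a (resolvent2 \<mu> G) + smult b (resolvent2 \<mu> H)))
     = smult a G + smult b H"
    unfolding resolvent2_eq .
qed

lemma resolvent2_nonzero: "G \<noteq> 0 \<Longrightarrow> resolvent2 \<mu> G \<noteq> 0"
  using resolvent2_eq[of \<mu> G] by (auto simp: numeral_2_eq_2)

lemma has_parity_resolvent2:
  assumes "has_parity n G"
  shows "has_parity n (resolvent2 \<mu> G)"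
proof -
  have "pcompose ((pderiv ^^ (2 * k)) G) [:0, -1:] = smult ((-1) ^ n) ((pderiv ^^ (2 * k)) G)" for k
    using has_parity_higher_pderiv[OF assms, of "2 * k"] by (simp add: has_parity_def power_add)
  then show ?thesis
    unfolding has_parity_def resolvent2_def by (simp add: pcompose_sum pcompose_smult smult_sum_right mult.commute)
qed

lemma polynomial_antiderivative:
  fixes w :: "complex poly"
  obtains P where "pderiv P = w" "degree P \<le> Suc (degree w)" "poly P x = 0"
proof
  define P where "P = (\<Sum>i\<le>degree w. monom (coeff w i / of_nat (Suc i)) (Suc i))"
  have "pderiv P = (\<Sum>i\<le>degree w. monom (coeff w i) i)"
    unfolding P_def higher_pderiv_sum[where n = 1, simplified] by (rule sum.cong) (simp_all add: pderiv_monom del: of_nat_Suc)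
  then show "pderiv (P - [:poly P x:]) = w"
    by (simp add: pderiv_diff poly_as_sum_of_monoms pderiv_pCons)
  have "degree P \<le> Suc (degree w)"
    unfolding P_def by (rule degree_sum_le) (auto intro: order_trans[OF degree_monom_le])
  then show "degree (P - [:poly P x:]) \<le> Suc (degree w)"
    by (intro degree_diff_le) auto
  show "poly (P - [:poly P x:]) x = 0" by simp
qed

text \<open>
  A polynomial \<open>w\<close> has a double antiderivative satisfying all four boundary conditions iff it is
  orthogonal to \<open>1\<close> and \<open>x\<close> in the unweighted sense.
\<close>

lemma trial_space_D2_iff:
  assumes "n \<ge> 2"
  shows "(\<exists>u \<in> trial_space n. D2 u = w) \<longleftrightarrow> degree w \<le> n - 2 \<and> jint 0 0 w = 0 \<and> jint 0 0 ([:0, 1:] * w) = 0"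
proof
  assume "\<exists>u \<in> trial_space n. D2 u = w"
  then obtain u where u: "u \<in> trial_space n" "D2 u = w" by blast
  have w: "w = pderiv (pderiv u)" using u(2) by (simp add: numeral_2_eq_2)
  have "degree w = degree u - 2" unfolding u(2)[symmetric] by (rule degree_higher_pderiv)
  then show "degree w \<le> n - 2 \<and> jint 0 0 w = 0 \<and> jint 0 0 ([:0, 1:] * w) = 0"
    unfolding w jint_pderiv jint_x_pderiv2 using u(1) by (auto simp: trial_space_def)
next
  assume w: "degree w \<le> n - 2 \<and> jint 0 0 w = 0 \<and> jint 0 0 ([:0, 1:] * w) = 0"
  \<comment> \<open>normalized at -1; the two moments give the conditions at 1\<close>
  obtain P where P: "pderiv P = w" "degree P \<le> Suc (degree w)" "poly P (-1) = 0"
    by (rule polynomial_antiderivative)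
  obtain u where u: "pderiv u = P" "degree u \<le> Suc (degree P)" "poly u (-1) = 0"
    by (rule polynomial_antiderivative)
  have "poly P 1 = 0" using w P by (metis jint_pderiv diff_zero)
  moreover have "poly u 1 = 0"
    using w jint_x_pderiv2[of u] unfolding u P using calculation P(3) u(3) by simp
  moreover have "degree u \<le> n" using w P(2) u(2) assms by linarith
  ultimately have "u \<in> trial_space n" using P(3) u by (simp add: trial_space_def)
  moreover have "D2 u = w" using u(1) P(1) by (simp add: numeral_2_eq_2)
  ultimately show "\<exists>u \<in> trial_space n. D2 u = w" by blast
qed

lemma trial_space_eq_0:
  assumes "n \<ge> 4" "u \<in> trial_space n" "degree u < 4"
  shows "u = 0"
proof (rule ccontr)
  assume u0: "u \<noteq> 0"
  obtain q where q: "u = [:1, 0, -1:] ^ 2 * q"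
    using assms(1,2) unfolding trial_space_eq[OF assms(1)] test_space_def by blast
  have "degree u = degree ([:1, 0, -1:] ^ 2 :: complex poly) + degree q"
    unfolding q using u0 q by (intro degree_mult_eq) auto
  also have "degree ([:1, 0, -1:] ^ 2 :: complex poly) = 4" by (simp add: power2_eq_square)
  finally show False using assms(3) by simp
qed

lemma test_space_orthogonality:
  assumes "\<gamma> + real s > -1/2"
  shows "(\<forall>v \<in> test_space n s. weighted_integral \<gamma> f v = 0)
    \<longleftrightarrow> (\<forall>q. degree q \<le> n - 4 \<longrightarrow> jint (\<gamma> + real s - 1/2) (\<gamma> + real s - 1/2) (f * q) = 0)"
  unfolding test_space_def weighted_integral_eq_jint[OF assms, symmetric] by blast

lemma orthogonal_imp_eq_0:
  assumes a: "a > -1" and f: "degree f \<le> d" and orth: "\<And>q. degree q \<le> d \<Longrightarrow> jint a a (f * q) = 0"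
  shows "f = 0"
proof -
  have "degree (map_poly cnj f) = degree f" by (rule degree_map_poly) simp
  then show ?thesis using jint_norm_eq_0[OF a a] orth f by metis
qed

text \<open>
  Subtracting multiples of the two monic orthogonal polynomials lowers the degree to \<open>n - 4\<close>, where
  orthogonality forces the remainder to vanish.
\<close>

lemma orthogonal_expansion:
  assumes a: "a \<ge> -1/2" and n: "n \<ge> 4" and Y: "degree Y \<le> n - 2"
  shows "(\<forall>q. degree q \<le> n - 4 \<longrightarrow> jint a a (Y * q) = 0)
     \<longleftrightarrow> (\<exists>\<tau> \<sigma>. Y = smult \<tau> (jacobi (n - 2) a a) + smult \<sigma> (jacobi (n - 3) a a))"
proof -
  let ?G = "\<lambda>N. jacobi N a a"
  have a1: "a > -1" using a by simp
  have ode: "jacobi_ode (real N) a a (?G N)" if "N > 0" for N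
    by (rule jacobi_jacobi_ode) (use a that in auto)
  have orth: "jint a a (?G N * q) = 0" if "degree q < N" for q N
    using jacobi_orthogonal[of N a a "?G N" 0 q] ode[of N] a1 that by simp
  have lin: "jint a a ((smult \<tau> f + smult \<sigma> g) * q) = \<tau> * jint a a (f * q) + \<sigma> * jint a a (g * q)" for \<tau> \<sigma> f g q
    using a1 by (simp add: distrib_right jint_add jint_smult)
  have diff: "jint a a ((f - g) * q) = jint a a (f * q) - jint a a (g * q)" for f g q
    using a1 by (simp add: left_diff_distrib jint_diff)
  show ?thesis
  proof
    assume Yq: "\<forall>q. degree q \<le> n - 4 \<longrightarrow> jint a a (Y * q) = 0"
    define Y1 where "Y1 = Y - smult (coeff Y (n - 2)) (?G (n - 2))"
    define Y2 where "Y2 = Y1 - smult (coeff Y1 (n - 3)) (?G (n - 3))"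
    have top: "degree (f - smult (coeff f (Suc k)) (?G (Suc k))) \<le> k" if "degree f \<le> Suc k" for f k
    proof (rule degree_le, intro allI impI)
      fix i assume "i > k"
      then consider "i = Suc k" | "i > Suc k" by linarith
      then show "coeff (f - smult (coeff f (Suc k)) (?G (Suc k))) i = 0"
      proof cases
        case 1
        then show ?thesis by (simp add: lead_coeff_jacobi)
      next
        case 2
        then show ?thesis using that by (simp add: coeff_eq_0 degree_jacobi)
      qed
    qed
    have eq: "n - 2 = Suc (n - 3)" "n - 3 = Suc (n - 4)" using n by auto
    have "degree Y1 \<le> n - 3" unfolding Y1_def eq(1) by (rule top) (use Y eq in simp)
    then have dY2: "degree Y2 \<le> n - 4" unfolding Y2_def eq(2) by (rule top)
    have YY: "Y2 = Y - (smult (coeff Y (n - 2)) (?G (n - 2)) + smult (coeff Y1 (n - 3)) (?G (n - 3)))"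
      by (simp add: Y2_def Y1_def)
    have "Y2 = 0"
    proof (rule orthogonal_imp_eq_0[OF a1 dY2])
      fix q :: "complex poly" assume q: "degree q \<le> n - 4"
      then have "degree q < n - 2" "degree q < n - 3" using n by auto
      then show "jint a a (Y2 * q) = 0" unfolding YY diff lin using orth Yq q by simp
    qed
    then show "\<exists>\<tau> \<sigma>. Y = smult \<tau> (?G (n - 2)) + smult \<sigma> (?G (n - 3))" unfolding YY by auto
  next
    assume "\<exists>\<tau> \<sigma>. Y = smult \<tau> (?G (n - 2)) + smult \<sigma> (?G (n - 3))"
    then obtain \<tau> \<sigma> where "Y = smult \<tau> (?G (n - 2)) + smult \<sigma> (?G (n - 3))" by blast
    then show "\<forall>q. degree q \<le> n - 4 \<longrightarrow> jint a a (Y * q) = 0"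
      using orth n by (auto simp: lin)
  qed
qed

text \<open>
  With \<open>w = u''\<close> the tau condition says that \<open>w - \<mu> w''\<close> is a combination of the two orthogonal
  polynomials of degrees \<open>n - 2\<close> and \<open>n - 3\<close>, so that \<open>w\<close> is the same combination of their
  resolvents. These have opposite parity, hence the constraint against \<open>1\<close> only concerns the even one and the
  constraint against \<open>x\<close> only the odd one.
\<close>

lemma reciprocal_eigenvalue_iff:
  assumes a: "a = \<gamma> + real s - 1/2" "a \<ge> -1/2" and n: "n \<ge> 4"
    and eo: "{e, k} = {n - 2, n - 3}" "even e" "odd k"
  shows "reciprocal_eigenvalue n \<gamma> s \<mu> \<longleftrightarrow>
     jint 0 0 (resolvent2 \<mu> (jacobi e a a)) = 0 \<or> jint 0 0 ([:0, 1:] * resolvent2 \<mu> (jacobi k a a)) = 0"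
proof -
  let ?G = "\<lambda>N. jacobi N a a"
  let ?R = "\<lambda>N. resolvent2 \<mu> (?G N)"
  have a1: "a > -1" using a by simp
  have parity: "has_parity N (?G N)" for N
    by (rule has_parity_jacobi[OF jacobi_jacobi_ode a1]) (use a in auto)
  have R0: "?R N \<noteq> 0" for N by (rule resolvent2_nonzero[OF jacobi_nonzero])
  have cross: "jint 0 0 (?R k) = 0" "jint 0 0 ([:0, 1:] * ?R e) = 0"
    using jint_even_odd_eq_0 has_parity_resolvent2[OF parity] eo by blast+
  have dR: "degree (?R N) \<le> n - 2" if "N \<in> {n - 2, n - 3}" for N
    using degree_resolvent2_le[of \<mu> "?G N"] that by (auto simp: degree_jacobi)
  have e: "e \<in> {n - 2, n - 3}" and k: "k \<in> {n - 2, n - 3}" using eo(1) by auto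
  have ek: "e = n - 2 \<and> k = n - 3 \<or> e = n - 3 \<and> k = n - 2"
    using eo n by (auto simp: doubleton_eq_iff)
  have lin: "jint 0 0 (smult \<tau> f + smult \<sigma> g) = \<tau> * jint 0 0 f + \<sigma> * jint 0 0 g" for \<tau> \<sigma> f g
    by (simp add: jint_add jint_smult)
  have linx: "jint 0 0 ([:0, 1:] * (smult \<tau> f + smult \<sigma> g)) = \<tau> * jint 0 0 ([:0, 1:] * f) + \<sigma> * jint 0 0 ([:0, 1:] * g)" for \<tau> \<sigma> f g
    unfolding distrib_left mult_smult_right lin ..
  have "reciprocal_eigenvalue n \<gamma> s \<mu> \<longleftrightarrow> (\<exists>u\<in>trial_space n. u \<noteq> 0 \<and>
      (\<forall>q. degree q \<le> n - 4 \<longrightarrow> jint a a ((D2 u - smult \<mu> (D4 u)) * q) = 0))"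
    unfolding reciprocal_eigenvalue_def using test_space_orthogonality[of \<gamma> s n] a by simp
  also have "\<dots> \<longleftrightarrow> (\<exists>w :: complex poly. w \<noteq> 0 \<and> degree w \<le> n - 2 \<and> jint 0 0 w = 0 \<and> jint 0 0 ([:0, 1:] * w) = 0
      \<and> (\<forall>q. degree q \<le> n - 4 \<longrightarrow> jint a a ((w - smult \<mu> (D2 w)) * q) = 0))" (is "?lhs \<longleftrightarrow> ?rhs")
  proof
    assume ?lhs
    then obtain u where u: "u \<in> trial_space n" "u \<noteq> 0"
      "\<forall>q. degree q \<le> n - 4 \<longrightarrow> jint a a ((D2 u - smult \<mu> (D4 u)) * q) = 0" by blast
    have "D2 u \<noteq> 0"
    proof
      assume "D2 u = 0"
      then have "degree u - 2 = 0" using degree_higher_pderiv[of 2 u] by simp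
      then show False using trial_space_eq_0[OF n u(1)] u(2) by simp
    qed
    moreover have "degree (D2 u) \<le> n - 2 \<and> jint 0 0 (D2 u) = 0 \<and> jint 0 0 ([:0, 1:] * D2 u) = 0"
      using trial_space_D2_iff[of n "D2 u"] n u(1) by auto
    moreover have "D4 u = D2 (D2 u)" by (simp add: eval_nat_numeral)
    ultimately show ?rhs using u(3) by metis
  next
    assume ?rhs
    then obtain w where w: "w \<noteq> 0" "degree w \<le> n - 2 \<and> jint 0 0 w = 0 \<and> jint 0 0 ([:0, 1:] * w) = 0"
      "\<forall>q. degree q \<le> n - 4 \<longrightarrow> jint a a ((w - smult \<mu> (D2 w)) * q) = 0" by blast
    obtain u where u: "u \<in> trial_space n" "D2 u = w" using trial_space_D2_iff[of n w] n w(2) by auto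
    have "D4 u = D2 w" unfolding u(2)[symmetric] by (simp add: eval_nat_numeral)
    moreover have "u \<noteq> 0" using u(2) w(1) by (auto simp: numeral_2_eq_2)
    ultimately show ?lhs using u w(3) by metis
  qed
  also have "\<dots> \<longleftrightarrow> (\<exists>w :: complex poly. w \<noteq> 0 \<and> degree w \<le> n - 2 \<and> jint 0 0 w = 0 \<and> jint 0 0 ([:0, 1:] * w) = 0
      \<and> (\<exists>\<tau> \<sigma>. w = smult \<tau> (?R e) + smult \<sigma> (?R k)))"
  proof (rule ex_cong1, intro conj_cong refl)
    fix w :: "complex poly" assume dw: "degree w \<le> n - 2"
    have "degree (w - smult \<mu> (D2 w)) \<le> n - 2"
    proof (rule degree_diff_le[OF dw])
      have "degree (smult \<mu> (D2 w)) \<le> degree (D2 w)" by (rule degree_smult_le)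
      also have "\<dots> = degree w - 2" by (rule degree_higher_pderiv)
      finally show "degree (smult \<mu> (D2 w)) \<le> n - 2" using dw by simp
    qed
    have swap: "(\<exists>\<tau> \<sigma>. v = smult \<tau> f + smult \<sigma> g) \<longleftrightarrow> (\<exists>\<tau> \<sigma>. v = smult \<tau> g + smult \<sigma> f)"
      for v f g :: "complex poly" by (metis add.commute)
    note orthogonal_expansion[OF a(2) n \<open>degree (w - smult \<mu> (D2 w)) \<le> n - 2\<close>]
    also have "(\<exists>\<tau> \<sigma>. w - smult \<mu> (D2 w) = smult \<tau> (?G (n - 2)) + smult \<sigma> (?G (n - 3)))
       \<longleftrightarrow> (\<exists>\<tau> \<sigma>. w - smult \<mu> (D2 w) = smult \<tau> (?G e) + smult \<sigma> (?G k))"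
      using ek swap by blast
    also have "\<dots> \<longleftrightarrow> (\<exists>\<tau> \<sigma>. w = smult \<tau> (?R e) + smult \<sigma> (?R k))"
      using resolvent2_unique[of w \<mu>] resolvent2_eq[of \<mu>] resolvent2_linear by metis
    finally show "(\<forall>q. degree q \<le> n - 4 \<longrightarrow> jint a a ((w - smult \<mu> (D2 w)) * q) = 0)
       \<longleftrightarrow> (\<exists>\<tau> \<sigma>. w = smult \<tau> (?R e) + smult \<sigma> (?R k))" .
  qed
  also have "\<dots> \<longleftrightarrow> jint 0 0 (?R e) = 0 \<or> jint 0 0 ([:0, 1:] * ?R k) = 0"
  proof
    assume "\<exists>w :: complex poly. w \<noteq> 0 \<and> degree w \<le> n - 2 \<and> jint 0 0 w = 0 \<and> jint 0 0 ([:0, 1:] * w) = 0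
      \<and> (\<exists>\<tau> \<sigma>. w = smult \<tau> (?R e) + smult \<sigma> (?R k))"
    then obtain w \<tau> \<sigma> where w: "w \<noteq> 0" "jint 0 0 w = 0" "jint 0 0 ([:0, 1:] * w) = 0"
      "w = smult \<tau> (?R e) + smult \<sigma> (?R k)" by blast
    have "\<tau> * jint 0 0 (?R e) = 0" "\<sigma> * jint 0 0 ([:0, 1:] * ?R k) = 0"
      using w(2,3) unfolding w(4) lin linx cross by simp_all
    moreover have "\<tau> \<noteq> 0 \<or> \<sigma> \<noteq> 0" using w(1,4) by auto
    ultimately show "jint 0 0 (?R e) = 0 \<or> jint 0 0 ([:0, 1:] * ?R k) = 0" by auto
  next
    assume "jint 0 0 (?R e) = 0 \<or> jint 0 0 ([:0, 1:] * ?R k) = 0"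
    then show "\<exists>w :: complex poly. w \<noteq> 0 \<and> degree w \<le> n - 2 \<and> jint 0 0 w = 0 \<and> jint 0 0 ([:0, 1:] * w) = 0
      \<and> (\<exists>\<tau> \<sigma>. w = smult \<tau> (?R e) + smult \<sigma> (?R k))"
    proof
      assume "jint 0 0 (?R e) = 0"
      moreover have "?R e = smult 1 (?R e) + smult 0 (?R k)" by simp
      ultimately show ?thesis using R0[of e] dR[OF e] cross by blast
    next
      assume "jint 0 0 ([:0, 1:] * ?R k) = 0"
      moreover have "?R k = smult 0 (?R e) + smult 1 (?R k)" by simp
      ultimately show ?thesis using R0[of k] dR[OF k] cross by blast
    qed
  qed
  finally show ?thesis .
qed

text \<open>
  For \<open>l = 0\<close> the fourth derivative itself is orthogonal to its own degree range and vanishes, and a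
  cubic polynomial with the boundary conditions is zero.
\<close>

lemma eigenvalue_nonzero:
  assumes a: "a = \<gamma> + real s - 1/2" "a > -1" and n: "n \<ge> 4" and ev: "eigenvalue n \<gamma> s l"
  shows "l \<noteq> 0"
proof
  assume l: "l = 0"
  obtain u where u: "u \<in> trial_space n" "u \<noteq> 0"
    "\<forall>v \<in> test_space n s. weighted_integral \<gamma> (smult l (D2 u) - D4 u) v = 0"
    using ev unfolding eigenvalue_def by blast
  have "\<forall>q. degree q \<le> n - 4 \<longrightarrow> jint a a ((- D4 u) * q) = 0"
    using u(3) test_space_orthogonality[of \<gamma> s n] a unfolding l by simp
  moreover have "degree (- D4 u) \<le> n - 4"
    using u(1) degree_higher_pderiv[of 4 u] by (simp add: trial_space_def diff_le_mono)
  ultimately have "- D4 u = 0" using orthogonal_imp_eq_0[OF a(2)] by blast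
  then have "degree u - 4 = 0" using degree_higher_pderiv[of 4 u] by simp
  then have "degree u \<le> 4" by simp
  moreover have "degree u \<noteq> 4"
  proof
    assume d: "degree u = 4"
    have "D4 u = 0" using \<open>- D4 u = 0\<close> by simp
    then have "poly (D4 u) 0 = 0" by simp
    then have "coeff u 4 = 0" unfolding poly_higher_pderiv tcoeff_def by simp
    then show False using d u(2) by (metis leading_coeff_0_iff)
  qed
  ultimately show False using trial_space_eq_0[OF n u(1)] u(2) by simp
qed

lemma eigenvalue_iff_reciprocal:
  assumes "\<gamma> + real s > -1/2" "l \<noteq> 0"
  shows "eigenvalue n \<gamma> s l \<longleftrightarrow> reciprocal_eigenvalue n \<gamma> s (1 / l)"
proof -
  have "smult l (D2 u) - D4 u = smult l (D2 u - smult (1 / l) (D4 u))" for u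
    using assms(2) by (simp add: smult_diff_right)
  moreover have "jint (\<gamma> + real s - 1/2) (\<gamma> + real s - 1/2) (smult l f * q) = 0
     \<longleftrightarrow> jint (\<gamma> + real s - 1/2) (\<gamma> + real s - 1/2) (f * q) = 0" for f q
    using assms by (simp add: jint_smult)
  ultimately show ?thesis
    unfolding eigenvalue_def reciprocal_eigenvalue_def test_space_orthogonality[OF assms(1)] by simp
qed

section \<open>Moment polynomials and the characteristic polynomial\<close>

text \<open>
  Coefficients, relative to the value of the Gegenbauer polynomial at \<open>1\<close>, of the unweighted integral
  of its resolvent. The one of index \<open>0\<close> does not follow the pattern of the others in general; it does when
  expressed through the jets for \<open>\<alpha> - 1\<close>.
\<close>

definition even_moment :: "nat \<Rightarrow> real \<Rightarrow> nat \<Rightarrow> real" where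
  "even_moment N \<alpha> k = (if k = 0 then 4 * \<alpha> / ((real N + 1) * (real N + 2 * \<alpha>))
     else 2 * jet (real N) (real N + 2 * \<alpha> + 1) \<alpha> (2 * k - 1))"

text \<open>
  The analogous coefficients for the integral against \<open>x\<close>.
\<close>

definition odd_moment :: "nat \<Rightarrow> real \<Rightarrow> nat \<Rightarrow> real" where
  "odd_moment N \<alpha> k = (if k = 0 then 4 * \<alpha> / ((real N + 2) * (real N + 2 * \<alpha> - 1))
     else 2 * (jet (real N) (real N + 2 * \<alpha> + 1) \<alpha> (2 * k - 1) - jet (real N) (real N + 2 * \<alpha> + 1) \<alpha> (2 * k - 2)))"

lemma jint_resolvent2_jacobi_even:
  assumes \<alpha>: "\<alpha> \<ge> -1/2" and N: "even N" "N > 0" "real N + 2 * \<alpha> \<noteq> 0"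
  shows "jint 0 0 (resolvent2 \<mu> (jacobi N \<alpha> \<alpha>)) = poly (jacobi N \<alpha> \<alpha>) 1 * poly (poly_upto (even_moment N \<alpha>) N) \<mu>"
proof -
  let ?G = "jacobi N \<alpha> \<alpha>"
  have a1: "\<alpha> > -1" using \<alpha> by simp
  have ode: "jacobi_ode (real N) \<alpha> \<alpha> ?G" by (rule jacobi_jacobi_ode) (use \<alpha> in auto)
  note par = has_parity_jacobi[OF ode a1]
  have mom: "jint 0 0 ((pderiv ^^ (2 * k)) ?G) = poly ?G 1 * of_real (even_moment N \<alpha> k)" for k
  proof (cases "k = 0")
    case True
    have "(real N + 1) * (real N + 2 * \<alpha>) \<noteq> 0" using N by simp
    then have "jint 0 0 ?G = of_real (4 * \<alpha>) * poly ?G 1 / of_real ((real N + 1) * (real N + 2 * \<alpha>))"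
      using jint_jacobi_even[OF ode par N(1) a1] by (metis nonzero_mult_div_cancel_left of_real_eq_0_iff)
    then show ?thesis using True by (simp add: even_moment_def)
  next
    case False
    have s: "real N + \<alpha> + \<alpha> + 1 = real N + 2 * \<alpha> + 1" by simp
    show ?thesis
      using False unfolding jint_higher_pderiv_even[OF par N(1) False[unfolded neq0_conv]]
        higher_pderiv_jacobi_ode_1[OF ode a1] s by (simp add: even_moment_def)
  qed
  have "jint 0 0 (resolvent2 \<mu> ?G) = (\<Sum>k\<le>N. \<mu> ^ k * jint 0 0 ((pderiv ^^ (2 * k)) ?G))"
    by (simp add: resolvent2_def degree_jacobi jint_sum jint_smult)
  also have "\<dots> = poly ?G 1 * poly (poly_upto (even_moment N \<alpha>) N) \<mu>"
    unfolding mom poly_upto_def poly_sum poly_monom sum_distrib_left by (rule sum.cong) simp_all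
  finally show ?thesis .
qed

lemma jint_resolvent2_jacobi_odd:
  assumes \<alpha>: "\<alpha> \<ge> -1/2" and N: "odd N" "real N + 2 * \<alpha> - 1 \<noteq> 0"
  shows "jint 0 0 ([:0, 1:] * resolvent2 \<mu> (jacobi N \<alpha> \<alpha>)) = poly (jacobi N \<alpha> \<alpha>) 1 * poly (poly_upto (odd_moment N \<alpha>) N) \<mu>"
proof -
  let ?G = "jacobi N \<alpha> \<alpha>"
  have a1: "\<alpha> > -1" using \<alpha> by simp
  have ode: "jacobi_ode (real N) \<alpha> \<alpha> ?G" by (rule jacobi_jacobi_ode) (use \<alpha> in auto)
  note par = has_parity_jacobi[OF ode a1]
  have mom: "jint 0 0 ([:0, 1:] * (pderiv ^^ (2 * k)) ?G) = poly ?G 1 * of_real (odd_moment N \<alpha> k)" for k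
  proof (cases "k = 0")
    case True
    have "(real N + 2) * (real N + 2 * \<alpha> - 1) \<noteq> 0" using N by simp
    then have "jint 0 0 ([:0, 1:] * ?G) = of_real (4 * \<alpha>) * poly ?G 1 / of_real ((real N + 2) * (real N + 2 * \<alpha> - 1))"
      using jint_jacobi_odd[OF ode par N(1) a1] by (metis nonzero_mult_div_cancel_left of_real_eq_0_iff)
    then show ?thesis using True by (simp add: odd_moment_def)
  next
    case False
    have s: "real N + \<alpha> + \<alpha> + 1 = real N + 2 * \<alpha> + 1" by simp
    show ?thesis
      using False unfolding jint_higher_pderiv_odd[OF par N(1) False[unfolded neq0_conv]]
        higher_pderiv_jacobi_ode_1[OF ode a1] s by (simp add: odd_moment_def algebra_simps)
  qed
  have "jint 0 0 ([:0, 1:] * resolvent2 \<mu> ?G) = (\<Sum>k\<le>N. \<mu> ^ k * jint 0 0 ([:0, 1:] * (pderiv ^^ (2 * k)) ?G))"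
    unfolding resolvent2_def degree_jacobi sum_distrib_left mult_smult_right by (simp add: jint_sum jint_smult del: mult_pCons_left)
  also have "\<dots> = poly ?G 1 * poly (poly_upto (odd_moment N \<alpha>) N) \<mu>"
    unfolding mom poly_upto_def poly_sum poly_monom sum_distrib_left by (rule sum.cong) simp_all
  finally show ?thesis .
qed

text \<open>
  Raising \<open>\<sigma>\<close> and the exponent while lowering the degree amounts to differentiating once.
\<close>

lemma jet_index_shift:
  assumes "a > -1"
  shows "jet (N + 1) \<sigma> a 1 * jet N (\<sigma> + 1) (a + 1) j = jet (N + 1) \<sigma> a (Suc j)"
proof (induction j)
  case (Suc j)
  have "jet (N + 1) \<sigma> a 1 * jet N (\<sigma> + 1) (a + 1) (Suc j)
    = (jet (N + 1) \<sigma> a 1 * jet N (\<sigma> + 1) (a + 1) j) * ((N - real j) * (\<sigma> + 1 + real j) / (2 * (a + 1 + 1 + real j)))"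
    by (simp only: jet_Suc mult.assoc)
  also have "\<dots> = jet (N + 1) \<sigma> a (Suc (Suc j))"
    unfolding Suc.IH jet_Suc[of _ _ _ "Suc j"] by (simp add: algebra_simps)
  finally show ?case .
qed simp

lemma coeff_even_jet_poly:
  "coeff (even_jet_poly m a) k = of_real (jet (real (2 * m + 1)) (2 * real m + 2 * a) a (2 * k))"
proof (cases "k \<le> m")
  case False
  then have "2 * m + 1 < 2 * k" by simp
  then have "jet (real (2 * m + 1)) (2 * real m + 2 * a) a (2 * k) = 0" by (rule jet_eq_0)
  then show ?thesis using False by (simp add: even_jet_poly_def coeff_poly_upto)
qed (simp add: even_jet_poly_def coeff_poly_upto)

lemma poly_upto_eq_smultI:
  assumes "\<And>k. k \<le> n \<Longrightarrow> of_real (f k) = c * coeff p k" "\<And>k. k > n \<Longrightarrow> coeff p k = 0"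
  shows "poly_upto f n = smult c p"
  using assms by (simp add: poly_eq_iff coeff_poly_upto)

lemma moment_normal_form: "2 / y * (4 * (p * q * t)) / k = 8 / (y * k) * (p * (q * t))" for p q t y k :: real
  by (simp add: mult_ac)

text \<open>
  After an index shift the moments are the even-indexed jets with \<open>\<sigma>\<close> larger by two than in
  \<open>even_jet_poly m a\<close>, and every unit shift of \<open>\<sigma>\<close> is a linear factor in the index, that is, an
  operator \<open>theta\<close>.
\<close>

lemma moment_poly_even_upper:
  assumes a: "a \<ge> -1/2" and m: "m \<ge> 1"
  obtains c where "c \<noteq> 0"
    "poly_upto (even_moment (2 * m) (a + 1)) (2 * m)
      = smult c (theta (real m + a) (theta (real m + a + 1/2) (even_jet_poly m a)))"
proof
  define \<sigma> Y where "\<sigma> = 2 * real m + 2 * a" and "Y = jet (real (2 * m + 1)) (\<sigma> + 1 + 1) a"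
  have m1: "real m \<ge> 1" using m by simp
  have \<sigma>: "\<sigma> > 0" using a m1 by (simp add: \<sigma>_def)
  have N: "real (2 * m + 1) = real (2 * m) + 1" by simp
  have Y1: "Y 1 = real (2 * m + 1) * (\<sigma> + 2) / (2 * (a + 1))" by (simp add: Y_def jet_def)
  have Y1pos: "Y 1 > 0" unfolding Y1 using \<sigma> a by (intro divide_pos_pos mult_pos_pos) auto
  have mom: "even_moment (2 * m) (a + 1) k = 2 / Y 1 * Y (2 * k)" for k
  proof (cases k)
    case 0
    then show ?thesis using Y1pos \<sigma> a unfolding Y1 by (simp add: even_moment_def Y_def \<sigma>_def field_simps)
  next
    case (Suc j)
    have "jet (real (2 * m)) (real (2 * m) + 2 * (a + 1) + 1) (a + 1) (2 * k - 1)
        = jet (real (2 * m)) (\<sigma> + 1 + 1 + 1) (a + 1) (2 * k - 1)" by (simp add: \<sigma>_def algebra_simps)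
    moreover have "Y 1 * jet (real (2 * m)) (\<sigma> + 1 + 1 + 1) (a + 1) (2 * k - 1) = Y (2 * k)"
      using jet_index_shift[of a "real (2 * m)" "\<sigma> + 1 + 1" "2 * k - 1"] a Suc unfolding Y_def N by simp
    ultimately show ?thesis using Y1pos Suc by (simp add: even_moment_def field_simps)
  qed
  have shift: "Y j * (\<sigma> * (\<sigma> + 1)) = jet (real (2 * m + 1)) \<sigma> a j * ((\<sigma> + real j) * (\<sigma> + 1 + real j))" for j
  proof -
    have "Y j * (\<sigma> * (\<sigma> + 1)) = (Y j * (\<sigma> + 1)) * \<sigma>" by simp
    also have "\<dots> = (jet (real (2 * m + 1)) (\<sigma> + 1) a j * \<sigma>) * (\<sigma> + 1 + real j)"
      unfolding Y_def jet_shift_sigma[of _ "\<sigma> + 1"] by simp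
    also have "\<dots> = jet (real (2 * m + 1)) \<sigma> a j * ((\<sigma> + real j) * (\<sigma> + 1 + real j))"
      unfolding jet_shift_sigma by simp
    finally show ?thesis .
  qed
  let ?c = "8 / (Y 1 * (\<sigma> * (\<sigma> + 1)))"
  show "complex_of_real ?c \<noteq> 0" unfolding of_real_eq_0_iff using Y1pos \<sigma> by simp
  show "poly_upto (even_moment (2 * m) (a + 1)) (2 * m)
      = smult (of_real ?c) (theta (real m + a) (theta (real m + a + 1/2) (even_jet_poly m a)))"
  proof (rule poly_upto_eq_smultI)
    fix k
    have "(\<sigma> + real (2 * k)) * (\<sigma> + 1 + real (2 * k)) = 4 * ((real m + a + real k) * (real m + a + 1/2 + real k))"
      by (simp add: \<sigma>_def field_simps)
    then have sk: "Y (2 * k) * (\<sigma> * (\<sigma> + 1)) = 4 * ((real m + a + real k) * (real m + a + 1/2 + real k) * jet (real (2 * m + 1)) \<sigma> a (2 * k))"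
      unfolding shift by simp
    have "even_moment (2 * m) (a + 1) k = 2 / Y 1 * (Y (2 * k) * (\<sigma> * (\<sigma> + 1))) / (\<sigma> * (\<sigma> + 1))"
      unfolding mom using \<sigma> by simp
    also have "\<dots> = ?c * ((real m + a + real k) * ((real m + a + 1/2 + real k) * jet (real (2 * m + 1)) \<sigma> a (2 * k)))"
      unfolding sk by (rule moment_normal_form)
    finally show "of_real (even_moment (2 * m) (a + 1) k)
        = complex_of_real ?c * coeff (theta (real m + a) (theta (real m + a + 1/2) (even_jet_poly m a))) k"
      unfolding coeff_theta coeff_even_jet_poly \<sigma>_def[symmetric] by simp
  next
    fix k assume "k > 2 * m"
    then have "degree (even_jet_poly m a) < k" using degree_even_jet_poly[of m a] by linarith
    then show "coeff (theta (real m + a) (theta (real m + a + 1/2) (even_jet_poly m a))) k = 0"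
      by (simp add: coeff_theta coeff_eq_0)
  qed
qed

text \<open>
  The same computation with the degree lowered by two instead, which again costs two linear factors.
\<close>

lemma moment_poly_even_lower:
  assumes a: "a \<ge> -1/2" and m: "m \<ge> 2"
  obtains c where "c \<noteq> 0"
    "poly_upto (even_moment (2 * m - 2) (a + 1)) (2 * m - 2)
      = smult c (theta (- real m - 1/2) (theta (- real m) (even_jet_poly m a)))"
proof
  define \<sigma> Y where "\<sigma> = 2 * real m + 2 * a" and "Y = jet (2 * real m - 1) \<sigma> a"
  have m1: "real m \<ge> 2" using m by simp
  have \<sigma>: "\<sigma> > 0" using a m1 by (simp add: \<sigma>_def)
  have N: "real (2 * m - 2) = 2 * real m - 2" using m by simp
  have Y1: "Y 1 = (2 * real m - 1) * \<sigma> / (2 * (a + 1))" by (simp add: Y_def jet_def)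
  have Y1pos: "Y 1 > 0" unfolding Y1 using \<sigma> a m1 by (intro divide_pos_pos mult_pos_pos) auto
  have mom: "even_moment (2 * m - 2) (a + 1) k = 2 / Y 1 * Y (2 * k)" for k
  proof (cases k)
    case 0
    have "2 * real m - 1 > 0" using m1 by simp
    then show ?thesis using 0 \<sigma> a unfolding Y1 even_moment_def N by (simp add: Y_def \<sigma>_def field_simps)
  next
    case (Suc j)
    have "jet (real (2 * m - 2)) (real (2 * m - 2) + 2 * (a + 1) + 1) (a + 1) (2 * k - 1)
        = jet (2 * real m - 2) (\<sigma> + 1) (a + 1) (2 * k - 1)" unfolding N by (simp add: \<sigma>_def algebra_simps)
    moreover have "Y 1 * jet (2 * real m - 2) (\<sigma> + 1) (a + 1) (2 * k - 1) = Y (2 * k)"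
      using jet_index_shift[of a "2 * real m - 2" "\<sigma>" "2 * k - 1"] a Suc unfolding Y_def by simp
    ultimately show ?thesis using Y1pos Suc by (simp add: even_moment_def field_simps)
  qed
  have shift: "Y j * (2 * real m * (2 * real m + 1)) = jet (real (2 * m + 1)) \<sigma> a j * ((2 * real m + 1 - real j) * (2 * real m - real j))" for j
  proof -
    have *: "Y j * (2 * real m) = jet (2 * real m) \<sigma> a j * (2 * real m - real j)"
      using jet_shift_degree[of "2 * real m - 1" \<sigma> a j] by (simp add: Y_def)
    have "Y j * (2 * real m * (2 * real m + 1)) = (Y j * (2 * real m)) * (2 * real m + 1)" by simp
    also have "\<dots> = (jet (2 * real m) \<sigma> a j * (2 * real m + 1)) * (2 * real m - real j)"
      unfolding * by simp
    also have "\<dots> = jet (2 * real m + 1) \<sigma> a j * ((2 * real m + 1 - real j) * (2 * real m - real j))"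
      unfolding jet_shift_degree by simp
    finally show ?thesis by (simp add: add.commute)
  qed
  let ?c = "8 / (Y 1 * (2 * real m * (2 * real m + 1)))"
  show "complex_of_real ?c \<noteq> 0" unfolding of_real_eq_0_iff using Y1pos m1 by simp
  show "poly_upto (even_moment (2 * m - 2) (a + 1)) (2 * m - 2)
      = smult (of_real ?c) (theta (- real m - 1/2) (theta (- real m) (even_jet_poly m a)))"
  proof (rule poly_upto_eq_smultI)
    fix k
    have "(2 * real m + 1 - real (2 * k)) * (2 * real m - real (2 * k)) = 4 * ((- real m - 1/2 + real k) * (- real m + real k))"
      by (simp add: field_simps)
    then have sk: "Y (2 * k) * (2 * real m * (2 * real m + 1)) = 4 * ((- real m - 1/2 + real k) * (- real m + real k) * jet (real (2 * m + 1)) \<sigma> a (2 * k))"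
      unfolding shift by simp
    have "even_moment (2 * m - 2) (a + 1) k
       = 2 / Y 1 * (Y (2 * k) * (2 * real m * (2 * real m + 1))) / (2 * real m * (2 * real m + 1))"
      unfolding mom by (subst times_divide_eq_right[symmetric], subst nonzero_mult_div_cancel_right) (use m1 in auto)
    also have "\<dots> = ?c * ((- real m - 1/2 + real k) * ((- real m + real k) * jet (real (2 * m + 1)) \<sigma> a (2 * k)))"
      unfolding sk by (rule moment_normal_form)
    finally show "of_real (even_moment (2 * m - 2) (a + 1) k)
        = complex_of_real ?c * coeff (theta (- real m - 1/2) (theta (- real m) (even_jet_poly m a))) k"
      unfolding coeff_theta coeff_even_jet_poly \<sigma>_def[symmetric] by simp
  next
    fix k assume "k > 2 * m - 2"
    then have "k \<ge> m" using m by linarith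
    then have "k = m \<or> degree (even_jet_poly m a) < k" using degree_even_jet_poly[of m a] by linarith
    then show "coeff (theta (- real m - 1/2) (theta (- real m) (even_jet_poly m a))) k = 0"
      by (auto simp: coeff_theta coeff_eq_0)
  qed
qed

text \<open>
  Here \<open>\<sigma>\<close> and the degree are each shifted once. The difference of consecutive jets
  telescopes by their two-term recurrence into a single jet with two linear factors.
\<close>

lemma moment_poly_odd:
  assumes a: "a \<ge> -1/2" and m: "m \<ge> 1"
  obtains c where "c \<noteq> 0"
    "poly_upto (odd_moment (2 * m - 1) (a + 1)) (2 * m - 1)
      = smult c (theta (real m + a + 1/2) (theta (- real m) (even_jet_poly m a)))"
proof
  define \<sigma> E Z where "\<sigma> = 2 * real m + 2 * a" and "E = jet (2 * real m + 1) \<sigma> a" and "Z = jet (2 * real m) (\<sigma> + 1) a"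
  have m1: "real m \<ge> 1" using m by simp
  have \<sigma>: "\<sigma> > 0" using a m1 by (simp add: \<sigma>_def)
  have N: "real (2 * m - 1) = 2 * real m - 1" using m by simp
  have Z1: "Z 1 = (2 * real m) * (\<sigma> + 1) / (2 * (a + 1))" by (simp add: Z_def jet_def)
  have Z1pos: "Z 1 > 0" unfolding Z1 using \<sigma> a m1 by (intro divide_pos_pos mult_pos_pos) auto
  have EZ: "Z j * (\<sigma> * (2 * real m + 1)) = E j * ((\<sigma> + real j) * (2 * real m + 1 - real j))" for j
  proof -
    have "Z j * (\<sigma> * (2 * real m + 1)) = (jet (2 * real m) (\<sigma> + 1) a j * \<sigma>) * (2 * real m + 1)" by (simp add: Z_def)
    also have "\<dots> = (jet (2 * real m) \<sigma> a j * (2 * real m + 1)) * (\<sigma> + real j)"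
      unfolding jet_shift_sigma by simp
    also have "\<dots> = E j * ((\<sigma> + real j) * (2 * real m + 1 - real j))"
      unfolding jet_shift_degree E_def by simp
    finally show ?thesis .
  qed
  have diff: "(Z (Suc i) - Z i) * (\<sigma> * (2 * real m + 1)) = E (Suc i) * ((2 * real m - real (Suc i)) * (\<sigma> + 1 + real (Suc i)))" for i
  proof -
    have "2 * (a + 1 + real i) \<noteq> 0" using a by auto
    then have "E i * ((\<sigma> + real i) * (2 * real m + 1 - real i)) = E (Suc i) * (2 * (a + 1 + real i))"
      unfolding E_def jet_Suc by (simp add: field_simps)
    then have "(Z (Suc i) - Z i) * (\<sigma> * (2 * real m + 1))
       = E (Suc i) * ((\<sigma> + real (Suc i)) * (2 * real m + 1 - real (Suc i)) - 2 * (a + 1 + real i))"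
      unfolding left_diff_distrib EZ by (simp add: right_diff_distrib)
    also have "(\<sigma> + real (Suc i)) * (2 * real m + 1 - real (Suc i)) - 2 * (a + 1 + real i)
       = (2 * real m - real (Suc i)) * (\<sigma> + 1 + real (Suc i))"
      by (simp add: \<sigma>_def algebra_simps)
    finally show ?thesis .
  qed
  let ?K = "\<sigma> * (2 * real m + 1)"
  have K: "?K > 0" using \<sigma> m1 by simp
  have mom: "odd_moment (2 * m - 1) (a + 1) k * ?K = 2 / Z 1 * (E (2 * k) * ((2 * real m - 2 * real k) * (\<sigma> + 1 + 2 * real k)))" for k
  proof (cases k)
    case 0
    have "(real (2 * m - 1) + 2) * (real (2 * m - 1) + 2 * (a + 1) - 1) = ?K"
      unfolding N \<sigma>_def by (simp add: algebra_simps)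
    then have "odd_moment (2 * m - 1) (a + 1) k = 4 * (a + 1) / ?K" using 0 by (simp add: odd_moment_def)
    then have "odd_moment (2 * m - 1) (a + 1) k * ?K = 4 * (a + 1)" using K \<sigma> by simp
    also have "\<dots> = 2 / Z 1 * (2 * real m * (\<sigma> + 1))"
    proof -
      have "4 * c = 2 / (w / (2 * c)) * w" if "w \<noteq> 0" for c w :: real using that by simp
      moreover have "2 * real m * (\<sigma> + 1) \<noteq> 0" using \<sigma> m1 by simp
      ultimately show ?thesis unfolding Z1 by blast
    qed
    finally show ?thesis using 0 by (simp add: E_def)
  next
    case (Suc j)
    have s: "real (2 * m - 1) + 2 * (a + 1) + 1 = \<sigma> + 1 + 1" unfolding N \<sigma>_def by simp
    have sh: "jet (2 * real m - 1) (\<sigma> + 1 + 1) (a + 1) i = Z (Suc i) / Z 1" for i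
      using jet_index_shift[of a "2 * real m - 1" "\<sigma> + 1" i] a Z1pos by (simp add: Z_def field_simps)
    have i: "Suc (2 * k - 1) = 2 * k" "Suc (2 * k - 2) = 2 * k - 1" using Suc by auto
    have "odd_moment (2 * m - 1) (a + 1) k = 2 / Z 1 * (Z (Suc (2 * k - 1)) - Z (2 * k - 1))"
      using Suc unfolding odd_moment_def s unfolding N sh i by (simp add: diff_divide_distrib right_diff_distrib)
    then have "odd_moment (2 * m - 1) (a + 1) k * ?K = 2 / Z 1 * ((Z (Suc (2 * k - 1)) - Z (2 * k - 1)) * ?K)" by simp
    then show ?thesis unfolding diff unfolding i by simp
  qed
  let ?c = "- 8 / (Z 1 * ?K)"
  show "complex_of_real ?c \<noteq> 0" unfolding of_real_eq_0_iff using Z1pos K \<sigma> by simp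
  show "poly_upto (odd_moment (2 * m - 1) (a + 1)) (2 * m - 1)
      = smult (of_real ?c) (theta (real m + a + 1/2) (theta (- real m) (even_jet_poly m a)))"
  proof (rule poly_upto_eq_smultI)
    fix k
    have "odd_moment (2 * m - 1) (a + 1) k = odd_moment (2 * m - 1) (a + 1) k * ?K / ?K" using K \<sigma> by simp
    also have "\<dots> = ?c * ((real m + a + 1/2 + real k) * ((- real m + real k) * E (2 * k)))"
    proof -
      have "(2 * real m - 2 * real k) * (\<sigma> + 1 + 2 * real k) = 4 * (- (real m + a + 1/2 + real k) * (- real m + real k))"
        by (simp add: \<sigma>_def field_simps)
      then have "E (2 * k) * ((2 * real m - 2 * real k) * (\<sigma> + 1 + 2 * real k))
          = 4 * (- (real m + a + 1/2 + real k) * (- real m + real k) * E (2 * k))" by simp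
      then show ?thesis unfolding mom
        using moment_normal_form[of "Z 1" "- (real m + a + 1/2 + real k)" "- real m + real k" "E (2 * k)" ?K]
        by (simp only: mult_minus_left mult_minus_right minus_divide_left[symmetric])
    qed
    finally show "of_real (odd_moment (2 * m - 1) (a + 1) k)
        = complex_of_real ?c * coeff (theta (real m + a + 1/2) (theta (- real m) (even_jet_poly m a))) k"
      unfolding coeff_theta coeff_even_jet_poly by (simp add: E_def \<sigma>_def add.commute)
  next
    fix k assume "k > 2 * m - 1"
    then have "k \<ge> m" using m by linarith
    then have "k = m \<or> degree (even_jet_poly m a) < k" using degree_even_jet_poly[of m a] by linarith
    then show "coeff (theta (real m + a + 1/2) (theta (- real m) (even_jet_poly m a))) k = 0"
      by (auto simp: coeff_theta coeff_eq_0)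
  qed
qed

lemma theta_commute: "theta s (theta t p) = theta t (theta s p)"
  by (rule poly_eqI) (simp add: coeff_theta mult.left_commute)

lemma simple_negative_roots_mult:
  assumes p: "simple_negative_roots p" and q: "simple_negative_roots q"
    and no: "\<And>z. poly p z = 0 \<Longrightarrow> poly q z \<noteq> 0"
  shows "simple_negative_roots (p * q)"
  unfolding simple_negative_roots_def
proof (intro conjI allI impI)
  show "p * q \<noteq> 0" using p q by (simp add: simple_negative_roots_def)
  fix z assume z: "poly (p * q) z = 0"
  then consider "poly p z = 0" "poly q z \<noteq> 0" | "poly q z = 0" "poly p z \<noteq> 0" using no by auto
  then have "z \<in> \<real> \<and> Re z < 0 \<and> poly (pderiv (p * q)) z \<noteq> 0"
  proof cases
    case 1
    then show ?thesis using p by (simp add: simple_negative_roots_def pderiv_mult)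
  next
    case 2
    then show ?thesis using q by (simp add: simple_negative_roots_def pderiv_mult)
  qed
  then show "z \<in> \<real>" "Re z < 0" "poly (pderiv (p * q)) z \<noteq> 0" by simp_all
qed

lemma card_simple_roots:
  assumes "simple_negative_roots p"
  shows "card {z. poly p z = 0} = degree p"
proof -
  have p0: "p \<noteq> 0" and sq: "rsquarefree p"
    using assms by (auto simp: simple_negative_roots_def rsquarefree_roots)
  have "(\<Sum>z | poly p z = 0. order z p) = (\<Sum>z | poly p z = 0. 1)"
    by (rule sum.cong) (use rsquarefree_root_order[OF sq _ p0] in auto)
  then show ?thesis using sum_order_roots[OF p0] by simp
qed

lemma coeff_even_jet_poly_nonzero: "a \<ge> -1/2 \<Longrightarrow> m \<ge> 1 \<Longrightarrow> k \<le> m \<Longrightarrow> coeff (even_jet_poly m a) k \<noteq> 0"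
proof -
  assume a: "a \<ge> -1/2" and m: "m \<ge> 1" and k: "k \<le> m"
  have m1: "real m \<ge> 1" using m by simp
  have "real (2 * k) \<le> real (2 * m + 1)" using k by simp
  then have "jet (real (2 * m + 1)) (2 * real m + 2 * a) a (2 * k) > 0"
    by (intro jet_pos) (use a m1 in auto)
  then show ?thesis unfolding coeff_even_jet_poly by simp
qed

lemma degree_eq_if_coeff:
  assumes "coeff p d \<noteq> 0" "\<And>k. k > d \<Longrightarrow> coeff p k = 0"
  shows "degree p = d"
  using assms by (meson degree_le le_antisym le_degree)

text \<open>
  The product of the even and the odd moment polynomial. Both arise from \<open>even_jet_poly m a\<close> by two
  operators \<open>theta\<close>, one of which they share, so that a common root would be a common root of two
  different operators applied to a polynomial with simple roots. In the product \<open>C\<close> the factor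
  with \<open>- m\<close> kills the coefficient of index \<open>m\<close>, which fixes the degree count \<open>n - 3\<close>.
\<close>

lemma characteristic_polynomial:
  assumes a: "a \<in> {-1/2, 0, 1/2, 1}" "a = \<gamma> + real s - 3/2" and n: "n \<ge> 4"
  obtains P where "simple_negative_roots P" "degree P = n - 3"
    "\<And>\<mu>. reciprocal_eigenvalue n \<gamma> s \<mu> \<longleftrightarrow> poly P \<mu> = 0"
proof -
  \<comment> \<open>the odd one of the two Gegenbauer polynomials has degree 2 * m - 1 for either parity of n\<close>
  define m where "m = (n - 1) div 2"
  have m: "m \<ge> 1" using n by (simp add: m_def)
  have m1: "real m \<ge> 1" using m by simp
  have ah: "a \<ge> -1/2" using a by auto
  let ?E = "even_jet_poly m a"
  define C where "C = theta (real m + a + 1/2) (theta (- real m) ?E)"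
  have E: "simple_negative_roots ?E" by (rule even_jet_poly_simple_negative_roots[OF a(1) m])
  have dE: "real (degree ?E) \<le> - (- real m)" using degree_even_jet_poly[of m a] by simp
  have coeff0: "coeff ?E k = 0" if "k > m" for k
    using degree_even_jet_poly[of m a] that by (intro coeff_eq_0) simp
  have E1: "simple_negative_roots (theta (- real m) ?E)"
    by (rule simple_negative_roots_theta[OF E]) (use dE m1 in simp)
  have C: "simple_negative_roots C"
    unfolding C_def by (rule simple_negative_roots_theta[OF E1]) (use m1 ah in simp)
  have dC: "degree C = m - 1"
  proof (rule degree_eq_if_coeff)
    have "real m + a + 1/2 + real (m - 1) > 0" "- real m + real (m - 1) = -1" using m m1 ah by (auto simp: of_nat_diff)
    then show "coeff C (m - 1) \<noteq> 0"
      using coeff_even_jet_poly_nonzero[OF ah m, of "m - 1"] unfolding C_def coeff_theta by (simp del: of_real_add of_real_diff)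
    fix k assume "k > m - 1"
    then have "k = m \<or> k > m" by linarith
    then show "coeff C k = 0" unfolding C_def coeff_theta using coeff0[of k] by auto
  qed
  have \<alpha>: "a + 1 = \<gamma> + real s - 1/2" "a + 1 \<ge> -1/2" "a + 1 > -1" using a(2) ah by auto
  have G1: "poly (jacobi N (a + 1) (a + 1)) 1 \<noteq> 0" for N
    by (rule poly_jacobi_1_nonzero[OF jacobi_jacobi_ode \<alpha>(3)]) (use ah in auto)
  obtain cC where cC: "cC \<noteq> 0" "poly_upto (odd_moment (2 * m - 1) (a + 1)) (2 * m - 1) = smult cC C"
    unfolding C_def by (rule moment_poly_odd[OF ah m])
  have "real (2 * m - 1) = 2 * real m - 1" using m by (simp add: of_nat_diff)
  then have oddN: "odd (2 * m - 1)" "real (2 * m - 1) + 2 * (a + 1) - 1 \<noteq> 0" using m m1 ah by auto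
  have iffC: "jint 0 0 ([:0, 1:] * resolvent2 \<mu> (jacobi (2 * m - 1) (a + 1) (a + 1))) = 0 \<longleftrightarrow> poly C \<mu> = 0" for \<mu>
    unfolding jint_resolvent2_jacobi_odd[OF \<alpha>(2) oddN] cC(2) using G1 cC(1) by simp
  show ?thesis
  proof (cases "even n")
    case True
    then have nm: "n - 2 = 2 * m" "n - 3 = 2 * m - 1" using n by (auto simp: m_def elim!: evenE)
    define A where "A = theta (real m + a) (theta (real m + a + 1/2) ?E)"
    have E2: "simple_negative_roots (theta (real m + a + 1/2) ?E)"
      by (rule simple_negative_roots_theta[OF E]) (use m1 ah in simp)
    have A: "simple_negative_roots A"
      unfolding A_def by (rule simple_negative_roots_theta[OF E2]) (use m1 ah in simp)
    have dA: "degree A = m"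
    proof (rule degree_eq_if_coeff)
      have "real m + a + 1/2 + real m > 0" "real m + a + real m > 0" using m1 ah by auto
      then show "coeff A m \<noteq> 0"
        using coeff_even_jet_poly_nonzero[OF ah m, of m] unfolding A_def coeff_theta by (simp del: of_real_add of_real_diff)
    qed (simp add: A_def coeff_theta coeff0)
    obtain cA where cA: "cA \<noteq> 0" "poly_upto (even_moment (2 * m) (a + 1)) (2 * m) = smult cA A"
      unfolding A_def by (rule moment_poly_even_upper[OF ah m])
    have evN: "even (2 * m)" "2 * m > 0" "real (2 * m) + 2 * (a + 1) \<noteq> 0" using m m1 ah by auto
    have iffA: "jint 0 0 (resolvent2 \<mu> (jacobi (2 * m) (a + 1) (a + 1))) = 0 \<longleftrightarrow> poly A \<mu> = 0" for \<mu>
      unfolding jint_resolvent2_jacobi_even[OF \<alpha>(2) evN] cA(2) using G1 cA(1) by simp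
    show ?thesis
    proof (rule that)
      show "simple_negative_roots (A * C)"
      proof (rule simple_negative_roots_mult[OF A C])
        fix z assume z: "poly A z = 0"
        show "poly C z \<noteq> 0"
        proof
          assume "poly C z = 0"
          then have "poly (theta (- real m) (theta (real m + a + 1/2) ?E)) z = 0" unfolding C_def by (subst theta_commute)
          moreover have "real m + a \<noteq> - real m" using m1 ah by auto
          ultimately show False using theta_no_common_root[OF E2] z unfolding A_def by blast
        qed
      qed
      have "A \<noteq> 0" "C \<noteq> 0" using A C by (auto simp: simple_negative_roots_def)
      then show "degree (A * C) = n - 3" using dA dC m nm by (simp add: degree_mult_eq)
      show "reciprocal_eigenvalue n \<gamma> s \<mu> \<longleftrightarrow> poly (A * C) \<mu> = 0" for \<mu>
        using reciprocal_eigenvalue_iff[OF \<alpha>(1,2) n, of "2 * m" "2 * m - 1" \<mu>] oddN(1)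
        unfolding iffA iffC nm by simp
    qed
  next
    case False
    then have nm: "n - 2 = 2 * m - 1" "n - 3 = 2 * m - 2" and m2: "m \<ge> 2" using n by (auto simp: m_def elim!: oddE)
    define A where "A = theta (- real m - 1/2) (theta (- real m) ?E)"
    have "coeff (theta (- real m) ?E) k = 0" if "k > m - 1" for k
    proof -
      have "k = m \<or> k > m" using that by linarith
      then show ?thesis unfolding coeff_theta using coeff0[of k] by auto
    qed
    then have dE1: "degree (theta (- real m) ?E) \<le> m - 1" by (intro degree_le) auto
    have A: "simple_negative_roots A"
      unfolding A_def by (rule simple_negative_roots_theta[OF E1]) (use dE1 in simp)
    have dA: "degree A = m - 1"
    proof (rule degree_eq_if_coeff)
      have "- real m - 1/2 + real (m - 1) = -3/2" "- real m + real (m - 1) = -1" using m by (auto simp: of_nat_diff)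
      then show "coeff A (m - 1) \<noteq> 0"
        using coeff_even_jet_poly_nonzero[OF ah m, of "m - 1"] unfolding A_def coeff_theta by (simp del: of_real_add of_real_diff)
      fix k assume "k > m - 1"
      then have "k = m \<or> k > m" by linarith
      then show "coeff A k = 0" unfolding A_def coeff_theta using coeff0[of k] by auto
    qed
    obtain cA where cA: "cA \<noteq> 0" "poly_upto (even_moment (2 * m - 2) (a + 1)) (2 * m - 2) = smult cA A"
      unfolding A_def by (rule moment_poly_even_lower[OF ah m2])
    have evN: "even (2 * m - 2)" "2 * m - 2 > 0" using m2 by auto
    have "real (2 * m - 2) \<ge> 1" using m2 by linarith
    then have evN': "real (2 * m - 2) + 2 * (a + 1) \<noteq> 0" using ah by auto
    have iffA: "jint 0 0 (resolvent2 \<mu> (jacobi (2 * m - 2) (a + 1) (a + 1))) = 0 \<longleftrightarrow> poly A \<mu> = 0" for \<mu>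
      unfolding jint_resolvent2_jacobi_even[OF \<alpha>(2) evN evN'] cA(2) using G1 cA(1) by simp
    show ?thesis
    proof (rule that)
      show "simple_negative_roots (A * C)"
      proof (rule simple_negative_roots_mult[OF A C])
        fix z assume z: "poly A z = 0"
        show "poly C z \<noteq> 0"
        proof
          assume "poly C z = 0"
          moreover have "- real m - 1/2 \<noteq> real m + a + 1/2" using m1 ah by auto
          ultimately show False using theta_no_common_root[OF E1] z unfolding A_def C_def by blast
        qed
      qed
      have "A \<noteq> 0" "C \<noteq> 0" using A C by (auto simp: simple_negative_roots_def)
      then show "degree (A * C) = n - 3" using dA dC m nm by (simp add: degree_mult_eq)
      show "reciprocal_eigenvalue n \<gamma> s \<mu> \<longleftrightarrow> poly (A * C) \<mu> = 0" for \<mu>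
        using reciprocal_eigenvalue_iff[OF \<alpha>(1,2) n, of "2 * m - 2" "2 * m - 1" \<mu>] oddN(1) evN(1)
        unfolding iffA iffC nm by (simp add: insert_commute)
    qed
  qed
qed

section \<open>The determinant of the pencil\<close>

text \<open>
  Coordinates are indexed by positions in the list, as vectors require, whereas independence concerns
  coefficient functions on the set of its entries; distinctness translates between the two.
\<close>

lemma basis_coordinates:
  assumes b: "is_basis \<phi> V"
  shows "u \<in> V \<and> u \<noteq> 0 \<longleftrightarrow> (\<exists>c. u = (\<Sum>j<length \<phi>. smult (c j) (\<phi> ! j)) \<and> (\<exists>j<length \<phi>. c j \<noteq> 0))"
proof -
  have d: "distinct \<phi>" and ind: "cpoly.independent (set \<phi>)" and sp: "cpoly.span (set \<phi>) = V"
    using b by (auto simp: is_basis_def)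
  have bij: "bij_betw ((!) \<phi>) {..<length \<phi>} (set \<phi>)" by (rule bij_betw_nth[OF d refl refl])
  have re: "(\<Sum>j<length \<phi>. smult (f (\<phi> ! j)) (\<phi> ! j)) = (\<Sum>x\<in>set \<phi>. smult (f x) x)" for f
    by (rule sum.reindex_bij_betw[OF bij])
  show ?thesis
  proof
    assume u: "u \<in> V \<and> u \<noteq> 0"
    then obtain f where f: "u = (\<Sum>x\<in>set \<phi>. smult (f x) x)"
      using cpoly.span_finite[of "set \<phi>"] unfolding sp[symmetric] by auto
    have "u = (\<Sum>j<length \<phi>. smult (f (\<phi> ! j)) (\<phi> ! j))" unfolding re by (rule f)
    moreover from this u have "\<exists>j<length \<phi>. f (\<phi> ! j) \<noteq> 0" by (metis (mono_tags, lifting) lessThan_iff smult_0_left sum.neutral)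
    ultimately show "\<exists>c. u = (\<Sum>j<length \<phi>. smult (c j) (\<phi> ! j)) \<and> (\<exists>j<length \<phi>. c j \<noteq> 0)"
      by (intro exI[of _ "\<lambda>j. f (\<phi> ! j)"]) simp
  next
    assume "\<exists>c. u = (\<Sum>j<length \<phi>. smult (c j) (\<phi> ! j)) \<and> (\<exists>j<length \<phi>. c j \<noteq> 0)"
    then obtain c j where c: "u = (\<Sum>j<length \<phi>. smult (c j) (\<phi> ! j))" and j: "j < length \<phi>" "c j \<noteq> 0" by blast
    define f where "f x = c (the_inv_into {..<length \<phi>} ((!) \<phi>) x)" for x
    have fc: "f (\<phi> ! i) = c i" if "i < length \<phi>" for i
      unfolding f_def using the_inv_into_f_f[OF bij_betw_imp_inj_on[OF bij]] that by simp
    have uf: "u = (\<Sum>x\<in>set \<phi>. smult (f x) x)"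
      unfolding re[symmetric] c by (rule sum.cong) (simp_all add: fc)
    have "u \<in> V" unfolding c sp[symmetric]
      by (intro cpoly.span_sum cpoly.span_scale cpoly.span_base) simp
    moreover have "u \<noteq> 0"
    proof
      assume "u = 0"
      then have "f (\<phi> ! j) = 0" using cpoly.independentD[OF ind _ order_refl, of f "\<phi> ! j"] uf j by simp
      then show False using fc j by simp
    qed
    ultimately show "u \<in> V \<and> u \<noteq> 0" by blast
  qed
qed

lemma weighted_integral_sum:
  assumes g: "\<gamma> + real s > -1/2" and v: "v \<in> test_space n s"
  shows "weighted_integral \<gamma> (\<Sum>j\<in>J. smult (c j) (f j)) v = (\<Sum>j\<in>J. c j * weighted_integral \<gamma> (f j) v)"
proof -
  obtain q where q: "v = [:1, 0, -1:] ^ s * q" using v by (auto simp: test_space_def)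
  show ?thesis
    unfolding q weighted_integral_eq_jint[OF g] using g by (simp add: sum_distrib_right jint_sum jint_smult)
qed

lemma weighted_integral_diff:
  assumes g: "\<gamma> + real s > -1/2" and v: "v \<in> test_space n s"
  shows "weighted_integral \<gamma> (f - smult l h) v = weighted_integral \<gamma> f v - l * weighted_integral \<gamma> h v"
proof -
  obtain q where q: "v = [:1, 0, -1:] ^ s * q" using v by (auto simp: test_space_def)
  show ?thesis
    unfolding q weighted_integral_eq_jint[OF g] using g by (simp add: left_diff_distrib jint_diff jint_smult)
qed

lemma test_space_basis_condition:
  assumes g: "\<gamma> + real s > -1/2" and b: "is_basis \<psi> (test_space n s)"
  shows "(\<forall>v \<in> test_space n s. weighted_integral \<gamma> f v = 0) \<longleftrightarrow> (\<forall>i<length \<psi>. weighted_integral \<gamma> f (\<psi> ! i) = 0)"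
proof
  have sp: "cpoly.span (set \<psi>) = test_space n s" using b by (simp add: is_basis_def)
  assume "\<forall>v \<in> test_space n s. weighted_integral \<gamma> f v = 0"
  then show "\<forall>i<length \<psi>. weighted_integral \<gamma> f (\<psi> ! i) = 0"
    unfolding sp[symmetric] by (simp add: cpoly.span_base)
next
  have sp: "cpoly.span (set \<psi>) = test_space n s" using b by (simp add: is_basis_def)
  assume 0: "\<forall>i<length \<psi>. weighted_integral \<gamma> f (\<psi> ! i) = 0"
  let ?p = "[:1, 0, -1:] ^ s :: complex poly" and ?J = "jint (\<gamma> + real s - 1/2) (\<gamma> + real s - 1/2)"
  let ?W = "{?p * q | q. ?J (f * q) = 0}"
  have "cpoly.span (set \<psi>) \<subseteq> ?W"
  proof (rule cpoly.span_minimal)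
    show "set \<psi> \<subseteq> ?W"
    proof
      fix v assume v: "v \<in> set \<psi>"
      then have "v \<in> test_space n s" unfolding sp[symmetric] by (rule cpoly.span_base)
      then obtain q where q: "v = ?p * q" by (auto simp: test_space_def)
      have "weighted_integral \<gamma> f v = 0" using 0 v by (auto simp: in_set_conv_nth)
      then show "v \<in> ?W" unfolding q weighted_integral_eq_jint[OF g] by blast
    qed
    show "cpoly.subspace ?W"
    proof (rule cpoly.subspaceI)
      show "0 \<in> ?W" by (auto intro!: exI[of _ 0])
    next
      fix x y assume "x \<in> ?W" "y \<in> ?W"
      then obtain q r where "x = ?p * q" "y = ?p * r" "?J (f * q) = 0" "?J (f * r) = 0" by blast
      then show "x + y \<in> ?W" using g by (auto intro!: exI[of _ "q + r"] simp: distrib_left jint_add)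
    next
      fix c x assume "x \<in> ?W"
      then obtain q where "x = ?p * q" "?J (f * q) = 0" by blast
      then show "smult c x \<in> ?W" using g by (auto intro!: exI[of _ "smult c q"] simp: jint_smult)
    qed
  qed
  then show "\<forall>v \<in> test_space n s. weighted_integral \<gamma> f v = 0"
    unfolding sp by (auto simp: weighted_integral_eq_jint[OF g])
qed

lemma poly_pencil_det:
  assumes "A \<in> carrier_mat N N" "B \<in> carrier_mat N N"
  shows "poly (pencil_det A B) l = Determinant.det (A - l \<cdot>\<^sub>m B)"
proof -
  interpret comm_ring_hom "\<lambda>p :: complex poly. poly p l" by unfold_locales simp_all
  have "map_mat (\<lambda>p. poly p l) (map_mat (\<lambda>a. [:a:]) A - [:0, 1:] \<cdot>\<^sub>m map_mat (\<lambda>b. [:b:]) B) = A - l \<cdot>\<^sub>m B"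
    using assms by (intro eq_matI) auto
  then show ?thesis unfolding pencil_det_def hom_det[symmetric] by simp
qed

lemma degree_pencil_det_le:
  assumes "A \<in> carrier_mat N N" "B \<in> carrier_mat N N"
  shows "degree (pencil_det A B) \<le> N"
proof -
  have "degree (pencil_det A B) \<le> 1 * N"
    unfolding pencil_det_def
  proof (rule degree_det_le)
    fix i j assume "i < N" "j < N"
    then show "degree ((map_mat (\<lambda>a. [:a:]) A - [:0, 1:] \<cdot>\<^sub>m map_mat (\<lambda>b. [:b:]) B) $$ (i, j)) \<le> 1"
      using assms by (auto intro!: degree_diff_le)
  qed (use assms in auto)
  then show ?thesis by simp
qed

lemma pencil_det_root_iff:
  assumes g: "\<gamma> + real s > -1/2" and n: "n \<ge> 4"
    and \<phi>: "is_basis \<phi> (trial_space n)" and \<psi>: "is_basis \<psi> (test_space n s)"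
  shows "poly (pencil_det (stiffness_matrix \<gamma> \<phi> \<psi>) (mass_matrix \<gamma> \<phi> \<psi>)) l = 0 \<longleftrightarrow> eigenvalue n \<gamma> s l"
proof -
  let ?N = "n - 3" and ?A = "stiffness_matrix \<gamma> \<phi> \<psi>" and ?B = "mass_matrix \<gamma> \<phi> \<psi>"
  have len: "length \<phi> = ?N" "length \<psi> = ?N"
    using length_trial_basis[OF n \<phi>] length_test_basis[OF n \<psi>] by auto
  have AB: "?A \<in> carrier_mat ?N ?N" "?B \<in> carrier_mat ?N ?N"
    by (simp_all add: stiffness_matrix_def mass_matrix_def len)
  have carr: "?A - l \<cdot>\<^sub>m ?B \<in> carrier_mat ?N ?N" using AB by (intro minus_carrier_mat smult_carrier_mat)
  have \<psi>i: "\<psi> ! i \<in> test_space n s" if "i < ?N" for i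
    using that \<psi> len cpoly.span_base[of "\<psi> ! i" "set \<psi>"] by (simp add: is_basis_def)
  define L where "L u = D4 u - smult l (D2 u)" for u
  have Lsum: "L (\<Sum>j\<in>J. smult (c j) (f j)) = (\<Sum>j\<in>J. smult (c j) (L (f j)))" for J :: "nat set" and c f
    unfolding L_def higher_pderiv_sum higher_pderiv_smult smult_sum_right sum_subtractf[symmetric]
    by (rule sum.cong) (simp_all add: smult_diff_right mult.commute)
  have row: "vec_index ((?A - l \<cdot>\<^sub>m ?B) *\<^sub>v Matrix.vec ?N c) i = weighted_integral \<gamma> (L (\<Sum>j<?N. smult (c j) (\<phi> ! j))) (\<psi> ! i)"
    if i: "i < ?N" for i c
  proof -
    have "vec_index ((?A - l \<cdot>\<^sub>m ?B) *\<^sub>v Matrix.vec ?N c) i = (\<Sum>j<?N. (?A - l \<cdot>\<^sub>m ?B) $$ (i, j) * c j)"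
      using i carr by (simp add: scalar_prod_def lessThan_atLeast0 del: index_minus_mat index_smult_mat)
    also have "\<dots> = (\<Sum>j<?N. c j * weighted_integral \<gamma> (L (\<phi> ! j)) (\<psi> ! i))"
      by (rule sum.cong) (use i len AB in \<open>simp_all add: L_def weighted_integral_diff[OF g \<psi>i[OF i]] stiffness_matrix_def mass_matrix_def\<close>)
    also have "\<dots> = weighted_integral \<gamma> (L (\<Sum>j<?N. smult (c j) (\<phi> ! j))) (\<psi> ! i)"
      unfolding Lsum weighted_integral_sum[OF g \<psi>i[OF i]] ..
    finally show ?thesis .
  qed
  have "poly (pencil_det ?A ?B) l = 0 \<longleftrightarrow> (\<exists>v. v \<in> carrier_vec ?N \<and> v \<noteq> 0\<^sub>v ?N \<and> (?A - l \<cdot>\<^sub>m ?B) *\<^sub>v v = 0\<^sub>v ?N)"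
    unfolding poly_pencil_det[OF AB] by (rule det_0_iff_vec_prod_zero_field[OF carr])
  also have "\<dots> \<longleftrightarrow> (\<exists>c. (\<exists>j<?N. c j \<noteq> 0) \<and> (\<forall>i<?N. weighted_integral \<gamma> (L (\<Sum>j<?N. smult (c j) (\<phi> ! j))) (\<psi> ! i) = 0))"
  proof
    assume "\<exists>v. v \<in> carrier_vec ?N \<and> v \<noteq> 0\<^sub>v ?N \<and> (?A - l \<cdot>\<^sub>m ?B) *\<^sub>v v = 0\<^sub>v ?N"
    then obtain v where v: "v \<in> carrier_vec ?N" "v \<noteq> 0\<^sub>v ?N" "(?A - l \<cdot>\<^sub>m ?B) *\<^sub>v v = 0\<^sub>v ?N" by blast
    have vv: "v = Matrix.vec ?N (\<lambda>j. vec_index v j)" using v(1) by auto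
    have "\<exists>j<?N. vec_index v j \<noteq> 0" using v(1,2) by (metis carrier_vecD eq_vecI index_zero_vec)
    moreover have "\<forall>i<?N. weighted_integral \<gamma> (L (\<Sum>j<?N. smult (vec_index v j) (\<phi> ! j))) (\<psi> ! i) = 0"
      using row[of _ "\<lambda>j. vec_index v j"] v(3) unfolding vv[symmetric] by simp
    ultimately show "\<exists>c. (\<exists>j<?N. c j \<noteq> 0) \<and> (\<forall>i<?N. weighted_integral \<gamma> (L (\<Sum>j<?N. smult (c j) (\<phi> ! j))) (\<psi> ! i) = 0)"
      by blast
  next
    assume "\<exists>c. (\<exists>j<?N. c j \<noteq> 0) \<and> (\<forall>i<?N. weighted_integral \<gamma> (L (\<Sum>j<?N. smult (c j) (\<phi> ! j))) (\<psi> ! i) = 0)"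
    then obtain c j where c: "j < ?N" "c j \<noteq> 0"
      "\<forall>i<?N. weighted_integral \<gamma> (L (\<Sum>j<?N. smult (c j) (\<phi> ! j))) (\<psi> ! i) = 0" by blast
    let ?v = "Matrix.vec ?N c"
    have "?v \<noteq> 0\<^sub>v ?N" using c(1,2) by (metis index_vec index_zero_vec(1))
    moreover have "(?A - l \<cdot>\<^sub>m ?B) *\<^sub>v ?v = 0\<^sub>v ?N"
    proof (rule eq_vecI)
      fix i assume "i < dim_vec (0\<^sub>v ?N)"
      then have i: "i < ?N" by simp
      show "vec_index ((?A - l \<cdot>\<^sub>m ?B) *\<^sub>v ?v) i = vec_index (0\<^sub>v ?N) i" unfolding row[OF i] using c(3) i by simp
    qed (use AB in simp)
    ultimately show "\<exists>v. v \<in> carrier_vec ?N \<and> v \<noteq> 0\<^sub>v ?N \<and> (?A - l \<cdot>\<^sub>m ?B) *\<^sub>v v = 0\<^sub>v ?N"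
      by (intro exI[of _ ?v]) simp
  qed
  also have "\<dots> \<longleftrightarrow> (\<exists>u. (u \<in> trial_space n \<and> u \<noteq> 0) \<and> (\<forall>i<length \<psi>. weighted_integral \<gamma> (L u) (\<psi> ! i) = 0))"
    unfolding basis_coordinates[OF \<phi>] len by blast
  also have "\<dots> \<longleftrightarrow> (\<exists>u. (u \<in> trial_space n \<and> u \<noteq> 0) \<and> (\<forall>v \<in> test_space n s. weighted_integral \<gamma> (L u) v = 0))"
    unfolding test_space_basis_condition[OF g \<psi>] ..
  also have "\<dots> \<longleftrightarrow> eigenvalue n \<gamma> s l"
  proof -
    have neg: "smult l (D2 u) - D4 u = 0 - smult 1 (L u)" for u by (simp add: L_def)
    have "weighted_integral \<gamma> (smult l (D2 u) - D4 u) v = 0 \<longleftrightarrow> weighted_integral \<gamma> (L u) v = 0"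
      if "v \<in> test_space n s" for u v
      unfolding neg weighted_integral_diff[OF g that] by (simp add: weighted_integral_def)
    then show ?thesis unfolding eigenvalue_def by blast
  qed
  finally show ?thesis .
qed

text \<open>
  The orders of the roots add up to the degree, so none of them can exceed one.
\<close>

lemma rsquarefree_if_many_roots:
  fixes p :: "complex poly"
  assumes "p \<noteq> 0" "degree p \<le> card {z. poly p z = 0}"
  shows "rsquarefree p"
proof -
  let ?R = "{z. poly p z = 0}"
  have fin: "finite ?R" by (rule poly_roots_finite[OF assms(1)])
  have ge: "order z p \<ge> 1" if "z \<in> ?R" for z using that assms(1) order_root[of p z] by (simp add: Suc_leI)
  have "order z p \<le> 1" if z: "z \<in> ?R" for z
  proof (rule ccontr)
    assume "\<not> order z p \<le> 1"
    then have "(\<Sum>z\<in>?R. 1) < (\<Sum>z\<in>?R. order z p)"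
      using ge z fin by (intro sum_strict_mono_ex1) auto
    then show False using sum_order_roots[OF assms(1)] assms(2) by simp
  qed
  then show ?thesis
    unfolding rsquarefree_def using assms(1) ge by (metis (mono_tags) le_antisym mem_Collect_eq order_root)
qed

section \<open>Eigenvalues of the six methods\<close>

text \<open>
  The reciprocals of the \<open>n - 3\<close> distinct negative roots of the characteristic polynomial are
  eigenvalues, hence roots of the determinant. Its degree is at most \<open>n - 3\<close>, so they are all of its roots and simple.
\<close>

lemma galerkin_eigenvalues:
  assumes a: "\<gamma> + real s - 3/2 \<in> {-1/2, 0, 1/2, 1}" and n: "n \<ge> 4"
  shows "(\<forall>l. eigenvalue n \<gamma> s l \<longrightarrow> l \<in> \<real> \<and> Re l < 0) \<and> \<not> reciprocal_eigenvalue n \<gamma> s 0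
    \<and> distinct_eigenvalues n \<gamma> s"
proof -
  obtain P where P: "simple_negative_roots P" "degree P = n - 3"
    and rec: "\<And>\<mu>. reciprocal_eigenvalue n \<gamma> s \<mu> \<longleftrightarrow> poly P \<mu> = 0"
    using characteristic_polynomial[OF a refl n] by blast
  have g: "\<gamma> + real s > -1/2" using a by auto
  have P0: "poly P 0 \<noteq> 0" using P(1) by (auto simp: simple_negative_roots_def)
  have ev: "eigenvalue n \<gamma> s l \<longleftrightarrow> l \<noteq> 0 \<and> poly P (1 / l) = 0" for l
  proof (cases "l = 0")
    case True
    then show ?thesis using eigenvalue_nonzero[OF refl _ n, of \<gamma> s l] g by auto
  next
    case False
    then show ?thesis using eigenvalue_iff_reciprocal[OF g False, of n] rec by simp
  qed
  have "l \<in> \<real> \<and> Re l < 0" if "eigenvalue n \<gamma> s l" for l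
  proof -
    have "1 / l \<in> \<real>" "Re (1 / l) < 0" using that P(1) unfolding ev simple_negative_roots_def by blast+
    then obtain r where r: "1 / l = complex_of_real r" "r < 0" by (auto elim: Reals_cases)
    then have "l = complex_of_real (1 / r)" using that unfolding ev by (metis divide_divide_eq_right mult_1 nonzero_mult_div_cancel_left of_real_1 of_real_divide div_by_1)
    then show ?thesis using r(2) by simp
  qed
  moreover have "distinct_eigenvalues n \<gamma> s"
    unfolding distinct_eigenvalues_def
  proof (intro allI impI)
    fix \<phi> \<psi> assume b: "is_basis \<phi> (trial_space n) \<and> is_basis \<psi> (test_space n s)"
    let ?A = "stiffness_matrix \<gamma> \<phi> \<psi>" and ?B = "mass_matrix \<gamma> \<phi> \<psi>"
    let ?p = "pencil_det ?A ?B"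
    have len: "length \<phi> = n - 3" "length \<psi> = n - 3"
      using length_trial_basis[OF n] length_test_basis[OF n] b by auto
    have AB: "?A \<in> carrier_mat (n - 3) (n - 3)" "?B \<in> carrier_mat (n - 3) (n - 3)"
      by (simp_all add: stiffness_matrix_def mass_matrix_def len)
    have root: "poly ?p l = 0 \<longleftrightarrow> l \<noteq> 0 \<and> poly P (1 / l) = 0" for l
      using pencil_det_root_iff[OF g n] b ev by blast
    have "bij_betw (\<lambda>z. 1 / z) {z. poly P z = 0} {l. poly ?p l = 0}"
    proof (rule bij_betwI[where g = "\<lambda>z. 1 / z"])
      show "(\<lambda>z. 1 / z) \<in> {z. poly P z = 0} \<rightarrow> {l. poly ?p l = 0}"
      proof
        fix z assume "z \<in> {z. poly P z = 0}"
        then have "z \<noteq> 0" "poly P z = 0" using P0 by auto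
        then have "1 / z \<noteq> 0 \<and> poly P (1 / (1 / z)) = 0" by simp
        then show "1 / z \<in> {l. poly ?p l = 0}" unfolding root[symmetric] by simp
      qed
      show "(\<lambda>z. 1 / z) \<in> {l. poly ?p l = 0} \<rightarrow> {z. poly P z = 0}"
        unfolding root by blast
    qed simp_all
    then have card: "card {l. poly ?p l = 0} = n - 3"
      using bij_betw_same_card card_simple_roots[OF P(1)] P(2) by metis
    have "poly ?p 0 \<noteq> 0" using root by simp
    then have "?p \<noteq> 0" by auto
    moreover have "degree ?p \<le> card {l. poly ?p l = 0}"
      unfolding card by (rule degree_pencil_det_le[OF AB])
    ultimately show "rsquarefree ?p" by (rule rsquarefree_if_many_roots)
  qed
  ultimately show ?thesis using rec P0 by blast
qed

lemma parity_degrees: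
  assumes "n \<ge> (4::nat)"
  obtains e k where "{e, k} = {n - 2, n - 3}" "even e" "odd k" "e \<ge> 2"
proof (cases "even n")
  case True
  then show ?thesis using assms that[of "n - 2" "n - 3"] by auto
next
  case False
  then have "n - 3 \<ge> 2" using assms by presburger
  then show ?thesis using False assms that[of "n - 3" "n - 2"] by (auto simp: insert_commute)
qed

text \<open>
  The constant coefficient of the even moment polynomial is proportional to \<open>\<alpha> = 0\<close>.
\<close>

lemma legendre_tau_infinite_eigenvalue:
  assumes n: "n \<ge> 4"
  shows "reciprocal_eigenvalue n (1/2) 0 0"
proof -
  obtain e k where eo: "{e, k} = {n - 2, n - 3}" "even e" "odd k" "e \<ge> 2" by (rule parity_degrees[OF n])
  have "jint 0 0 (resolvent2 0 (jacobi e 0 0)) = 0"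
    using jint_resolvent2_jacobi_even[of 0 e 0] eo by (simp add: poly_0_coeff_0 coeff_poly_upto even_moment_def)
  then show ?thesis using reciprocal_eigenvalue_iff[of 0 "1/2" 0 n e k 0] n eo by simp
qed

text \<open>
  For \<open>\<alpha> = -1/2\<close> the even moment polynomial has a negative constant coefficient and otherwise
  nonnegative ones, hence a positive root.
\<close>

lemma chebyshev_tau_positive_eigenvalue:
  assumes n: "n \<ge> 4"
  shows "\<exists>l::real. l > 0 \<and> eigenvalue n 0 0 (complex_of_real l)"
proof -
  obtain e k where eo: "{e, k} = {n - 2, n - 3}" "even e" "odd k" "e \<ge> 2" by (rule parity_degrees[OF n])
  let ?M = "even_moment e (-1/2)"
  define f where "f x = (\<Sum>i\<le>e. ?M i * x ^ i)" for x :: real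
  have e2: "real e \<ge> 2" using eo(4) by simp
  have M0: "-1 \<le> ?M 0" "?M 0 < 0"
  proof -
    have p: "(real e + 1) * (real e - 1) \<ge> 3" using e2 mult_mono[of 3 "real e + 1" 1 "real e - 1"] by simp
    have M: "?M 0 = - 2 / ((real e + 1) * (real e - 1))" by (simp add: even_moment_def)
    show "-1 \<le> ?M 0" unfolding M using p by (simp add: field_simps)
    show "?M 0 < 0" unfolding M using p by (intro divide_neg_pos) linarith+
  qed
  have Mi: "?M i \<ge> 0" if "i > 0" for i
  proof (cases "2 * i - 1 \<le> e")
    case True
    then have "jet (real e) (real e) (-1/2) (2 * i - 1) > 0" by (intro jet_pos) (use e2 in auto)
    then show ?thesis using that by (simp add: even_moment_def)
  next
    case False
    then show ?thesis using that jet_eq_0[of e "2 * i - 1" "real e" "-1/2"] by (simp add: even_moment_def)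
  qed
  have M1: "?M 1 \<ge> 2"
  proof -
    have "?M 1 = 2 * (real e * real e)" by (simp add: even_moment_def jet_def)
    moreover have "real e * real e \<ge> 1" using e2 mult_mono[of 1 "real e" 1 "real e"] by simp
    ultimately show ?thesis by linarith
  qed
  have "f 0 = ?M 0" unfolding f_def by (simp add: power_0_left if_distrib sum.delta cong: if_cong)
  then have f0: "f 0 < 0" using M0 by simp
  have "f 1 = (\<Sum>i\<le>e. ?M i)" by (simp add: f_def)
  also have "\<dots> \<ge> (\<Sum>i\<in>{0, 1}. ?M i)" by (rule sum_mono2) (use eo(4) Mi in auto)
  finally have f1: "f 1 \<ge> 0" using M0 M1 by simp
  have "continuous_on {0..1} f" unfolding f_def by (intro continuous_intros)
  then obtain x where x: "0 \<le> x" "x \<le> 1" "f x = 0" using IVT'[of f 0 0 1] f0 f1 by auto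
  then have x0: "x > 0" using f0 by (cases "x = 0") auto
  have "poly (poly_upto ?M e) (of_real x) = of_real (f x)"
    unfolding poly_upto_def f_def poly_sum poly_monom by simp
  then have "jint 0 0 (resolvent2 (of_real x) (jacobi e (-1/2) (-1/2))) = 0"
    using jint_resolvent2_jacobi_even[of "-1/2" e "of_real x"] eo e2 x by simp
  then have "reciprocal_eigenvalue n 0 0 (of_real x)"
    using reciprocal_eigenvalue_iff[of "-1/2" 0 0 n e k "of_real x"] n eo by simp
  then have "eigenvalue n 0 0 (complex_of_real (1 / x))" using x0
    by (subst eigenvalue_iff_reciprocal) auto
  then show ?thesis using x0 by (intro exI[of _ "1 / x"]) simp
qed

theorem corollary6p3:
  fixes n :: nat
  assumes "n \<ge> 4"
  shows "(\<exists>l::real. l > 0 \<and> eigenvalue n 0 0 (complex_of_real l))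
    \<and> reciprocal_eigenvalue n (1/2) 0 0
    \<and> (\<forall>\<gamma> \<in> {0, 1/2}. \<forall>s \<in> {1, 2}.
         (\<forall>l. eigenvalue n \<gamma> s l \<longrightarrow> l \<in> \<real> \<and> Re l < 0)
         \<and> \<not> reciprocal_eigenvalue n \<gamma> s 0
         \<and> distinct_eigenvalues n \<gamma> s)"
proof (intro conjI ballI)
  show "\<exists>l::real. l > 0 \<and> eigenvalue n 0 0 (complex_of_real l)"
    by (rule chebyshev_tau_positive_eigenvalue[OF assms])
  show "reciprocal_eigenvalue n (1/2) 0 0" by (rule legendre_tau_infinite_eigenvalue[OF assms])
  fix \<gamma> :: real and s :: nat assume "\<gamma> \<in> {0, 1/2}" "s \<in> {1, 2}"
  then have a: "\<gamma> + real s - 3/2 \<in> {-1/2, 0, 1/2, 1}" by auto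
  show "\<forall>l. eigenvalue n \<gamma> s l \<longrightarrow> l \<in> \<real> \<and> Re l < 0" "\<not> reciprocal_eigenvalue n \<gamma> s 0" "distinct_eigenvalues n \<gamma> s"
    using galerkin_eigenvalues[OF a assms] by blast+
qed

end
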